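(* There exist smooth boundary data $\phi(\cdot,\tau)$, $\tau\in\partial\mathbb D$, on $\mathbb P^1\times\partial\mathbb D$ for which the following is true: there exist a nonempty open set $U'$ in $\mathbb P^1\times\mathbb D$ and an $\epsilon>0$ such that if $\phi'(z,\tau)$ is any smooth boundary data with $$\|\phi'-\phi\|_{C^2(\mathbb P^1\times\partial\mathbb D)}<\epsilon$$ and $\Phi'$ is the associated solution to the Homogeneous Monge-Ampère equation on $\mathbb P^1\times\overline{\mathbb D}$, then no harmonic disc associated to $\Phi'$ passes through $U'$.
   Context: $\mathbb D\subset\mathbb C$ is the open unit disc. $\omega_{FS}$ is the Fubini-Study form on $\mathbb P^1=\mathbb C\cup\{\infty\}$, with $\omega_{FS}=dd^c\ln(1+|z|^2)$ on $\mathbb C$ and $dd^c$ normalized so that $dd^c\ln|z|^2=\delta_0$. $\pi\colon\mathbb P^1\times\overline{\mathbb D}\to\mathbb P^1$ is the projection. Smooth boundary data: a smooth real function $\phi(z,\tau)$ on $\mathbb P^1\times\partial\mathbb D$ such that $\omega_{FS}+dd^c\phi(\cdot,\tau)$ is a Kähler form for each $\tau\in\partial\mathbb D$. Solution of the HMAE with this boundary data: $$\Phi=\sup\{\psi:\psi\text{ usc on }\mathbb P^1\times\overline{\mathbb D},\ \pi^*\omega_{FS}+dd^c\psi\ge0,\ \psi(\cdot,\tau)\le\phi(\cdot,\tau)\text{ for }\tau\in\partial\mathbb D\}.$$ Harmonic disc: for $g\colon\mathbb D\to\mathbb P^1$ holomorphic, the graph $\{(g(\tau),\tau):\tau\in\mathbb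 D\}$ is a harmonic disc associated to a solution $\Phi$ if the restriction of $\pi^*\omega_{FS}+dd^c\Phi$ to it vanishes, i.e. $g^*\omega_{FS}+dd^c_\tau\big(\Phi(g(\tau),\tau)\big)=0$ on $\mathbb D$. *)

theory Defs
  imports "HOL-Complex_Analysis.Complex_Analysis"
begin

section \<open>Smooth functions on Euclidean spaces\<close>

definition dir_deriv :: "'a::euclidean_space \<Rightarrow> ('a \<Rightarrow> real) \<Rightarrow> 'a \<Rightarrow> real" where
  "dir_deriv b f x = frechet_derivative f (at x) b"

primrec Ck :: "nat \<Rightarrow> ('a::euclidean_space \<Rightarrow> real) \<Rightarrow> bool" where
  "Ck 0 f \<longleftrightarrow> continuous_on UNIV f"
| "Ck (Suc k) f \<longleftrightarrow> (\<forall>x. f differentiable (at x)) \<and> (\<forall>b\<in>Basis. Ck k (dir_deriv b f))"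

definition smooth :: "('a::euclidean_space \<Rightarrow> real) \<Rightarrow> bool" where
  "smooth f \<longleftrightarrow> (\<forall>k. Ck k f)"

text \<open>Density, with respect to Lebesgue measure on the plane, of the (1,1)-form \<open>dd\<^sup>c f\<close>. The
  Laplacian of \<open>ln \<bar>z\<bar>\<^sup>2\<close> is \<open>4 * pi\<close> times the Dirac mass at the origin, so the factor
  \<open>1 / (4 * pi)\<close> is the normalization in which \<open>dd\<^sup>c ln \<bar>z\<bar>\<^sup>2\<close> is the Dirac mass.\<close>

definition ddc :: "(complex \<Rightarrow> real) \<Rightarrow> complex \<Rightarrow> real" where
  "ddc f z = (\<Sum>b\<in>Basis. dir_deriv b (dir_deriv b f) z) / (4 * pi)"


section \<open>The projective line\<close>

text \<open>The projective line is \<open>complex option\<close>, where \<open>None\<close> is the point at infinity. Its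
  smooth and complex structures are those given by the two charts \<open>Some\<close> and \<open>chart_inf\<close>.\<close>

definition P1 :: "complex option topology" where
  "P1 = Alexandroff_compactification euclidean"

definition chart_inf :: "complex \<Rightarrow> complex option" where
  "chart_inf w = (if w = 0 then None else Some (1 / w))"

definition P1_charts :: "(complex \<Rightarrow> complex option) set" where
  "P1_charts = {Some, chart_inf}"

text \<open>The Fubini-Study form enters through its potential: in either coordinate it is \<open>dd\<^sup>c\<close> of
  \<open>FS_pot\<close>, because \<open>ln (1 + \<bar>z\<bar>\<^sup>2)\<close> and \<open>ln (1 + \<bar>1/z\<bar>\<^sup>2)\<close> differ by the harmonic function
  \<open>ln \<bar>z\<bar>\<^sup>2\<close>.\<close>

definition FS_pot :: "complex \<Rightarrow> real" where
  "FS_pot z = ln (1 + (cmod z)\<^sup>2)"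

definition holomorphic_into_P1 :: "(complex \<Rightarrow> complex option) \<Rightarrow> complex set \<Rightarrow> bool" where
  "holomorphic_into_P1 g S \<longleftrightarrow>
     (\<forall>\<tau>\<in>S. \<exists>V. open V \<and> \<tau> \<in> V \<and> V \<subseteq> S \<and>
        (\<exists>c\<in>P1_charts. \<exists>h. h holomorphic_on V \<and> (\<forall>\<sigma>\<in>V. g \<sigma> = c (h \<sigma>))))"


section \<open>Smooth boundary data\<close>

text \<open>A function on \<open>P1 \<times> sphere 0 1\<close> is read in the coordinates \<open>(z, t)\<close>, where \<open>z\<close> is one of the
  two coordinates of the projective line and \<open>t\<close> is the angle on the circle.\<close>

definition local_rep ::
  "(complex \<Rightarrow> complex option) \<Rightarrow> (complex option \<times> complex \<Rightarrow> real) \<Rightarrow> complex \<times> real \<Rightarrow> real" where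
  "local_rep c f = (\<lambda>(z, t). f (c z, cis t))"

definition smooth_boundary_data :: "(complex option \<times> complex \<Rightarrow> real) \<Rightarrow> bool" where
  "smooth_boundary_data \<phi> \<longleftrightarrow>
     (\<forall>c\<in>P1_charts. smooth (local_rep c \<phi>)) \<and>
     (\<forall>\<tau>\<in>sphere 0 1. \<forall>c\<in>P1_charts. \<forall>z. ddc (\<lambda>z. FS_pot z + \<phi> (c z, \<tau>)) z > 0)"

text \<open>The closed unit discs of the two charts cover the projective line, so this is the usual
  norm obtained from a finite cover by compact coordinate patches.\<close>

definition C2_norm :: "(complex option \<times> complex \<Rightarrow> real) \<Rightarrow> real" where
  "C2_norm f = Sup (\<Union>c\<in>P1_charts. \<Union>x\<in>cball 0 1 \<times> {0..2 * pi}.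
       {\<bar>local_rep c f x\<bar>}
       \<union> {\<bar>dir_deriv a (local_rep c f) x\<bar> | a. a \<in> Basis}
       \<union> {\<bar>dir_deriv a (dir_deriv b (local_rep c f)) x\<bar> | a b. a \<in> Basis \<and> b \<in> Basis})"


section \<open>Plurisubharmonic functions\<close>

definition usc_on :: "'a topology \<Rightarrow> ('a \<Rightarrow> ereal) \<Rightarrow> bool" where
  "usc_on X f \<longleftrightarrow>
     (\<forall>x\<in>topspace X. f x < \<infinity>) \<and> (\<forall>r::real. openin X {x \<in> topspace X. f x < ereal r})"

text \<open>Lebesgue integral with values in the extended reals; \<open>e2ennreal\<close> truncates negative values
  to \<open>0\<close>. It is only used for functions that are bounded above, so that the first term is finite.\<close>

definition ereal_integral :: "'a measure \<Rightarrow> ('a \<Rightarrow> ereal) \<Rightarrow> ereal" where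
  "ereal_integral M f =
     enn2ereal (\<integral>\<^sup>+ x. e2ennreal (f x) \<partial>M) - enn2ereal (\<integral>\<^sup>+ x. e2ennreal (- f x) \<partial>M)"

text \<open>Upper semicontinuous, with the sub-mean value property on every closed disc
  \<open>{(a\<^sub>1 + \<zeta> b\<^sub>1, a\<^sub>2 + \<zeta> b\<^sub>2) | \<bar>\<zeta>\<bar> \<le> 1}\<close> of a complex line contained in \<open>U\<close>.
  The function that is constantly \<open>-\<infinity>\<close> is allowed.\<close>

definition psh_on :: "(complex \<times> complex) set \<Rightarrow> (complex \<times> complex \<Rightarrow> ereal) \<Rightarrow> bool" where
  "psh_on U f \<longleftrightarrow>
     usc_on (top_of_set U) f \<and>
     (\<forall>a1 a2 b1 b2. (\<forall>\<zeta>\<in>cball 0 1. (a1 + \<zeta> * b1, a2 + \<zeta> * b2) \<in> U) \<longrightarrow>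
        f (a1, a2) \<le> ereal_integral (uniform_measure lborel {0..2 * pi})
                        (\<lambda>\<theta>. f (a1 + cis \<theta> * b1, a2 + cis \<theta> * b2)))"


section \<open>The Dirichlet problem for the homogeneous Monge-Ampere equation\<close>

text \<open>The condition \<open>\<pi>\<^sup>*\<omega>\<^sub>F\<^sub>S + dd\<^sup>c \<psi> \<ge> 0\<close> over the open unit disc: in each chart the sum of
  \<open>\<psi>\<close> and the local potential of \<open>\<pi>\<^sup>*\<omega>\<^sub>F\<^sub>S\<close> is plurisubharmonic.\<close>

definition FS_psh :: "(complex option \<times> complex \<Rightarrow> ereal) \<Rightarrow> bool" where
  "FS_psh \<psi> \<longleftrightarrow>
     (\<forall>c\<in>P1_charts. psh_on (UNIV \<times> ball 0 1) (\<lambda>(z, \<tau>). ereal (FS_pot z) + \<psi> (c z, \<tau>)))"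

definition HMAE_subsolutions ::
  "(complex option \<times> complex \<Rightarrow> real) \<Rightarrow> (complex option \<times> complex \<Rightarrow> ereal) set" where
  "HMAE_subsolutions \<phi> =
     {\<psi>. usc_on (prod_topology P1 (top_of_set (cball 0 1))) \<psi> \<and> FS_psh \<psi> \<and>
          (\<forall>p. \<forall>\<tau>\<in>sphere 0 1. \<psi> (p, \<tau>) \<le> ereal (\<phi> (p, \<tau>)))}"

definition HMAE_solution ::
  "(complex option \<times> complex \<Rightarrow> real) \<Rightarrow> complex option \<times> complex \<Rightarrow> ereal" where
  "HMAE_solution \<phi> x = (SUP \<psi>\<in>HMAE_subsolutions \<phi>. \<psi> x)"


section \<open>Harmonic discs\<close>

text \<open>\<open>dd\<^sup>c u = 0\<close> on \<open>V\<close> in the sense of currents, for a locally integrable function \<open>u\<close>.\<close>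

definition ddc_vanishes_on :: "complex set \<Rightarrow> (complex \<Rightarrow> real) \<Rightarrow> bool" where
  "ddc_vanishes_on V u \<longleftrightarrow>
     (\<forall>K. compact K \<and> K \<subseteq> V \<longrightarrow> set_integrable lborel K u) \<and>
     (\<forall>\<eta>. smooth \<eta> \<and> compact (closure {z. \<eta> z \<noteq> 0}) \<and> closure {z. \<eta> z \<noteq> 0} \<subseteq> V \<longrightarrow>
        (LINT z|lborel. u z * ddc \<eta> z) = 0)"

text \<open>On an open set on which \<open>g\<close> has the local expression \<open>h\<close>, the pull-back of the Fubini-Study
  form by \<open>g\<close> is \<open>dd\<^sup>c\<close> of \<open>FS_pot \<circ> h\<close>. The solution \<open>\<Phi>\<close> of the Dirichlet problem takes
  finite values, so \<open>real_of_ereal\<close> loses no information.\<close>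

definition harmonic_disc ::
  "(complex option \<times> complex \<Rightarrow> ereal) \<Rightarrow> (complex \<Rightarrow> complex option) \<Rightarrow> bool" where
  "harmonic_disc \<Phi> g \<longleftrightarrow>
     holomorphic_into_P1 g (ball 0 1) \<and>
     (\<forall>V h. \<forall>c\<in>P1_charts.
        open V \<and> V \<subseteq> ball 0 1 \<and> h holomorphic_on V \<and> (\<forall>\<tau>\<in>V. g \<tau> = c (h \<tau>)) \<longrightarrow>
        ddc_vanishes_on V (\<lambda>\<tau>. FS_pot (h \<tau>) + real_of_ereal (\<Phi> (g \<tau>, \<tau>))))"

end

(*
  In the affine coordinate y = 1/z let Q(y,t) = y^2 - c^2 t^2 with c large. The boundary data are a
  smooth strictly positive variant of ln^+|Q| - ln(1+|y|^2), whose solution is this same formula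
  inside: it is pluriharmonic off the Levi-flat hypersurface |Q| = 1. A harmonic disc through a
  point with |Q| < 1 is forced to satisfy |Q(g(t),t)| <= 1 throughout, so g(t)^2 is close to c^2 t^2;
  by connectedness of the circle g(t) is then close to +-c t there, hence g(0) is small, which
  fails for g(0) near 1/2.

  All of this is quantitative and needs only bounds on the solution within an absolute constant, so
  it survives perturbations that are merely uniformly small. The lower bound for the perturbed solution
  comes from an explicit subsolution, the upper bound from comparison with |Q|^2, whose Levi form
  vanishes in the directions tangent to the leaves Q = const.
*)
theory Submission
  imports Defs
begin

section \<open>Calculus of smooth functions\<close>

text \<open>The bounds on the perturbed solution must not depend on \<open>c\<close>, since
  \<open>c\<close> is chosen last, large compared with the constant 243^2 that they produce. This
  dictates the smoothing of ln^+ |Q|: half the logarithm of 1 + |y/c|^2 + |Q|^2. The map (1, Q) is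
  not immersive at y = 0, so 1 + |Q|^2 alone would give a form that degenerates there; the extra
  component y/c repairs this, and its weight 1/c keeps |y/c|^2 below 1 + |Q| over the unit circle.
  Nothing is known about the regularity of the perturbed solution, and along a disc harmonicity
  holds only in the sense of currents. The potential is therefore averaged over small discs:
  pointwise bounds survive averaging, and the average is a genuine harmonic function, hence the real
  part of a holomorphic one. A further obstacle is that the disc may pass through infinity, where no
  upper bound is at hand. All estimates are made on a homogeneous lift (g0, g1), and the absence of
  poles near t = 0 is a conclusion.\<close>

lemma dir_deriv_eq:
  "(f has_derivative f') (at x) \<Longrightarrow> dir_deriv b f x = f' b"
  unfolding dir_deriv_def using frechet_derivative_at by metis

lemma Ck_SucI:
  assumes "\<And>x. (f has_derivative D x) (at x)" "\<And>b. b \<in> Basis \<Longrightarrow> Ck k (\<lambda>x. D x b)"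
  shows "Ck (Suc k) f"
proof -
  have "dir_deriv b f = (\<lambda>x. D x b)" for b
    using dir_deriv_eq[OF assms(1)] by blast
  then show ?thesis
    using assms by (auto simp: differentiable_def)
qed

lemma Ck_SucD: "Ck (Suc k) f \<Longrightarrow> Ck k f"
proof (induction k arbitrary: f)
  case 0
  then show ?case
    by (auto intro!: continuous_at_imp_continuous_on differentiable_imp_continuous_within)
next
  case (Suc k)
  then show ?case by auto
qed

lemma has_derivative_dir_deriv:
  "Ck (Suc k) f \<Longrightarrow> (f has_derivative (\<lambda>b. dir_deriv b f x)) (at x)"
  by (simp add: dir_deriv_def frechet_derivative_works[symmetric])

lemma Ck_const: "Ck k (\<lambda>x. c)"
  by (induction k arbitrary: c) (auto intro!: Ck_SucI derivative_eq_intros simp del: Ck.simps(2))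

lemma Ck_bounded_linear:
  assumes "bounded_linear f" shows "Ck k f"
proof (cases k)
  case 0
  then show ?thesis
    using assms by (simp add: linear_continuous_on)
next
  case (Suc n)
  show ?thesis unfolding Suc
    by (rule Ck_SucI[OF bounded_linear_imp_has_derivative[OF assms]]) (rule Ck_const)
qed

lemma Ck_add: "Ck k f \<Longrightarrow> Ck k g \<Longrightarrow> Ck k (\<lambda>x. f x + g x)"
proof (induction k arbitrary: f g)
  case 0
  then show ?case by (auto intro: continuous_intros)
next
  case (Suc k)
  show ?case
    by (rule Ck_SucI[OF has_derivative_add[OF has_derivative_dir_deriv[OF Suc.prems(1)]
            has_derivative_dir_deriv[OF Suc.prems(2)]]])
       (use Suc in auto)
qed

lemma Ck_mult: "Ck k f \<Longrightarrow> Ck k g \<Longrightarrow> Ck k (\<lambda>x. f x * g x)"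
proof (induction k arbitrary: f g)
  case 0
  then show ?case by (auto intro: continuous_intros)
next
  case (Suc k)
  show ?case
    by (rule Ck_SucI[OF has_derivative_mult[OF has_derivative_dir_deriv[OF Suc.prems(1)]
            has_derivative_dir_deriv[OF Suc.prems(2)]]])
       (use Suc Ck_SucD[OF Suc.prems(1)] Ck_SucD[OF Suc.prems(2)] in \<open>auto intro!: Ck_add\<close>)
qed

text \<open>The chain rule replaces \<open>F n\<close> by \<open>F (Suc n)\<close>, so the statement
  carries the whole tower of derivatives and the induction leaves \<open>n\<close> arbitrary. The
  set \<open>S\<close> admits functions such as the logarithm that are smooth on part of the line
  only.\<close>

lemma Ck_compose_real:
  assumes F: "\<And>n s. s \<in> S \<Longrightarrow> (F n has_real_derivative F (Suc n) s) (at s)"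
  shows "Ck k f \<Longrightarrow> range f \<subseteq> S \<Longrightarrow> Ck k (\<lambda>x. F n (f x))"
proof (induction k arbitrary: f n)
  case 0
  have "continuous_on S (F n)"
    using F DERIV_isCont continuous_at_imp_continuous_on by blast
  then show ?case
    using 0 by (auto intro: continuous_on_compose2)
next
  case (Suc k)
  have "((\<lambda>x. F n (f x)) has_derivative (\<lambda>b. F (Suc n) (f x) * dir_deriv b f x)) (at x)" for x
    using has_derivative_compose[OF has_derivative_dir_deriv[OF Suc.prems(1), of x]
        has_field_derivative_imp_has_derivative[OF F[of "f x" n]]] Suc.prems(2)
    by auto
  then show ?case
    by (rule Ck_SucI) (use Suc Ck_SucD[OF Suc.prems(1)] in \<open>auto intro!: Ck_mult\<close>)
qed

lemma smooth_const: "smooth (\<lambda>x. c)"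
  and smooth_bounded_linear: "bounded_linear f \<Longrightarrow> smooth f"
  and smooth_add: "smooth f \<Longrightarrow> smooth g \<Longrightarrow> smooth (\<lambda>x. f x + g x)"
  and smooth_mult: "smooth f \<Longrightarrow> smooth g \<Longrightarrow> smooth (\<lambda>x. f x * g x)"
  by (auto simp: smooth_def intro: Ck_const Ck_bounded_linear Ck_add Ck_mult)

lemma smooth_compose_real:
  assumes "\<And>n s. s \<in> S \<Longrightarrow> (F n has_real_derivative F (Suc n) s) (at s)"
    and "smooth f" "range f \<subseteq> S"
  shows "smooth (\<lambda>x. F n (f x))"
  using Ck_compose_real[of S F] assms unfolding smooth_def by blast

lemma smooth_minus: "smooth f \<Longrightarrow> smooth (\<lambda>x. - f x)"
  using smooth_mult[OF smooth_const[of "-1"], of f] by simp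

lemma smooth_diff: "smooth f \<Longrightarrow> smooth g \<Longrightarrow> smooth (\<lambda>x. f x - g x)"
  using smooth_add[OF _ smooth_minus, of f g] by simp

lemma smooth_power: "smooth f \<Longrightarrow> smooth (\<lambda>x. f x ^ n)"
  by (induction n) (auto intro: smooth_mult smooth_const)

lemma smooth_ln:
  assumes "smooth f" "\<And>x. f x > 0"
  shows "smooth (\<lambda>x. ln (f x))"
proof -
  define F where "F n = (\<lambda>s::real. if n = 0 then ln s else (-1) ^ (n - 1) * fact (n - 1) / s ^ n)" for n :: nat
  have "(F n has_real_derivative F (Suc n) s) (at s)" if "s \<in> {0<..}" for n s
  proof (cases n)
    case 0
    then show ?thesis using that
      by (auto simp: F_def inverse_eq_divide intro!: derivative_eq_intros)
  next
    case (Suc m)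
    have "((\<lambda>s::real. (-1) ^ m * fact m / s ^ Suc m) has_real_derivative
        (-1) ^ Suc m * fact (Suc m) / s ^ Suc (Suc m)) (at s)"
      using that by (auto intro!: derivative_eq_intros simp: divide_simps) (cases m; simp add: algebra_simps)
    then show ?thesis by (simp add: F_def Suc)
  qed
  from smooth_compose_real[of "{0<..}" F, OF this assms(1), of 0] assms(2) show ?thesis
    by (auto simp: F_def)
qed

lemma smooth_cos_sin:
  assumes "smooth f"
  shows smooth_cos: "smooth (\<lambda>x. cos (f x))" and smooth_sin: "smooth (\<lambda>x. sin (f x))"
proof -
  \<comment> \<open>Each differentiation of the cosine advances the phase by a quarter turn.\<close>
  define F where "F n = (\<lambda>s::real. cos (s + n * (pi/2)))" for n :: nat
  have "(F n has_real_derivative F (Suc n) s) (at s)" for n s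
  proof -
    have "F (Suc n) s = - sin (s + n * (pi/2))"
      using cos_add[of "s + n * (pi/2)" "pi/2"] by (simp add: F_def algebra_simps add_divide_distrib)
    then show ?thesis
      by (auto simp: F_def intro!: derivative_eq_intros)
  qed
  note * = smooth_compose_real[of UNIV F, OF this assms]
  show "smooth (\<lambda>x. cos (f x))" using *[of 0] by (simp add: F_def)
  have "smooth (\<lambda>x. - cos (f x + pi/2))" using smooth_minus[OF *[of 1]] by (simp add: F_def)
  then show "smooth (\<lambda>x. sin (f x))" by (simp add: cos_add)
qed

lemma smooth_imp_continuous: "smooth f \<Longrightarrow> continuous_on A f"
  using smooth_def Ck.simps(1) continuous_on_subset by blast

lemma smooth_dir_deriv: "smooth f \<Longrightarrow> b \<in> Basis \<Longrightarrow> smooth (dir_deriv b f)"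
  unfolding smooth_def using Ck.simps(2) by blast

lemma smooth_has_derivative: "smooth f \<Longrightarrow> (f has_derivative (\<lambda>b. dir_deriv b f x)) (at x)"
  unfolding smooth_def using has_derivative_dir_deriv by blast

subsection \<open>Bump functions\<close>

lemma tendsto_poly_times_exp_neg_0: "((\<lambda>t::real. poly p t * exp (- t)) \<longlongrightarrow> 0) at_top"
proof -
  have "((\<lambda>t::real. \<Sum>i\<le>degree p. coeff p i * (t ^ i / exp t)) \<longlongrightarrow> (\<Sum>i\<le>degree p. coeff p i * 0)) at_top"
    by (intro tendsto_intros tendsto_power_div_exp_0)
  moreover have "(\<lambda>t::real. \<Sum>i\<le>degree p. coeff p i * (t ^ i / exp t)) = (\<lambda>t. poly p t * exp (- t))"
    by (auto simp: fun_eq_iff poly_altdef sum_distrib_right exp_minus divide_inverse mult.assoc)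
  ultimately show ?thesis by simp
qed

text \<open>The functions p(1/s) e^(-1/s), continued by 0, form a class closed under
  differentiation: with x = 1/s one has d/ds = -x^2 d/dx, which sends the polynomial p to x^2 (p -
  p'). Iterating this from p = 1 gives the tower of derivatives of the bump function.\<close>

definition flat_fun :: "real poly \<Rightarrow> real \<Rightarrow> real" where
  "flat_fun p s = (if s > 0 then poly p (1/s) * exp (- (1/s)) else 0)"

lemma has_real_derivative_flat_fun:
  "(flat_fun p has_real_derivative flat_fun (monom 1 2 * (p - pderiv p)) s) (at s)"
proof -
  consider "s > 0" | "s < 0" | "s = 0" by linarith
  then show ?thesis
  proof cases
    case 1
    have "((\<lambda>s. poly p (1/s) * exp (- (1/s))) has_real_derivative
        flat_fun (monom 1 2 * (p - pderiv p)) s) (at s)"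
      using 1 by (auto intro!: derivative_eq_intros poly_DERIV[THEN DERIV_chain2]
          simp: flat_fun_def poly_monom field_simps power2_eq_square)
    then show ?thesis
      by (rule has_field_derivative_transform_within_open[of _ _ _ "{0<..}"])
        (use 1 in \<open>auto simp: flat_fun_def\<close>)
  next
    case 2
    have "((\<lambda>s. 0) has_real_derivative flat_fun (monom 1 2 * (p - pderiv p)) s) (at s)"
      using 2 by (simp add: flat_fun_def)
    then show ?thesis
      by (rule has_field_derivative_transform_within_open[of _ _ _ "{..<0}"])
        (use 2 in \<open>auto simp: flat_fun_def\<close>)
  next
    case 3
    \<comment> \<open>With x = 1/h the right difference quotient is x p(x) e^(-x), which tends to 0
      as x grows.\<close>
    have "((\<lambda>h. (flat_fun p (0 + h) - flat_fun p 0) / h) \<longlongrightarrow> 0) (at_right 0)"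
    proof (rule Lim_transform_eventually)
      have "((\<lambda>h. poly (monom 1 1 * p) (inverse h) * exp (- inverse h)) \<longlongrightarrow> 0) (at_right (0::real))"
        by (rule filterlim_compose[OF tendsto_poly_times_exp_neg_0 filterlim_inverse_at_top_right])
      then show "((\<lambda>h. poly (monom 1 1 * p) (inverse h) * exp (- inverse h)) \<longlongrightarrow> 0) (at_right (0::real))" .
      show "\<forall>\<^sub>F h in at_right 0. poly (monom 1 1 * p) (inverse h) * exp (- inverse h) = (flat_fun p (0 + h) - flat_fun p 0) / h"
        by (rule eventually_at_rightI[of 0 1]) (auto simp: flat_fun_def poly_monom field_simps)
    qed
    moreover have "((\<lambda>h. (flat_fun p (0 + h) - flat_fun p 0) / h) \<longlongrightarrow> 0) (at_left 0)"
      by (rule Lim_transform_eventually[OF tendsto_const])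
        (rule eventually_at_leftI[of "-1" 0], auto simp: flat_fun_def)
    ultimately show ?thesis
      using 3 by (simp add: DERIV_def filterlim_split_at_real flat_fun_def)
  qed
qed

definition bump :: "real \<Rightarrow> complex \<Rightarrow> real" where
  "bump r z = flat_fun 1 (r\<^sup>2 - (cmod z)\<^sup>2)"

lemma smooth_cmod_power2: "smooth (\<lambda>z. (cmod z)\<^sup>2)"
  unfolding cmod_power2
  by (intro smooth_add smooth_power smooth_bounded_linear bounded_linear_Re bounded_linear_Im)

lemma smooth_bump: "smooth (bump r)"
proof -
  define p where "p = rec_nat (1::real poly) (\<lambda>_ q. monom 1 2 * (q - pderiv q))"
  have "(flat_fun (p n) has_real_derivative flat_fun (p (Suc n)) s) (at s)" for n s
    using has_real_derivative_flat_fun[of "p n" s] by (simp add: p_def)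
  from smooth_compose_real[of UNIV "\<lambda>n. flat_fun (p n)",
      OF this smooth_diff[OF smooth_const[of "r\<^sup>2"] smooth_cmod_power2], of 0]
  show ?thesis by (simp add: p_def bump_def[abs_def])
qed

lemma bump_nonneg: "bump r z \<ge> 0"
  by (simp add: bump_def flat_fun_def)

lemma bump_pos_iff: "r > 0 \<Longrightarrow> bump r z > 0 \<longleftrightarrow> cmod z < r"
  by (auto simp: bump_def flat_fun_def intro: power_less_imp_less_base power_strict_mono)

lemma bump_eq_0_iff: "r > 0 \<Longrightarrow> bump r z = 0 \<longleftrightarrow> r \<le> cmod z"
  using bump_pos_iff[of r z] bump_nonneg[of r z] by force

text \<open>A convolution evaluated at y tests against the kernel in the variable y - x. Reflection
  changes the sign of first derivatives and preserves \<open>ddc\<close>, which allows weak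
  harmonicity to be applied to the kernel.\<close>

lemma Ck_reflect:
  "Ck k f \<Longrightarrow> Ck k (\<lambda>x. f (y - x))"
proof (induction k arbitrary: f)
  case 0
  then show ?case using continuous_on_compose2[of UNIV f UNIV "\<lambda>x. y - x"]
    by (simp add: continuous_on_diff)
next
  case (Suc k)
  have "((\<lambda>x. f (y - x)) has_derivative (\<lambda>b. - dir_deriv b f (y - x))) (at x)" for x
  proof -
    have "((\<lambda>x. f (y - x)) has_derivative (\<lambda>b. dir_deriv (- b) f (y - x))) (at x)"
      by (rule has_derivative_compose[OF _ has_derivative_dir_deriv[OF Suc.prems]])
        (auto intro!: derivative_eq_intros)
    moreover have "dir_deriv (- b) f (y - x) = - dir_deriv b f (y - x)" for b
      by (rule linear_neg[OF bounded_linear.linear[OF has_derivative_bounded_linear[OF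
              has_derivative_dir_deriv[OF Suc.prems]]]])
    ultimately show ?thesis by simp
  qed
  then show ?case
    by (rule Ck_SucI) (use Suc in \<open>auto intro!: Ck_mult[OF Ck_const[of _ "-1"], simplified]\<close>)
qed

lemma smooth_reflect: "smooth f \<Longrightarrow> smooth (\<lambda>x. f (y - x))"
  by (simp add: smooth_def Ck_reflect)

lemma dir_deriv_reflect: "smooth f \<Longrightarrow> dir_deriv b (\<lambda>x. f (y - x)) x = - dir_deriv b f (y - x)"
proof -
  assume f: "smooth f"
  have "((\<lambda>x. f (y - x)) has_derivative (\<lambda>b. dir_deriv (- b) f (y - x))) (at x)"
    by (rule has_derivative_compose[OF _ smooth_has_derivative[OF f]])
      (auto intro!: derivative_eq_intros)
  moreover have "dir_deriv (- b) f (y - x) = - dir_deriv b f (y - x)" for b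
    by (rule linear_neg[OF bounded_linear.linear[OF has_derivative_bounded_linear[OF
            smooth_has_derivative[OF f]]]])
  ultimately show ?thesis by (simp add: dir_deriv_eq)
qed

lemma ddc_reflect: "smooth f \<Longrightarrow> ddc (\<lambda>x. f (y - x)) x = ddc f (y - x)"
proof -
  assume f: "smooth f"
  have "dir_deriv b (\<lambda>x. f (y - x)) = (\<lambda>x. - dir_deriv b f (y - x))" for b
    using dir_deriv_reflect[OF f] by blast
  moreover have "dir_deriv b (\<lambda>x. - dir_deriv b f (y - x)) x = dir_deriv b (dir_deriv b f) (y - x)"
    if "b \<in> Basis" for b
    using dir_deriv_reflect[OF smooth_minus[OF smooth_dir_deriv[OF f that]], of b y x]
      dir_deriv_eq[OF has_derivative_minus[OF smooth_has_derivative[OF smooth_dir_deriv[OF f that]]], of b "y - x" ]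
    by simp
  ultimately show ?thesis by (simp add: ddc_def)
qed

section \<open>Convolution and Green's identity\<close>

lemma linear_complex_expand:
  fixes L :: "complex \<Rightarrow> real"
  assumes "bounded_linear L"
  shows "L h = Re h * L 1 + Im h * L \<i>"
proof -
  interpret bounded_linear L by fact
  have "h = Re h *\<^sub>R 1 + Im h *\<^sub>R \<i>"
    by (simp add: complex_eq_iff)
  from arg_cong[OF this, of L] show ?thesis
    by (simp add: add scaleR)
qed

text \<open>The mean value inequality for F - \<open>D x\<close> on the segment from x to x + h,
  which convexity keeps in \<open>K\<close>. The derivative \<open>D y - D x\<close> is small
  because \<open>D\<close> is uniformly continuous on \<open>K\<close> in the two basis
  directions.\<close>

lemma uniform_taylor1:
  fixes F :: "complex \<Rightarrow> real"
  assumes D: "\<And>x. (F has_derivative D x) (at x)"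
    and cont: "\<And>b. continuous_on UNIV (\<lambda>x. D x b)"
    and K: "compact K" "convex K" and "e > 0"
  obtains d where "d > 0" "\<And>x h. x \<in> K \<Longrightarrow> x + h \<in> K \<Longrightarrow> norm h < d \<Longrightarrow> \<bar>F (x + h) - F x - D x h\<bar> \<le> e * norm h"
proof -
  have lin: "bounded_linear (D x)" for x using D has_derivative_bounded_linear by blast
  note expand = linear_complex_expand[OF lin]
  have uc: "uniformly_continuous_on K (\<lambda>x. D x b)" for b
    by (rule compact_uniformly_continuous[OF continuous_on_subset[OF cont] K(1)]) auto
  obtain d1 where d1: "d1 > 0" "\<And>x y. x \<in> K \<Longrightarrow> y \<in> K \<Longrightarrow> dist y x < d1 \<Longrightarrow> \<bar>D y 1 - D x 1\<bar> < e/2"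
    using uc[of 1] \<open>e > 0\<close> unfolding uniformly_continuous_on_def dist_real_def
    by (meson half_gt_zero)
  obtain d2 where d2: "d2 > 0" "\<And>x y. x \<in> K \<Longrightarrow> y \<in> K \<Longrightarrow> dist y x < d2 \<Longrightarrow> \<bar>D y \<i> - D x \<i>\<bar> < e/2"
    using uc[of \<i>] \<open>e > 0\<close> unfolding uniformly_continuous_on_def dist_real_def
    by (meson half_gt_zero)
  show thesis
  proof (rule that[of "min d1 d2"])
    show "min d1 d2 > 0" using d1 d2 by simp
    fix x h assume x: "x \<in> K" "x + h \<in> K" "norm h < min d1 d2"
    have seg: "closed_segment x (x + h) \<subseteq> K"
      using x K(2) by (simp add: closed_segment_subset)
    have ball: "dist y x < min d1 d2" if "y \<in> closed_segment x (x + h)" for y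
      using that x(3) segment_bound(1)[OF that] by (simp add: dist_norm norm_minus_commute)
    have on: "onorm (\<lambda>k. D y k - D x k) \<le> e" if y: "y \<in> closed_segment x (x + h)" for y
    proof (rule onorm_le)
      fix k
      have "\<bar>D y k - D x k\<bar> = \<bar>Re k * (D y 1 - D x 1) + Im k * (D y \<i> - D x \<i>)\<bar>"
        by (subst (1 2) expand) (simp add: algebra_simps)
      also have "\<dots> \<le> \<bar>Re k\<bar> * (e/2) + \<bar>Im k\<bar> * (e/2)"
      proof -
        have "\<bar>D y 1 - D x 1\<bar> \<le> e/2" "\<bar>D y \<i> - D x \<i>\<bar> \<le> e/2"
          using d1(2)[of x y] d2(2)[of x y] y seg x ball[OF y] by force+
        then show ?thesis
          by (intro order_trans[OF abs_triangle_ineq] add_mono) (simp_all only: abs_mult mult_left_mono abs_ge_zero)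
      qed
      also have "\<dots> \<le> cmod k * (e/2) + cmod k * (e/2)"
        using \<open>e > 0\<close> by (intro add_mono mult_right_mono abs_Re_le_cmod abs_Im_le_cmod) auto
      finally show "norm (D y k - D x k) \<le> e * norm k" by simp
    qed
    have der: "((\<lambda>y. F y - D x y) has_derivative (\<lambda>k. D y k - D x k)) (at y within closed_segment x (x + h))" for y
      by (rule has_derivative_diff[OF has_derivative_at_withinI[OF D] bounded_linear_imp_has_derivative[OF lin]])
    have "norm ((\<lambda>y. F y - D x y) (x + h) - (\<lambda>y. F y - D x y) x) \<le> e * norm (x + h - x)"
      by (rule differentiable_bound[OF convex_closed_segment der on]) auto
    moreover have "D x (x + h) = D x x + D x h"
      by (rule linear_add[OF bounded_linear.linear[OF lin]])
    ultimately show "\<bar>F (x + h) - F x - D x h\<bar> \<le> e * norm h" by simp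
  qed
qed

lemma set_integrable_mult_continuous:
  fixes u G :: "complex \<Rightarrow> real"
  assumes u: "set_integrable lborel (cball p r) u" and G: "continuous_on UNIV G"
  shows "set_integrable lborel (cball p r) (\<lambda>x. u x * G x)"
proof -
  have "bounded (G ` cball p r)"
    by (rule compact_imp_bounded[OF compact_continuous_image[OF continuous_on_subset[OF G]]]) auto
  then obtain B where "\<forall>v\<in>G ` cball p r. norm v \<le> B"
    unfolding bounded_iff by (elim exE)
  then have B: "\<And>x. x \<in> cball p r \<Longrightarrow> \<bar>G x\<bar> \<le> B"
    by simp
  have "set_integrable lborel (cball p r) (\<lambda>x. B * u x)"
    using u by (rule set_integrable_mult_right)
  then show ?thesis
    unfolding set_integrable_def
  proof (rule Bochner_Integration.integrable_bound)
    have "G \<in> borel_measurable borel"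
      using G by (rule borel_measurable_continuous_onI)
    moreover have "(\<lambda>x. indicat_real (cball p r) x *\<^sub>R u x) \<in> borel_measurable lborel"
      using u unfolding set_integrable_def by simp
    ultimately have "(\<lambda>x. (indicat_real (cball p r) x *\<^sub>R u x) * G x) \<in> borel_measurable lborel"
      by measurable
    then show "(\<lambda>x. indicat_real (cball p r) x *\<^sub>R (u x * G x)) \<in> borel_measurable lborel"
      by (simp add: mult.assoc)
    show "AE x in lborel. norm (indicat_real (cball p r) x *\<^sub>R (u x * G x)) \<le> norm (indicat_real (cball p r) x *\<^sub>R (B * u x))"
    proof (intro AE_I2)
      fix x
      have "\<bar>u x\<bar> * \<bar>G x\<bar> \<le> \<bar>u x\<bar> * \<bar>B\<bar>" if "x \<in> cball p r"
        using B[OF that] by (intro mult_left_mono) auto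
      then show "norm (indicat_real (cball p r) x *\<^sub>R (u x * G x)) \<le> norm (indicat_real (cball p r) x *\<^sub>R (B * u x))"
        by (cases "x \<in> cball p r") (simp_all add: abs_mult mult.commute)
    qed
  qed
qed

text \<open>Only integrability of \<open>u\<close> is needed: the first-order Taylor remainder of the kernel is small
  uniformly on compact sets.\<close>

lemma has_derivative_convolution:
  fixes F :: "complex \<Rightarrow> real" and u :: "complex \<Rightarrow> real"
  assumes D: "\<And>x. (F has_derivative D x) (at x)"
    and cont: "\<And>b. continuous_on UNIV (\<lambda>x. D x b)"
    and u: "set_integrable lborel (cball p r) u"
  shows "((\<lambda>y. LINT x:cball p r|lborel. u x * F (y - x)) has_derivative
          (\<lambda>b. LINT x:cball p r|lborel. u x * D (y - x) b)) (at y)"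
proof -
  have int: "set_integrable lborel (cball p r) (\<lambda>x. u x * G (y - x))" if G: "continuous_on UNIV G" for G y
    using set_integrable_mult_continuous[OF u, of "\<lambda>x. G (y - x)"] continuous_on_compose2[OF G, of UNIV "\<lambda>x. y - x"]
    by (simp add: continuous_on_diff)
  have cF: "continuous_on UNIV F"
    by (intro continuous_at_imp_continuous_on ballI has_derivative_continuous[OF D])
  define I where "I = (LINT x:cball p r|lborel. \<bar>u x\<bar>)"
  have uabs: "set_integrable lborel (cball p r) (\<lambda>x. \<bar>u x\<bar>)"
    using u by (rule set_integrable_abs)
  have I: "I \<ge> 0" unfolding I_def set_lebesgue_integral_def by (rule Bochner_Integration.integral_nonneg) auto
  have lin: "bounded_linear (D x)" for x using D has_derivative_bounded_linear by blast
  show ?thesis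
    unfolding has_derivative_at_alt
  proof (intro conjI allI impI)
    let ?L = "\<lambda>b. LINT x:cball p r|lborel. u x * D (y - x) b"
    have "linear ?L"
    proof (rule linearI)
      fix a b :: complex and s :: real
      have "D (y - x) (a + b) = D (y - x) a + D (y - x) b" for x
        by (rule linear_add[OF bounded_linear.linear[OF lin]])
      then show "?L (a + b) = ?L a + ?L b"
        using set_integral_add(2)[OF int[OF cont, of y a] int[OF cont, of y b]] by (simp only: distrib_left)
      have "D (y - x) (s *\<^sub>R a) = s * D (y - x) a" for x
        using linear_scale[OF bounded_linear.linear[OF lin[of "y - x"]], of s a] by simp
      then have "u x * D (y - x) (s *\<^sub>R a) = s * (u x * D (y - x) a)" for x
        by (simp only: mult.left_commute)
      then show "?L (s *\<^sub>R a) = s *\<^sub>R ?L a"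
        by (simp only: set_integral_mult_right real_scaleR_def)
    qed
    then show "bounded_linear ?L" by (simp add: linear_conv_bounded_linear)
    fix e :: real assume "e > 0"
    define e' where "e' = e / (I + 1)"
    have "e' > 0" using \<open>e > 0\<close> I by (simp add: e'_def)
    \<comment> \<open>Contains \<open>y - x\<close> for every \<open>x\<close> in the disc of
      integration, and also \<open>y' - x\<close> as long as |y' - y| < 1.\<close>
    define K where "K = cball (y - p) (r + 1)"
    obtain d where d: "d > 0" "\<And>x h. x \<in> K \<Longrightarrow> x + h \<in> K \<Longrightarrow> norm h < d \<Longrightarrow> \<bar>F (x + h) - F x - D x h\<bar> \<le> e' * norm h"
      using uniform_taylor1[OF D cont _ _ \<open>e' > 0\<close>, of K] by (auto simp: K_def)
    show "\<exists>d>0. \<forall>y'. norm (y' - y) < d \<longrightarrow>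
        norm ((LINT x:cball p r|lborel. u x * F (y' - x)) - (LINT x:cball p r|lborel. u x * F (y - x)) - ?L (y' - y)) \<le> e * norm (y' - y)"
    proof (intro exI[of _ "min d 1"] conjI allI impI)
      show "min d 1 > 0" using d by simp
      fix y' assume y': "norm (y' - y) < min d 1"
      have i1: "set_integrable lborel (cball p r) (\<lambda>x. u x * F (y' - x) - u x * F (y - x))"
        by (intro set_integral_diff int cF)
      have i2: "set_integrable lborel (cball p r) (\<lambda>x. u x * F (y' - x) - u x * F (y - x) - u x * D (y - x) (y' - y))"
        by (intro set_integral_diff int cF cont)
      have "norm ((LINT x:cball p r|lborel. u x * F (y' - x)) - (LINT x:cball p r|lborel. u x * F (y - x)) - ?L (y' - y))
        = norm (LINT x:cball p r|lborel. u x * F (y' - x) - u x * F (y - x) - u x * D (y - x) (y' - y))"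
        using set_integral_diff(2)[OF i1 int[OF cont, of y "y' - y"]]
          set_integral_diff(2)[OF int[OF cF, of y'] int[OF cF, of y]] by simp
      also have "\<dots> \<le> (LINT x:cball p r|lborel. (e' * norm (y' - y)) * \<bar>u x\<bar>)"
        unfolding set_lebesgue_integral_def
      proof (rule Bochner_Integration.integral_norm_bound_integral)
        show "integrable lborel (\<lambda>x. indicat_real (cball p r) x *\<^sub>R (u x * F (y' - x) - u x * F (y - x) - u x * D (y - x) (y' - y)))"
          using i2 unfolding set_integrable_def .
        show "integrable lborel (\<lambda>x. indicat_real (cball p r) x *\<^sub>R (e' * norm (y' - y) * \<bar>u x\<bar>))"
          using set_integrable_mult_right[of "e' * norm (y' - y)", OF uabs] unfolding set_integrable_def by simp
        fix x
        show "norm (indicat_real (cball p r) x *\<^sub>R (u x * F (y' - x) - u x * F (y - x) - u x * D (y - x) (y' - y)))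
          \<le> indicat_real (cball p r) x *\<^sub>R (e' * norm (y' - y) * \<bar>u x\<bar>)"
        proof (cases "x \<in> cball p r")
          case True
          have "y - x \<in> K" 
            using True by (auto simp: K_def dist_norm norm_minus_commute)
          moreover have "y - x + (y' - y) \<in> K"
          proof -
            have "norm (x - p + - (y' - y)) \<le> norm (x - p) + norm (y' - y)"
              by (metis norm_minus_cancel norm_triangle_ineq)
            then show ?thesis
              using True y' by (simp add: K_def dist_norm norm_minus_commute algebra_simps)
          qed
          ultimately have "\<bar>F (y' - x) - F (y - x) - D (y - x) (y' - y)\<bar> \<le> e' * norm (y' - y)"
            using d(2)[of "y - x" "y' - y"] y' by simp
          then have "\<bar>u x\<bar> * \<bar>F (y' - x) - F (y - x) - D (y - x) (y' - y)\<bar> \<le> \<bar>u x\<bar> * (e' * norm (y' - y))"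
            by (intro mult_left_mono) auto
          then show ?thesis using True
            by (simp add: abs_mult[symmetric] algebra_simps)
        qed auto
      qed
      also have "\<dots> = e' * norm (y' - y) * I"
        by (simp add: I_def)
      also have "\<dots> = e * norm (y' - y) * (I / (I + 1))"
        by (simp add: e'_def)
      also have "\<dots> \<le> e * norm (y' - y) * 1"
        using I \<open>e > 0\<close> by (intro mult_left_mono) auto
      finally show "norm ((LINT x:cball p r|lborel. u x * F (y' - x)) - (LINT x:cball p r|lborel. u x * F (y - x)) - ?L (y' - y)) \<le> e * norm (y' - y)"
        by simp
    qed
  qed
qed

section \<open>Integration by parts for functions of compact support\<close>

lemma integrable_continuous_compact_support:
  fixes G :: "complex \<Rightarrow> real"
  assumes "continuous_on UNIV G" "\<And>x. x \<notin> cball p r \<Longrightarrow> G x = 0"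
  shows "integrable lborel G"
proof -
  have "integrable lborel (\<lambda>x. indicat_real (cball p r) x *\<^sub>R G x)"
    using assms(1) by (intro borel_integrable_compact) (auto intro: continuous_on_subset)
  moreover have "(\<lambda>x. indicat_real (cball p r) x *\<^sub>R G x) = G"
    using assms(2) by (auto simp: indicator_def fun_eq_iff)
  ultimately show ?thesis by simp
qed

lemma has_derivative_zero_outside:
  fixes F :: "complex \<Rightarrow> real"
  assumes "(F has_derivative D) (at x)" "\<And>x. x \<notin> cball p r \<Longrightarrow> F x = 0" "x \<notin> cball p r"
  shows "D b = 0"
proof -
  have "((\<lambda>x. 0) has_derivative D) (at x)"
    by (rule has_derivative_transform_within_open[OF assms(1), of "- cball p r"])
      (use assms in \<open>auto simp: open_Compl\<close>)
  then show ?thesis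
    using has_derivative_unique[OF _ has_derivative_const] by metis
qed

lemma integral_reflect:
  fixes G :: "complex \<Rightarrow> real"
  assumes "G \<in> borel_measurable borel"
  shows "(LINT x|lborel. G (y - x)) = (LINT x|lborel. G x)"
proof -
  have "(lborel :: complex measure) = distr lborel borel (\<lambda>x. y - x)"
    using lborel_affine[of "-1" y] by (simp add: density_1)
  then have "(LINT x|lborel. G x) = (LINT x|distr lborel borel (\<lambda>x. y - x). G x)"
    by simp
  also have "\<dots> = (LINT x|lborel. G (y - x))"
    by (rule integral_distr) (use assms in auto)
  finally show ?thesis by simp
qed

text \<open>By translation invariance the integral of F(y - x) over x is constant in y, and its
  derivative at y = 0 is the integral of the derivative. Differentiation under the integral is the
  convolution lemma with u = 1 on a disc that is large enough for all |y| < 1.\<close>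

lemma integral_dir_deriv_compact_support:
  fixes F :: "complex \<Rightarrow> real"
  assumes D: "\<And>x. (F has_derivative D x) (at x)"
    and cont: "\<And>b. continuous_on UNIV (\<lambda>x. D x b)"
    and supp: "\<And>x. x \<notin> cball p r \<Longrightarrow> F x = 0"
  shows "(LINT x|lborel. D x b) = 0"
proof -
  let ?B = "cball (- p) (r + 1)"
  have D0: "D x b = 0" if "x \<notin> cball p r" for x
    by (rule has_derivative_zero_outside[OF D supp that])
  have eq: "(LINT x:?B|lborel. 1 * G (y - x)) = (LINT x|lborel. G x)"
    if G: "\<And>x. x \<notin> cball p r \<Longrightarrow> G x = 0" "continuous_on UNIV G" and y: "norm y < 1" for G :: "complex \<Rightarrow> real" and y
  proof -
    have "(LINT x:?B|lborel. 1 * G (y - x)) = (LINT x|lborel. G (y - x))"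
      unfolding set_lebesgue_integral_def
    proof (intro Bochner_Integration.integral_cong refl)
      fix x
      have "G (y - x) = 0" if "x \<notin> ?B"
      proof (rule G(1), rule notI)
        assume "y - x \<in> cball p r"
        moreover have "norm (p + x) \<le> norm (p - (y - x)) + norm y"
          using norm_triangle_ineq[of "p - (y - x)" y] by simp
        ultimately show False
          using that y by (simp add: dist_norm norm_minus_commute[of "- p" x] add.commute)
      qed
      then show "indicat_real ?B x *\<^sub>R (1 * G (y - x)) = G (y - x)"
        by (cases "x \<in> ?B") auto
    qed
    then show ?thesis
      using integral_reflect[OF borel_measurable_continuous_onI[OF G(2)]] by simp
  qed
  have cF: "continuous_on UNIV F"
    by (intro continuous_at_imp_continuous_on ballI has_derivative_continuous[OF D])
  have "set_integrable lborel ?B (\<lambda>x. 1 :: real)"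
    unfolding set_integrable_def by (rule borel_integrable_compact) auto
  from has_derivative_convolution[OF D cont this, of 0]
  have "((\<lambda>y. LINT x:?B|lborel. 1 * F (y - x)) has_derivative
          (\<lambda>b. LINT x:?B|lborel. 1 * D (0 - x) b)) (at 0)" .
  then have "((\<lambda>y. LINT x|lborel. F x) has_derivative
          (\<lambda>b. LINT x:?B|lborel. 1 * D (0 - x) b)) (at 0)"
    by (rule has_derivative_transform_within_open[of _ _ _ _ "ball 0 1"])
      (use eq[OF supp cF] in auto)
  then have "(\<lambda>b. LINT x:?B|lborel. 1 * D (0 - x) b) = (\<lambda>b. 0)"
    using has_derivative_unique[OF _ has_derivative_const] by metis
  then have "(LINT x:?B|lborel. 1 * D (0 - x) b) = 0"
    by metis
  then show ?thesis
    using eq[of "\<lambda>x. D x b" 0, OF D0 cont] by simp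
qed

text \<open>Green's second identity: as Re H is harmonic, Re H times the Laplacian of
  \<open>\<eta>\<close> is the divergence of (Re H) grad \<open>\<eta>\<close> -
  \<open>\<eta>\<close> grad (Re H), a field of compact support.\<close>

lemma integral_Re_holomorphic_ddc:
  assumes H: "H holomorphic_on ball p R" and \<eta>: "smooth \<eta>"
    and supp: "\<And>x. x \<notin> cball p r \<Longrightarrow> \<eta> x = 0" and "r < R"
  shows "(LINT x|lborel. Re (H x) * ddc \<eta> x) = 0"
proof -
  let ?H1 = "deriv H" and ?H2 = "deriv (deriv H)"
  have H1: "?H1 holomorphic_on ball p R" and H2: "?H2 holomorphic_on ball p R"
    using H by (auto intro!: holomorphic_deriv)
  have sub: "cball p r \<subseteq> ball p R" using \<open>r < R\<close> by auto
  have d\<eta>: "(\<eta> has_derivative (\<lambda>k. dir_deriv k \<eta> x)) (at x)" for x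
    by (rule smooth_has_derivative[OF \<eta>])
  have dd\<eta>: "(dir_deriv b \<eta> has_derivative (\<lambda>k. dir_deriv k (dir_deriv b \<eta>) x)) (at x)" if "b \<in> Basis" for x b
    by (rule smooth_has_derivative[OF smooth_dir_deriv[OF \<eta> that]])
  have z1: "dir_deriv k \<eta> x = 0" if "x \<notin> cball p r" for k x
    by (rule has_derivative_zero_outside[OF d\<eta> supp that])
  have z2: "dir_deriv k (dir_deriv b \<eta>) x = 0" if "x \<notin> cball p r" "b \<in> Basis" for k b x
    by (rule has_derivative_zero_outside[OF dd\<eta>[OF that(2)] z1 that(1)])
  \<comment> \<open>The component of that field in direction b, extended by 0; the derivative of Re
    H in direction b is Re (b H'). \<open>D b x\<close> is the differential of this
    component.\<close>
  define F where "F b x = (if x \<in> ball p R then Re (H x) * dir_deriv b \<eta> x - \<eta> x * Re (b * ?H1 x) else 0)" for b x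
  define D where "D b x k = (if x \<in> ball p R then
      (Re (H x) * dir_deriv k (dir_deriv b \<eta>) x + Re (?H1 x * k) * dir_deriv b \<eta> x)
      - (\<eta> x * Re (b * (?H2 x * k)) + dir_deriv k \<eta> x * Re (b * ?H1 x)) else 0)" for b x k
  have hol: "(G has_derivative (\<lambda>k. deriv G x * k)) (at x)" if "G holomorphic_on ball p R" "x \<in> ball p R" for G x
    using holomorphic_derivI[OF that(1) open_ball that(2)] by (simp add: has_field_derivative_def)
  have int: "integrable lborel (\<lambda>x. D b x b)" and zero: "(LINT x|lborel. D b x b) = 0" if b: "b \<in> Basis" for b
  proof -
    have F: "(F b has_derivative D b x) (at x)" for x
    proof (cases "x \<in> ball p R")
      case True
      have "((\<lambda>x. Re (H x) * dir_deriv b \<eta> x - \<eta> x * Re (b * ?H1 x)) has_derivative D b x) (at x)"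
        using True hol[OF H True] hol[OF H1 True] d\<eta>[of x] dd\<eta>[OF b, of x] unfolding D_def
        by (auto intro!: derivative_eq_intros)
      then show ?thesis
        by (rule has_derivative_transform_within_open[of _ _ _ _ "ball p R"])
          (use True in \<open>auto simp: F_def\<close>)
    next
      case False
      have "((\<lambda>x. 0) has_derivative D b x) (at x)"
        using False by (simp add: D_def[abs_def])
      then show ?thesis
        by (rule has_derivative_transform_within_open[of _ _ _ _ "- cball p r"])
          (use False sub supp z1 in \<open>auto simp: F_def open_Compl\<close>)
    qed
    have cont: "continuous_on UNIV (\<lambda>x. D b x k)" for k
    proof -
      have sk: "continuous_on A (dir_deriv k \<eta>)" for A
        by (subst linear_complex_expand[OF has_derivative_bounded_linear[OF d\<eta>], abs_def])
          (intro continuous_intros smooth_imp_continuous smooth_dir_deriv \<eta>; simp add: Basis_complex_def)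
      have skk: "continuous_on A (dir_deriv k (dir_deriv b \<eta>))" for A
        by (subst linear_complex_expand[OF has_derivative_bounded_linear[OF dd\<eta>[OF b]], abs_def])
          (intro continuous_intros smooth_imp_continuous smooth_dir_deriv \<eta> b; simp add: Basis_complex_def)
      have "continuous_on (ball p R) (\<lambda>x. D b x k)"
      proof (subst continuous_on_cong[OF refl])
        show "continuous_on (ball p R) (\<lambda>x. (Re (H x) * dir_deriv k (dir_deriv b \<eta>) x + Re (?H1 x * k) * dir_deriv b \<eta> x)
            - (\<eta> x * Re (b * (?H2 x * k)) + dir_deriv k \<eta> x * Re (b * ?H1 x)))"
          by (intro continuous_intros sk skk smooth_imp_continuous[OF \<eta>] smooth_imp_continuous[OF smooth_dir_deriv[OF \<eta> b]]
              holomorphic_on_imp_continuous_on H H1 H2)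
      qed (simp add: D_def)
      moreover have "continuous_on (- cball p r) (\<lambda>x. D b x k)"
        by (subst continuous_on_cong[OF refl, of _ _ "\<lambda>x. 0"]) (use z1 z2[OF _ b] supp in \<open>auto simp: D_def\<close>)
      ultimately have "continuous_on (ball p R \<union> - cball p r) (\<lambda>x. D b x k)"
        by (intro continuous_on_open_Un) (auto simp: open_Compl)
      moreover have "ball p R \<union> - cball p r = UNIV" using sub by auto
      ultimately show ?thesis by simp
    qed
    have "F b x = 0" if "x \<notin> cball p r" for x
      using supp[OF that] z1[OF that] by (simp add: F_def)
    from integral_dir_deriv_compact_support[OF F cont this]
    show "(LINT x|lborel. D b x b) = 0" .
    show "integrable lborel (\<lambda>x. D b x b)"
    proof (rule integrable_continuous_compact_support[OF cont])
      show "D b x b = 0" if "x \<notin> cball p r" for x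
        using z1[OF that] z2[OF that b] supp[OF that] by (simp add: D_def)
    qed
  qed
  have "Re (H x) * ddc \<eta> x = (D 1 x 1 + D \<i> x \<i>) / (4 * pi)" for x
  proof (cases "x \<in> ball p R")
    case False
    then have "x \<notin> cball p r" using sub by blast
    then show ?thesis using z2[of x] False by (simp add: D_def ddc_def Basis_complex_def)
  next
    case True
    then show ?thesis by (simp add: D_def ddc_def Basis_complex_def algebra_simps add_divide_distrib)
  qed
  then have "(LINT x|lborel. Re (H x) * ddc \<eta> x) = (LINT x|lborel. D 1 x 1 + D \<i> x \<i>) / (4 * pi)"
    by simp
  also have "\<dots> = 0"
    using int zero by (simp add: Basis_complex_def)
  finally show ?thesis .
qed

section \<open>Mollification of a weakly harmonic function\<close>

lemma set_lebesgue_integral_support: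
  fixes f :: "complex \<Rightarrow> real"
  assumes "\<And>x. x \<notin> S \<Longrightarrow> f x = 0"
  shows "(LINT x:S|lborel. f x) = (LINT x|lborel. f x)"
proof -
  have "indicat_real S x *\<^sub>R f x = f x" for x
    using assms by (cases "x \<in> S") auto
  then show ?thesis unfolding set_lebesgue_integral_def by (simp only:)
qed

lemma integrable_set_support:
  fixes f :: "complex \<Rightarrow> real"
  assumes "set_integrable lborel S f" "\<And>x. x \<notin> S \<Longrightarrow> f x = 0"
  shows "integrable lborel f"
proof -
  have "(\<lambda>x. indicat_real S x *\<^sub>R f x) = f"
    using assms(2) by (force simp: indicator_def)
  then show ?thesis using assms(1) by (simp add: set_integrable_def)
qed

section \<open>The mollifying kernel and its averages\<close>

lemma dir_deriv_bump:
  "dir_deriv b (bump r) = (\<lambda>z. flat_fun (monom 1 2) (r\<^sup>2 - (cmod z)\<^sup>2) * (- 2 * (z \<bullet> b)))"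
proof
  fix z
  have "((\<lambda>z. r\<^sup>2 - (cmod z)\<^sup>2) has_derivative (\<lambda>b. - 2 * (z \<bullet> b))) (at z)"
    unfolding power2_norm_eq_inner
    by (auto intro!: derivative_eq_intros simp: inner_commute)
  from has_derivative_compose[OF this has_field_derivative_imp_has_derivative[OF has_real_derivative_flat_fun[of 1]]]
  have "(bump r has_derivative (\<lambda>b. flat_fun (monom 1 2) (r\<^sup>2 - (cmod z)\<^sup>2) * (- 2 * (z \<bullet> b)))) (at z)"
    by (simp add: bump_def[abs_def] pderiv_1)
  then show "dir_deriv b (bump r) z = flat_fun (monom 1 2) (r\<^sup>2 - (cmod z)\<^sup>2) * (- 2 * (z \<bullet> b))"
    by (rule dir_deriv_eq)
qed

text \<open>This symmetry becomes one of the two Cauchy-Riemann equations for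
  \<open>mollify_grad\<close>. The radial form of the kernel gives a formula for the second
  derivatives that is visibly symmetric in the two directions.\<close>

lemma dir_deriv_bump_commute:
  "dir_deriv a (dir_deriv b (bump r)) z = dir_deriv b (dir_deriv a (bump r)) z"
proof -
  obtain p where p: "\<And>s. (flat_fun (monom 1 2) has_real_derivative flat_fun p s) (at s)"
    using has_real_derivative_flat_fun by blast
  have d: "((\<lambda>z. r\<^sup>2 - (cmod z)\<^sup>2) has_derivative (\<lambda>b. - 2 * (z \<bullet> b))) (at z)"
    unfolding power2_norm_eq_inner
    by (auto intro!: derivative_eq_intros simp: inner_commute)
  let ?s = "r\<^sup>2 - (cmod z)\<^sup>2"
  have "dir_deriv a (dir_deriv b (bump r)) z =
      flat_fun (monom 1 2) ?s * (- 2 * (a \<bullet> b)) + flat_fun p ?s * (- 2 * (z \<bullet> a)) * (- 2 * (z \<bullet> b))" for a b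
    unfolding dir_deriv_bump
    by (rule dir_deriv_eq)
      (auto intro!: derivative_eq_intros has_derivative_compose[OF d has_field_derivative_imp_has_derivative[OF p]])
  then show ?thesis by (simp add: inner_commute)
qed

text \<open>If the integral vanished, the closed set where \<open>bump r\<close> is 0 would have
  full measure and hence contain the origin.\<close>

lemma integral_bump_pos:
  assumes "r > 0" shows "(LINT x|lborel. bump r x) > 0"
proof -
  have int: "integrable lborel (bump r)"
    by (rule integrable_continuous_compact_support[where p=0 and r=r])
      (use assms in \<open>auto simp: bump_eq_0_iff intro: smooth_imp_continuous smooth_bump\<close>)
  have "(LINT x|lborel. bump r x) \<noteq> 0"
  proof
    assume "(LINT x|lborel. bump r x) = 0"
    then have "AE x in lborel. bump r x = 0"
      using integral_nonneg_eq_0_iff_AE[OF int] bump_nonneg by auto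
    then have "AE x in lebesgue. x \<in> {x. r \<le> cmod x}"
      using assms by (auto simp: bump_eq_0_iff intro: AE_completion)
    then have "0 \<in> {x. r \<le> cmod x}"
      by (intro mem_closed_if_AE_lebesgue closed_Collect_le continuous_intros)
    then show False using assms by simp
  qed
  moreover have "(LINT x|lborel. bump r x) \<ge> 0"
    by (rule Bochner_Integration.integral_nonneg) (rule bump_nonneg)
  ultimately show ?thesis by linarith
qed

definition mollify :: "real \<Rightarrow> (complex \<Rightarrow> real) \<Rightarrow> complex \<Rightarrow> real" where
  "mollify r U y = (LINT x|lborel. U x * bump r (y - x)) / (LINT x|lborel. bump r x)"

text \<open>The complex gradient A_x - i A_y, that is 2 dA/dz, of the mollified function A, with the
  derivatives moved to the kernel. The differential of A is the real part of multiplication by it,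
  and A is harmonic when it is holomorphic.\<close>

definition mollify_grad :: "real \<Rightarrow> (complex \<Rightarrow> real) \<Rightarrow> complex \<Rightarrow> complex" where
  "mollify_grad r U y = Complex (LINT x|lborel. U x * dir_deriv 1 (bump r) (y - x))
      (- (LINT x|lborel. U x * dir_deriv \<i> (bump r) (y - x))) / (LINT x|lborel. bump r x)"

lemma mollify_ge:
  assumes r: "r > 0" and U: "set_integrable lborel (cball y r) U" and l: "\<And>x. x \<in> cball y r \<Longrightarrow> l \<le> U x"
  shows "l \<le> mollify r U y"
proof -
  have cb: "continuous_on UNIV (\<lambda>x. bump r (y - x))"
    by (rule smooth_imp_continuous[OF smooth_reflect[OF smooth_bump]])
  have z: "bump r (y - x) = 0" if "x \<notin> cball y r" for x
    using that r by (simp add: bump_eq_0_iff dist_norm)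
  have "integrable lborel (\<lambda>x. U x * bump r (y - x))"
    by (rule integrable_set_support[OF set_integrable_mult_continuous[OF U cb]]) (simp add: z)
  moreover have i: "integrable lborel (\<lambda>x. bump r (y - x))"
    by (rule integrable_continuous_compact_support[OF cb z])
  ultimately have "(LINT x|lborel. l * bump r (y - x)) \<le> (LINT x|lborel. U x * bump r (y - x))"
  proof (intro integral_mono)
    show "l * bump r (y - x) \<le> U x * bump r (y - x)" for x
      using l[of x] z[of x] bump_nonneg[of r "y - x"] by (cases "x \<in> cball y r") (auto intro: mult_right_mono)
  qed auto
  moreover have "(LINT x|lborel. bump r (y - x)) = (LINT x|lborel. bump r x)"
    by (rule integral_reflect[OF borel_measurable_continuous_onI[OF smooth_imp_continuous[OF smooth_bump]]])
  ultimately show ?thesis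
    using integral_bump_pos[OF r] i by (simp add: mollify_def pos_le_divide_eq)
qed

lemma mollify_le:
  assumes r: "r > 0" and U: "set_integrable lborel (cball y r) U" and l: "\<And>x. x \<in> cball y r \<Longrightarrow> U x \<le> l"
  shows "mollify r U y \<le> l"
proof -
  have "set_integrable lborel (cball y r) (\<lambda>x. - U x)"
    using set_integrable_mult_right[of "-1", OF U] by simp
  from mollify_ge[OF r this, of "-l"] l show ?thesis
    by (simp add: mollify_def)
qed

text \<open>Weak harmonicity of \<open>u\<close>, applied to the kernel centred at p, says that the
  Laplacian of its average vanishes at p; Green's identity says the same for Re H. This is the other
  Cauchy-Riemann equation. The conclusions concern the single point p because \<open>V\<close>,
  \<open>u\<close> and \<open>H\<close> come from a local chart and change with p, whereas
  \<open>U\<close> does not.\<close>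

lemma mollify_local:
  assumes r: "r > 0" and sub: "cball p (2 * r) \<subseteq> ball p R" "ball p R \<subseteq> V"
    and u: "ddc_vanishes_on V u" and H: "H holomorphic_on ball p R"
    and U: "\<And>x. x \<in> ball p R \<Longrightarrow> U x = u x + Re (H x)"
  shows "set_integrable lborel (cball p (2 * r)) U"
    and "(mollify r U has_derivative (\<lambda>k. Re (mollify_grad r U p * k))) (at p)"
    and "mollify_grad r U field_differentiable (at p)"
proof -
  let ?B = "cball p (2 * r)"
  have "2 * r < R"
    using sub(1) r cball_subset_ball_iff[of p "2 * r" p R] by simp
  have iu: "set_integrable lborel ?B u"
    using u sub unfolding ddc_vanishes_on_def by (meson compact_cball order_trans)
  have iH: "set_integrable lborel ?B (\<lambda>x. Re (H x))"
    unfolding set_integrable_def using holomorphic_on_imp_continuous_on[OF H] sub(1)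
    by (intro borel_integrable_compact continuous_intros) (auto intro: continuous_on_subset)
  have "set_integrable lborel ?B (\<lambda>x. u x + Re (H x))"
    using iu iH by (rule set_integral_add)
  moreover have "indicat_real ?B x *\<^sub>R U x = indicat_real ?B x *\<^sub>R (u x + Re (H x))" for x
    using U sub(1) by (cases "x \<in> ?B") auto
  ultimately show iU: "set_integrable lborel ?B U"
    unfolding set_integrable_def by (simp only:)
  define N where "N = (LINT x|lborel. bump r x)"
  have N: "N > 0" unfolding N_def using r by (rule integral_bump_pos)
  have conv: "((\<lambda>y. LINT x|lborel. U x * F (y - x)) has_derivative
          (\<lambda>k. Re k * (LINT x|lborel. U x * dir_deriv 1 F (p - x)) + Im k * (LINT x|lborel. U x * dir_deriv \<i> F (p - x)))) (at p)"
    if F: "smooth F" "\<And>x. x \<notin> cball 0 r \<Longrightarrow> F x = 0" for F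
  proof -
    let ?D = "\<lambda>x k. dir_deriv k F x"
    have D: "(F has_derivative ?D x) (at x)" for x by (rule smooth_has_derivative[OF F(1)])
    note lin = has_derivative_bounded_linear[OF D]
    have c1: "continuous_on UNIV (\<lambda>x. ?D x 1)" "continuous_on UNIV (\<lambda>x. ?D x \<i>)"
      by (rule smooth_imp_continuous[OF smooth_dir_deriv[OF F(1)]]; simp add: Basis_complex_def)+
    have "?D x k = Re k * ?D x 1 + Im k * ?D x \<i>" for x k
      by (rule linear_complex_expand[OF lin])
    note ex = this
    have c: "continuous_on UNIV (\<lambda>x. ?D x k)" for k
      by (subst ex) (intro continuous_intros c1)
    have z: "?D x k = 0" if "x \<notin> cball 0 r" for x k
      by (rule has_derivative_zero_outside[OF D F(2) that])
    have cr: "continuous_on UNIV (\<lambda>x. G (p - x))" if "continuous_on UNIV G" for G :: "complex \<Rightarrow> real"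
      using continuous_on_compose2[OF that, of UNIV "\<lambda>x. p - x"] by (simp add: continuous_on_diff)
    have out: "G (y - x) = 0" if "x \<notin> ?B" "norm (y - p) < r" "\<And>x. x \<notin> cball 0 r \<Longrightarrow> G x = 0" for x y and G :: "complex \<Rightarrow> real"
    proof (rule that(3), rule notI)
      assume "y - x \<in> cball 0 r"
      then show False
        using norm_triangle_ineq[of "p - y" "y - x"] that(1,2) by (simp add: dist_norm norm_minus_commute)
    qed
    have "((\<lambda>y. LINT x:?B|lborel. U x * F (y - x)) has_derivative
          (\<lambda>k. LINT x:?B|lborel. U x * ?D (p - x) k)) (at p)"
      by (rule has_derivative_convolution[OF D c iU])
    then have "((\<lambda>y. LINT x|lborel. U x * F (y - x)) has_derivative
          (\<lambda>k. LINT x:?B|lborel. U x * ?D (p - x) k)) (at p)"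
      by (rule has_derivative_transform_within_open[of _ _ _ _ "ball p r"])
        (use r out[of _ _ F, OF _ _ F(2)] in \<open>auto simp: dist_norm norm_minus_commute intro!: set_lebesgue_integral_support\<close>)
    moreover have "(LINT x:?B|lborel. U x * ?D (p - x) k) =
       Re k * (LINT x|lborel. U x * dir_deriv 1 F (p - x)) + Im k * (LINT x|lborel. U x * dir_deriv \<i> F (p - x))" for k
    proof -
      have s: "(LINT x:?B|lborel. U x * ?D (p - x) k) = (LINT x|lborel. U x * ?D (p - x) k)" for k
        by (rule set_lebesgue_integral_support) (use r out[of _ p "\<lambda>x. ?D x k", OF _ _ z] in auto)
      have i: "integrable lborel (\<lambda>x. U x * ?D (p - x) k)" for k
        by (rule integrable_set_support[OF set_integrable_mult_continuous[OF iU cr[OF c]]])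
          (use r out[of _ p "\<lambda>x. ?D x k", OF _ _ z] in auto)
      have e: "U x * ?D (p - x) k = Re k * (U x * ?D (p - x) 1) + Im k * (U x * ?D (p - x) \<i>)" for x
        by (subst ex) (simp add: algebra_simps)
      show ?thesis
        unfolding s by (subst e) (simp add: i)
    qed
    ultimately show ?thesis by simp
  qed
  have sb: "smooth (bump r)" "smooth (dir_deriv 1 (bump r))" "smooth (dir_deriv \<i> (bump r))"
    by (auto intro!: smooth_bump smooth_dir_deriv simp: Basis_complex_def)
  have zb: "bump r x = 0" if "x \<notin> cball 0 r" for x
    using that r by (simp add: bump_eq_0_iff)
  have zd: "dir_deriv k (bump r) x = 0" if "x \<notin> cball 0 r" for k x
    by (rule has_derivative_zero_outside[OF smooth_has_derivative[OF sb(1)] zb that])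
  let ?I = "\<lambda>F. LINT x|lborel. U x * F (p - x)"
  show "(mollify r U has_derivative (\<lambda>k. Re (mollify_grad r U p * k))) (at p)"
    unfolding mollify_def[abs_def] mollify_grad_def N_def[symmetric]
    using N by (auto intro!: derivative_eq_intros conv sb zb simp: add_divide_distrib diff_divide_distrib mult_ac)
  have cdd: "continuous_on UNIV (dir_deriv a (dir_deriv b (bump r)))" if "a \<in> Basis" "b \<in> Basis" for a b
    by (intro smooth_imp_continuous smooth_dir_deriv smooth_bump that)
  have zdd: "dir_deriv a (dir_deriv b (bump r)) x = 0" if "b \<in> Basis" "x \<notin> cball 0 r" for a b x
    by (rule has_derivative_zero_outside[OF smooth_has_derivative[OF smooth_dir_deriv[OF sb(1) that(1)]] zd that(2)])
  define \<eta> where "\<eta> = (\<lambda>x. bump r (p - x))"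
  have \<eta>: "smooth \<eta>" unfolding \<eta>_def by (rule smooth_reflect[OF sb(1)])
  have z\<eta>: "\<eta> x = 0" if "x \<notin> cball p r" for x
    using that zb[of "p - x"] by (simp add: \<eta>_def dist_norm norm_minus_commute)
  have ddc\<eta>: "ddc \<eta> x = (dir_deriv 1 (dir_deriv 1 (bump r)) (p - x) + dir_deriv \<i> (dir_deriv \<i> (bump r)) (p - x)) / (4 * pi)" for x
    unfolding \<eta>_def ddc_reflect[OF sb(1)] by (simp add: ddc_def Basis_complex_def)
  have cr: "continuous_on UNIV (\<lambda>x. G (p - x))" if "continuous_on UNIV G" for G :: "complex \<Rightarrow> real"
    using continuous_on_compose2[OF that, of UNIV "\<lambda>x. p - x"] by (simp add: continuous_on_diff)
  have int: "integrable lborel (\<lambda>x. w x * G (p - x))"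
    if "set_integrable lborel ?B w" "continuous_on UNIV G" "\<And>x. x \<notin> cball 0 r \<Longrightarrow> G x = 0" for w and G :: "complex \<Rightarrow> real"
  proof (rule integrable_set_support[OF set_integrable_mult_continuous[OF that(1) cr[OF that(2)]]])
    fix x assume "x \<notin> ?B"
    then show "w x * G (p - x) = 0"
      using r that(3)[of "p - x"] by (simp add: dist_norm norm_minus_commute)
  qed
  have int\<eta>: "integrable lborel (\<lambda>x. w x * ddc \<eta> x)" if "set_integrable lborel ?B w" for w
  proof -
    have "integrable lborel (\<lambda>x. (w x * dir_deriv 1 (dir_deriv 1 (bump r)) (p - x) + w x * dir_deriv \<i> (dir_deriv \<i> (bump r)) (p - x)) / (4 * pi))"
      by (intro integrable_divide Bochner_Integration.integrable_add int that cdd zdd) (auto simp: Basis_complex_def)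
    then show ?thesis by (simp add: ddc\<eta> distrib_left)
  qed
  have lap: "?I (dir_deriv 1 (dir_deriv 1 (bump r))) + ?I (dir_deriv \<i> (dir_deriv \<i> (bump r))) = 0"
  proof -
    have "?I (dir_deriv 1 (dir_deriv 1 (bump r))) + ?I (dir_deriv \<i> (dir_deriv \<i> (bump r))) =
      (LINT x|lborel. U x * dir_deriv 1 (dir_deriv 1 (bump r)) (p - x) + U x * dir_deriv \<i> (dir_deriv \<i> (bump r)) (p - x))"
      by (rule Bochner_Integration.integral_add[symmetric]; intro int iU cdd zdd) (auto simp: Basis_complex_def)
    also have "\<dots> = (LINT x|lborel. 4 * pi * (u x * ddc \<eta> x + Re (H x) * ddc \<eta> x))"
    proof (intro Bochner_Integration.integral_cong refl)
      fix x
      show "U x * dir_deriv 1 (dir_deriv 1 (bump r)) (p - x) + U x * dir_deriv \<i> (dir_deriv \<i> (bump r)) (p - x)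
         = 4 * pi * (u x * ddc \<eta> x + Re (H x) * ddc \<eta> x)"
      proof (cases "x \<in> ball p R")
        case True
        show ?thesis unfolding U[OF True] ddc\<eta> by (simp add: field_simps)
      next
        case False
        then have "p - x \<notin> cball 0 r" using \<open>2 * r < R\<close> r by (simp add: dist_norm norm_minus_commute)
        then show ?thesis
          using zdd[of 1 "p - x" 1] zdd[of \<i> "p - x" \<i>] by (simp add: ddc\<eta> Basis_complex_def)
      qed
    qed
    also have "\<dots> = 4 * pi * ((LINT x|lborel. u x * ddc \<eta> x) + (LINT x|lborel. Re (H x) * ddc \<eta> x))"
      using int\<eta>[OF iu] int\<eta>[OF iH] by simp
    also have "(LINT x|lborel. Re (H x) * ddc \<eta> x) = 0"
      by (rule integral_Re_holomorphic_ddc[OF H \<eta> z\<eta>]) (use \<open>2 * r < R\<close> r in auto)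
    also have "(LINT x|lborel. u x * ddc \<eta> x) = 0"
    proof -
      have "closure {x. \<eta> x \<noteq> 0} \<subseteq> cball p r"
        by (rule closure_minimal) (use z\<eta> in \<open>blast, simp\<close>)
      moreover have "cball p r \<subseteq> V" using sub r by (force simp: subset_iff)
      moreover have "compact (closure {x. \<eta> x \<noteq> 0})"
        using calculation(1) by (meson bounded_cball bounded_subset closed_closure compact_eq_bounded_closed)
      ultimately show ?thesis
        using u \<eta> unfolding ddc_vanishes_on_def by blast
    qed
    finally show ?thesis by simp
  qed
  show "mollify_grad r U field_differentiable (at p)"
  proof -
    let ?P1 = "?I (dir_deriv 1 (dir_deriv 1 (bump r)))" and ?Q1 = "?I (dir_deriv 1 (dir_deriv \<i> (bump r)))"
    have P: "((\<lambda>y. LINT x|lborel. U x * dir_deriv 1 (bump r) (y - x)) has_derivative (\<lambda>k. Re k * ?P1 + Im k * ?Q1)) (at p)"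
      using conv[OF sb(2) zd] by (simp add: dir_deriv_bump_commute[of \<i> 1])
    \<comment> \<open>\<open>lap\<close> turns the second derivative in direction
      \<open>\<i>\<close> into minus the second real one. With the symmetric mixed term, the two
      real differentials become those of one complex-linear map.\<close>
    have Q: "((\<lambda>y. LINT x|lborel. U x * dir_deriv \<i> (bump r) (y - x)) has_derivative (\<lambda>k. Re k * ?Q1 - Im k * ?P1)) (at p)"
    proof -
      have "?I (dir_deriv \<i> (dir_deriv \<i> (bump r))) = - ?P1" using lap by linarith
      then show ?thesis using conv[OF sb(3) zd] by simp
    qed
    have "(mollify_grad r U has_derivative (\<lambda>k. (Complex ?P1 (- ?Q1) / N) * k)) (at p)"
    proof -
      have "((\<lambda>y. (of_real (LINT x|lborel. U x * dir_deriv 1 (bump r) (y - x))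
         - \<i> * of_real (LINT x|lborel. U x * dir_deriv \<i> (bump r) (y - x))) / of_real N) has_derivative
         (\<lambda>k. (of_real (Re k * ?P1 + Im k * ?Q1) - \<i> * of_real (Re k * ?Q1 - Im k * ?P1)) / of_real N)) (at p)"
        using N by (auto intro!: derivative_eq_intros P Q)
      moreover have "(of_real (Re k * ?P1 + Im k * ?Q1) - \<i> * of_real (Re k * ?Q1 - Im k * ?P1)) / of_real N
         = (Complex ?P1 (- ?Q1) / N) * k" for k
        by (simp add: complex_eq_iff algebra_simps add_divide_distrib diff_divide_distrib)
      moreover have "mollify_grad r U = (\<lambda>y. (of_real (LINT x|lborel. U x * dir_deriv 1 (bump r) (y - x))
         - \<i> * of_real (LINT x|lborel. U x * dir_deriv \<i> (bump r) (y - x))) / of_real N)"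
        by (simp add: fun_eq_iff mollify_grad_def N_def Complex_eq)
      ultimately show ?thesis by (simp only:)
    qed
    then show ?thesis
      unfolding field_differentiable_def has_field_derivative_def by blast
  qed
qed

text \<open>\<open>f\<close> plays the role of 2 dA/dz. The real part of a primitive of
  \<open>f\<close> on the ball has the same differential as A, so the two differ by a
  constant.\<close>

lemma harmonic_imp_Re_holomorphic:
  assumes A: "\<And>p. p \<in> ball c R \<Longrightarrow> (A has_derivative (\<lambda>k. Re (f p * k))) (at p)"
    and f: "\<And>p. p \<in> ball c R \<Longrightarrow> f field_differentiable (at p)"
  obtains H where "H holomorphic_on ball c R" "\<And>p. p \<in> ball c R \<Longrightarrow> A p = Re (H p)"
proof -
  have "f holomorphic_on ball c R"
    using f by (simp add: holomorphic_on_open field_differentiable_def)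
  then obtain g where "\<And>x. x \<in> ball c R \<Longrightarrow> (g has_field_derivative f x) (at x within ball c R)"
    using holomorphic_convex_primitive'[OF convex_ball open_ball] by blast
  then have g: "\<And>x. x \<in> ball c R \<Longrightarrow> (g has_field_derivative f x) (at x)"
    by (simp add: at_within_open[OF _ open_ball])
  have "((\<lambda>x. A x - Re (g x)) has_derivative (\<lambda>k. 0)) (at x within ball c R)" if "x \<in> ball c R" for x
  proof -
    have "((\<lambda>x. A x - Re (g x)) has_derivative (\<lambda>k. Re (f x * k) - Re (f x * k))) (at x)"
      by (intro has_derivative_diff A that bounded_linear.has_derivative[OF bounded_linear_Re]
          has_field_derivative_imp_has_derivative g)
    then show ?thesis by (simp add: has_derivative_at_withinI)
  qed
  then obtain d where d: "\<And>x. x \<in> ball c R \<Longrightarrow> A x - Re (g x) = d"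
    using has_derivative_zero_constant[OF convex_ball, of c R "\<lambda>x. A x - Re (g x)"] by blast
  show thesis
  proof (rule that[of "\<lambda>x. g x + of_real d"])
    show "(\<lambda>x. g x + of_real d) holomorphic_on ball c R"
      using g by (intro holomorphic_intros) (meson holomorphic_on_open open_ball)
  qed (use d in force)
qed

section \<open>Means over circles\<close>

lemma ereal_integral_continuous:
  assumes b: "continuous_on UNIV b"
  shows "ereal_integral (uniform_measure lborel {0..2 * pi}) (\<lambda>\<theta>. ereal (b \<theta>)) =
    ereal (integral {0..2 * pi} b / (2 * pi))"
proof -
  let ?A = "{0..2 * pi}" and ?M = "uniform_measure lborel {0..2 * pi}"
  have int: "integrable lborel (\<lambda>x. indicator ?A x *\<^sub>R g x)" if "continuous_on UNIV g" for g :: "real \<Rightarrow> real"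
    using that by (intro borel_integrable_compact) (auto intro: continuous_on_subset)
  \<comment> \<open>Truncation by \<open>e2ennreal\<close> leaves the positive part; the other half
    of \<open>ereal_integral\<close> is the same statement for -b.\<close>
  have pos: "enn2ereal (\<integral>\<^sup>+ x. e2ennreal (ereal (g x)) \<partial>?M) = ereal ((LINT x:?A|lborel. max 0 (g x)) / (2 * pi))"
    if g: "continuous_on UNIV g" for g :: "real \<Rightarrow> real"
  proof -
    have m: "(\<lambda>x. ennreal (g x)) \<in> borel_measurable lborel"
      using borel_measurable_continuous_onI[OF g] by simp
    have cm: "continuous_on UNIV (\<lambda>x. max 0 (g x))"
      by (intro continuous_intros g)
    have nn: "(LINT x:?A|lborel. max 0 (g x)) \<ge> 0"
      unfolding set_lebesgue_integral_def by (rule Bochner_Integration.integral_nonneg) auto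
    have "(\<integral>\<^sup>+ x. e2ennreal (ereal (g x)) \<partial>?M) = (\<integral>\<^sup>+ x. ennreal (g x) \<partial>?M)"
      by (simp add: ennreal.abs_eq e2ennreal_def)
    also have "\<dots> = (\<integral>\<^sup>+ x. ennreal (g x) * indicator ?A x \<partial>lborel) / emeasure lborel ?A"
      by (rule nn_integral_uniform_measure[OF m]) auto
    also have "(\<integral>\<^sup>+ x. ennreal (g x) * indicator ?A x \<partial>lborel) = (\<integral>\<^sup>+ x. ennreal (indicator ?A x *\<^sub>R max 0 (g x)) \<partial>lborel)"
      by (intro nn_integral_cong) (auto simp: indicator_def max_def ennreal_neg)
    also have "\<dots> = ennreal (LINT x:?A|lborel. max 0 (g x))"
      unfolding set_lebesgue_integral_def by (rule nn_integral_eq_integral[OF int[OF cm]]) auto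
    also have "\<dots> / emeasure lborel ?A = ennreal ((LINT x:?A|lborel. max 0 (g x)) / (2 * pi))"
      using nn by (simp add: divide_ennreal)
    finally show ?thesis using nn by (simp add: enn2ereal_ennreal)
  qed
  have cp: "continuous_on UNIV (\<lambda>x. max 0 (b x))" "continuous_on UNIV (\<lambda>x. max 0 (- b x))" "continuous_on UNIV (\<lambda>x. - b x)"
    by (intro continuous_intros b)+
  have "(LINT x:?A|lborel. max 0 (b x)) - (LINT x:?A|lborel. max 0 (- b x)) = (LINT x:?A|lborel. max 0 (b x) - max 0 (- b x))"
    using set_integral_diff(2)[of lborel ?A "\<lambda>x. max 0 (b x)" "\<lambda>x. max 0 (- b x)"] int[OF cp(1)] int[OF cp(2)]
    by (simp add: set_integrable_def)
  also have "\<dots> = (LINT x:?A|lborel. b x)"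
    by (rule arg_cong[where f="set_lebesgue_integral lborel ?A"]) (auto simp: max_def)
  also have "\<dots> = integral ?A b"
    by (rule set_borel_integral_eq_integral(2)) (use int[OF b] in \<open>simp add: set_integrable_def\<close>)
  finally have "(LINT x:?A|lborel. max 0 (b x)) - (LINT x:?A|lborel. max 0 (- b x)) = integral ?A b" .
  then show ?thesis
    unfolding ereal_integral_def uminus_ereal.simps pos[OF b] pos[OF cp(3)]
    by (simp add: diff_divide_distrib[symmetric])
qed

lemma ereal_integral_mono:
  assumes "\<And>x. f x \<le> g x" shows "ereal_integral M f \<le> ereal_integral M g"
  unfolding ereal_integral_def
proof (rule ereal_minus_mono)
  show "enn2ereal (\<integral>\<^sup>+ x. e2ennreal (f x) \<partial>M) \<le> enn2ereal (\<integral>\<^sup>+ x. e2ennreal (g x) \<partial>M)"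
    using assms by (auto simp flip: less_eq_ennreal.rep_eq intro!: nn_integral_mono e2ennreal_mono)
  show "enn2ereal (\<integral>\<^sup>+ x. e2ennreal (- g x) \<partial>M) \<le> enn2ereal (\<integral>\<^sup>+ x. e2ennreal (- f x) \<partial>M)"
    using assms by (auto simp flip: less_eq_ennreal.rep_eq intro!: nn_integral_mono e2ennreal_mono)
qed

lemma integral_periodic_shift:
  fixes l :: "real \<Rightarrow> real"
  assumes l: "continuous_on UNIV l" and per: "\<And>x. l (x + 2 * pi) = l x" and a: "0 \<le> a" "a \<le> 2 * pi"
  shows "integral {a..a + 2 * pi} l = integral {0..2 * pi} l"
proof -
  have i: "l integrable_on {u..v}" for u v
    using l by (intro integrable_continuous_real) (auto intro: continuous_on_subset)
  have "integral {0..a} l = integral {0..a} (\<lambda>x. l (x + 2 * pi))"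
    using per by simp
  also have "\<dots> = integral {2 * pi..a + 2 * pi} l"
    using integral_shift[of 0 "2 * pi" a l] l by (simp add: o_def continuous_on_subset)
  finally have "integral {0..a} l = integral {2 * pi..a + 2 * pi} l" .
  moreover have "integral {0..a} l + integral {a..2 * pi} l = integral {0..2 * pi} l"
    using a by (intro Henstock_Kurzweil_Integration.integral_combine i)
  moreover have "integral {a..2 * pi} l + integral {2 * pi..a + 2 * pi} l = integral {a..a + 2 * pi} l"
    using a by (intro Henstock_Kurzweil_Integration.integral_combine i) auto
  ultimately show ?thesis by linarith
qed

text \<open>The product \<open>F \<zeta> = (\<Prod>k<n. a (\<zeta> * w ^ k))\<close> over the \<open>n\<close>-th roots of unity satisfies the maximum
  principle, and the logarithm of its bound on the circle is \<open>n\<close> times a Riemann sum. So the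
  easy half of Jensen's formula holds without any regard to the zeros of \<open>a\<close>.\<close>

lemma ln_cmod_le_mean:
  fixes l :: "real \<Rightarrow> real"
  assumes a: "a holomorphic_on UNIV" "a 0 \<noteq> 0" and l: "continuous_on UNIV l" "\<And>x. l (x + 2 * pi) = l x"
    and le: "\<And>x. cmod (a (cis x)) \<le> exp (l x)"
  shows "ln (cmod (a 0)) \<le> integral {0..2 * pi} l / (2 * pi)"
proof (rule field_le_epsilon)
  fix e :: real assume "e > 0"
  \<comment> \<open>The sample points start at an angle t in [0, 2 pi] and go once around, hence the
    interval up to 4 pi.\<close>
  have "uniformly_continuous_on {0..4 * pi} l"
    by (rule compact_uniformly_continuous[OF continuous_on_subset[OF l(1)]]) auto
  then obtain d where d: "d > 0" "\<And>x y. x \<in> {0..4*pi} \<Longrightarrow> y \<in> {0..4*pi} \<Longrightarrow> dist y x < d \<Longrightarrow> dist (l y) (l x) < e"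
    unfolding uniformly_continuous_on_def using \<open>e > 0\<close> by metis
  obtain n :: nat where n: "2 * pi / d < n" using reals_Archimedean2 by blast
  have "n > 0" using n d(1) by (metis divide_pos_pos gr0I not_less_iff_gr_or_eq of_nat_0 order_less_trans pi_gt_zero mult_pos_pos zero_less_numeral)
  define h where "h = 2 * pi / n"
  have h: "0 < h" "h < d" "n * h = 2 * pi"
    using n d(1) \<open>n > 0\<close> by (auto simp: h_def field_simps)
  define F where "F = (\<lambda>z. \<Prod>k<n. a (z * cis (k * h)))"
  have holF: "F holomorphic_on UNIV"
    unfolding F_def by (intro holomorphic_intros holomorphic_on_compose_gen[OF _ a(1), unfolded o_def]) auto
  obtain w where w: "cmod w = 1" "cmod (F 0) \<le> cmod (F w)"
  proof -
    have "continuous_on (sphere 0 1) (\<lambda>z. cmod (F z))"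
      using holF
      by (intro continuous_intros) (auto intro: continuous_on_subset holomorphic_on_imp_continuous_on)
    then obtain w where w: "w \<in> sphere 0 1" "\<And>z. z \<in> sphere 0 1 \<Longrightarrow> cmod (F z) \<le> cmod (F w)"
      using continuous_attains_sup[of "sphere (0::complex) 1" "\<lambda>z. cmod (F z)"] by auto
    have "cmod (F 0) \<le> cmod (F w)"
    proof (rule maximum_modulus_frontier[of F "cball 0 1"])
      show "F holomorphic_on interior (cball 0 1)" "continuous_on (closure (cball 0 1)) F"
        using holF by (auto intro: holomorphic_on_subset holomorphic_on_imp_continuous_on continuous_on_subset)
    qed (use w in auto)
    with w that show thesis by auto
  qed
  define t where "t = Arg2pi w"
  have t: "0 \<le> t" "t \<le> 2 * pi" "w = cis t"
    using Arg2pi_ge_0[of w] Arg2pi_lt_2pi[of w] Arg2pi_eq[of w] w(1) by (auto simp: t_def cis_conv_exp)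
  have F0: "cmod (F 0) = cmod (a 0) ^ n"
    by (simp add: F_def norm_power)
  have "cmod (F w) \<le> (\<Prod>k<n. exp (l (t + k * h)))"
    unfolding F_def t(3) cis_mult prod_norm[symmetric]
    by (intro prod_mono) (use le in auto)
  also have "\<dots> = exp (\<Sum>k<n. l (t + k * h))"
    by (simp add: exp_sum)
  finally have "cmod (a 0) ^ n \<le> exp (\<Sum>k<n. l (t + k * h))"
    using w(2) F0 by simp
  then have "n * ln (cmod (a 0)) \<le> (\<Sum>k<n. l (t + k * h))"
    using a(2) by (metis ln_exp ln_le_cancel_iff ln_realpow norm_eq_zero exp_gt_zero zero_less_norm_iff zero_less_power)
  then have "n * h * ln (cmod (a 0)) \<le> (\<Sum>k<n. h * l (t + k * h))"
    using h(1) by (simp add: sum_distrib_left[symmetric] mult.commute[of _ h] mult.assoc)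
  \<comment> \<open>Each term is compared with the integral over its own arc of length h < d, on
    which l varies by less than e.\<close>
  also have "(\<Sum>k<n. h * l (t + k * h)) \<le> (\<Sum>k<n. integral {t + k * h..t + Suc k * h} l + h * e)"
  proof (rule sum_mono)
    fix k assume k: "k \<in> {..<n}"
    have "Suc k * h \<le> 2 * pi" using k h by (metis Suc_leI lessThan_iff mult_right_mono of_nat_le_iff less_imp_le)
    then have kh: "t + k * h \<in> {0..4*pi}" "t + Suc k * h \<le> 4 * pi" "t + k * h \<le> t + Suc k * h"
      using t h by (auto simp: algebra_simps)
    have "h * (l (t + k * h) - e) = integral {t + k * h..t + Suc k * h} (\<lambda>x. l (t + k * h) - e)"
      using h(1) by (simp add: algebra_simps)
    also have "\<dots> \<le> integral {t + k * h..t + Suc k * h} l"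
    proof (rule integral_le)
      show "l integrable_on {t + k * h..t + Suc k * h}"
        using l(1) by (intro integrable_continuous_real) (auto intro: continuous_on_subset)
      fix x assume x: "x \<in> {t + k * h..t + Suc k * h}"
      have "dist (t + k * h) x < d" using x h by (simp add: dist_real_def algebra_simps)
      then show "l (t + k * h) - e \<le> l x"
        using d(2)[of x "t + k * h"] x kh by (auto simp: dist_real_def)
    qed auto
    finally show "h * l (t + k * h) \<le> integral {t + k * h..t + Suc k * h} l + h * e"
      by (simp add: algebra_simps)
  qed
  also have "\<dots> = (\<Sum>k<n. integral {t + k * h..t + Suc k * h} l) + n * h * e"
    by (simp add: sum.distrib)
  also have "(\<Sum>k<m. integral {t + k * h..t + Suc k * h} l) = integral {t..t + m * h} l" for m :: nat
  proof (induction m)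
    case (Suc m)
    have "integral {t..t + m * h} l + integral {t + m * h..t + Suc m * h} l = integral {t..t + Suc m * h} l"
      by (rule Henstock_Kurzweil_Integration.integral_combine)
        (use h(1) l(1) in \<open>auto simp: algebra_simps intro!: integrable_continuous_real intro: continuous_on_subset\<close>)
    then show ?case using Suc by simp
  qed simp
  finally have "2 * pi * ln (cmod (a 0)) \<le> integral {t..t + 2 * pi} l + 2 * pi * e"
    by (simp add: h(3))
  then show "ln (cmod (a 0)) \<le> integral {0..2 * pi} l / (2 * pi) + e"
    using integral_periodic_shift[OF l t(1,2)] by (simp add: field_simps)
qed

text \<open>The logarithm of the norm of a holomorphic vector f = (f1, f2, f3) has the sub-mean
  value property. The scalar function a(z) = <f(z), f(0)> / |f(0)| has the value |f(0)| at 0 and is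
  dominated by |f| everywhere, so the scalar inequality for a suffices.\<close>

lemma ln_sum_squares_le_mean:
  fixes f1 f2 f3 :: "complex \<Rightarrow> complex"
  assumes hol: "f1 holomorphic_on UNIV" "f2 holomorphic_on UNIV" "f3 holomorphic_on UNIV"
  defines "S \<equiv> \<lambda>z. (cmod (f1 z))\<^sup>2 + (cmod (f2 z))\<^sup>2 + (cmod (f3 z))\<^sup>2"
  assumes pos: "\<And>z. S z > 0"
  shows "ln (S 0) / 2 \<le> integral {0..2 * pi} (\<lambda>x. ln (S (cis x)) / 2) / (2 * pi)"
proof -
  define a where "a = (\<lambda>z. (cnj (f1 0) * f1 z + cnj (f2 0) * f2 z + cnj (f3 0) * f3 z) / sqrt (S 0))"
  have "a 0 = of_real (S 0) / of_real (sqrt (S 0))"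
    unfolding a_def S_def of_real_add complex_norm_square by (simp add: mult.commute)
  then have a0: "a 0 = of_real (sqrt (S 0))"
    using pos[of 0] by (simp add: real_div_sqrt flip: of_real_divide)
  have cont: "continuous_on UNIV (\<lambda>x. f (cis x))" if "f holomorphic_on UNIV" for f
    by (rule continuous_on_compose2[OF holomorphic_on_imp_continuous_on[OF that]])
      (auto intro: continuous_intros)
  have "ln (cmod (a 0)) \<le> integral {0..2 * pi} (\<lambda>x. ln (S (cis x)) / 2) / (2 * pi)"
  proof (rule ln_cmod_le_mean)
    show "a holomorphic_on UNIV"
      unfolding a_def using pos[of 0] by (intro holomorphic_intros hol) auto
    show "a 0 \<noteq> 0" using a0 pos[of 0] by simp
    show "continuous_on UNIV (\<lambda>x. ln (S (cis x)) / 2)"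
      using pos by (intro continuous_intros) (auto simp: S_def intro!: continuous_intros cont hol simp: less_imp_neq[symmetric])
    show "ln (S (cis (x + 2 * pi))) / 2 = ln (S (cis x)) / 2" for x
      by (simp add: cis.code)
    fix x
    let ?z = "cis x"
    have "(cmod (cnj (f1 0) * f1 ?z + cnj (f2 0) * f2 ?z + cnj (f3 0) * f3 ?z))\<^sup>2
       \<le> (cmod (f1 0) * cmod (f1 ?z) + cmod (f2 0) * cmod (f2 ?z) + cmod (f3 0) * cmod (f3 ?z))\<^sup>2"
      by (intro power_mono order_trans[OF norm_triangle_ineq] add_mono) (auto simp: norm_mult)
    also have "\<dots> \<le> S 0 * S ?z"
    proof -
      \<comment> \<open>Lagrange's identity for the vectors of moduli, which gives
        Cauchy-Schwarz.\<close>
      have "S 0 * S ?z - (cmod (f1 0) * cmod (f1 ?z) + cmod (f2 0) * cmod (f2 ?z) + cmod (f3 0) * cmod (f3 ?z))\<^sup>2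
        = (cmod (f1 0) * cmod (f2 ?z) - cmod (f2 0) * cmod (f1 ?z))\<^sup>2 + (cmod (f1 0) * cmod (f3 ?z) - cmod (f3 0) * cmod (f1 ?z))\<^sup>2
          + (cmod (f2 0) * cmod (f3 ?z) - cmod (f3 0) * cmod (f2 ?z))\<^sup>2"
        by (simp add: S_def power2_eq_square algebra_simps)
      then show ?thesis by (smt (verit) zero_le_power2)
    qed
    finally have "(cmod (a ?z))\<^sup>2 \<le> S ?z"
      using pos[of 0] by (simp add: a_def norm_divide power_divide divide_le_eq mult.commute)
    then have "cmod (a ?z) \<le> sqrt (S ?z)" by (rule real_le_rsqrt)
    also have "sqrt (S ?z) = exp (ln (S ?z) / 2)"
      using pos[of ?z] by (simp add: ln_sqrt[symmetric])
    finally show "cmod (a ?z) \<le> exp (ln (S ?z) / 2)" .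
  qed
  then show ?thesis
    using a0 pos[of 0] by (simp add: ln_sqrt)
qed

section \<open>The boundary data\<close>

text \<open>The potential is homogeneous of degree four in the coordinates \<open>(u, v)\<close> of the point \<open>v / u\<close> of
  the projective line.\<close>

definition pot :: "real \<Rightarrow> complex \<Rightarrow> complex \<Rightarrow> complex \<Rightarrow> real" where
  "pot c u v t = (cmod (u\<^sup>2))\<^sup>2 + (cmod (u * v / c))\<^sup>2 + (cmod (v\<^sup>2 - c\<^sup>2 * t\<^sup>2 * u\<^sup>2))\<^sup>2"

text \<open>The value 0 at infinity is the limit: \<open>pot c 1 y t\<close> grows like |y|^4, so
  half its logarithm cancels \<open>FS_pot y\<close>. The formula is kept for all t and not only on
  the circle, since inside it serves as a subsolution.\<close>

definition branched_data :: "real \<Rightarrow> complex option \<times> complex \<Rightarrow> real" where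
  "branched_data c = (\<lambda>(p, t). case p of None \<Rightarrow> 0 | Some y \<Rightarrow> ln (pot c 1 y t) / 2 - FS_pot y)"

lemma pot_pos: "u \<noteq> 0 \<or> v \<noteq> 0 \<Longrightarrow> pot c u v t > 0"
  unfolding pot_def
  by (cases "u = 0") (auto intro!: add_pos_nonneg)

lemma pot_scale: "pot c (s * u) (s * v) t = (cmod s) ^ 4 * pot c u v t"
proof -
  have "(s * v)\<^sup>2 - (complex_of_real c)\<^sup>2 * t\<^sup>2 * (s * u)\<^sup>2 = s\<^sup>2 * (v\<^sup>2 - (complex_of_real c)\<^sup>2 * t\<^sup>2 * u\<^sup>2)"
    "(s * u)\<^sup>2 = s\<^sup>2 * u\<^sup>2" "s * u * (s * v) / c = s\<^sup>2 * (u * v / c)"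
    by (simp_all add: power2_eq_square algebra_simps)
  moreover have "(cmod (s\<^sup>2 * A))\<^sup>2 + (cmod (s\<^sup>2 * B))\<^sup>2 + (cmod (s\<^sup>2 * C))\<^sup>2
      = (cmod s) ^ 4 * ((cmod A)\<^sup>2 + (cmod B)\<^sup>2 + (cmod C)\<^sup>2)" for A B C
    by (simp add: norm_mult norm_power power_mult_distrib distrib_left flip: power_mult)
  ultimately show ?thesis
    unfolding pot_def by (simp only:)
qed

lemma FS_pot_branched_data_Some: "FS_pot z + branched_data c (Some z, t) = ln (pot c 1 z t) / 2"
  by (simp add: branched_data_def)

lemma FS_pot_branched_data_inf: "FS_pot x + branched_data c (chart_inf x, t) = ln (pot c x 1 t) / 2"
proof (cases "x = 0")
  case True
  then show ?thesis by (simp add: branched_data_def chart_inf_def FS_pot_def pot_def)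
next
  case False
  have "pot c x 1 t = (cmod x) ^ 4 * pot c 1 (1 / x) t"
    using pot_scale[of c x 1 "1 / x" t] False by simp
  then have "ln (pot c x 1 t) = 4 * ln (cmod x) + ln (pot c 1 (1 / x) t)"
    using False pot_pos[of 1 "1/x" c t] by (simp add: ln_mult ln_realpow)
  moreover have "FS_pot (1 / x) = FS_pot x - 2 * ln (cmod x)"
  proof -
    have "1 + (cmod (1 / x))\<^sup>2 = (1 + (cmod x)\<^sup>2) / (cmod x)\<^sup>2"
      using False by (simp add: norm_divide field_simps)
    moreover have "1 + (cmod x)\<^sup>2 > 0" by (simp add: add_pos_nonneg)
    ultimately show ?thesis
      using False by (simp add: FS_pot_def ln_div ln_realpow)
  qed
  ultimately show ?thesis
    using False by (simp add: branched_data_def chart_inf_def)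
qed

section \<open>Smoothness and positivity of the boundary data in both charts\<close>

definition csmooth :: "('a::euclidean_space \<Rightarrow> complex) \<Rightarrow> bool" where
  "csmooth f \<longleftrightarrow> smooth (\<lambda>x. Re (f x)) \<and> smooth (\<lambda>x. Im (f x))"

lemma csmooth_const: "csmooth (\<lambda>x. c)"
  by (simp add: csmooth_def smooth_const)

lemma csmooth_bounded_linear: "bounded_linear f \<Longrightarrow> csmooth f"
  unfolding csmooth_def
  by (intro conjI smooth_bounded_linear bounded_linear_compose[OF bounded_linear_Re]
      bounded_linear_compose[OF bounded_linear_Im])

lemma csmooth_diff: "csmooth f \<Longrightarrow> csmooth g \<Longrightarrow> csmooth (\<lambda>x. f x - g x)"
  by (simp add: csmooth_def smooth_diff)

lemma csmooth_mult: "csmooth f \<Longrightarrow> csmooth g \<Longrightarrow> csmooth (\<lambda>x. f x * g x)"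
  by (simp add: csmooth_def smooth_diff smooth_mult smooth_add)

lemma csmooth_cis: "smooth h \<Longrightarrow> csmooth (\<lambda>x. cis (h x))"
  by (simp add: csmooth_def smooth_cos smooth_sin)

lemma csmooth_power: "csmooth f \<Longrightarrow> csmooth (\<lambda>x. f x ^ n)"
  by (induction n) (auto intro: csmooth_mult csmooth_const)

lemma smooth_cmod_power2_csmooth: "csmooth f \<Longrightarrow> smooth (\<lambda>x. (cmod (f x))\<^sup>2)"
  unfolding cmod_power2 csmooth_def by (intro smooth_add smooth_power) auto

lemma smooth_ln_pot:
  assumes "csmooth u" "csmooth v" "csmooth t" "\<And>x. u x \<noteq> 0 \<or> v x \<noteq> 0"
  shows "smooth (\<lambda>x. ln (pot c (u x) (v x) (t x)) / 2)"
  unfolding divide_inverse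
  by (intro smooth_mult smooth_const smooth_ln pot_pos assms)
    (unfold pot_def divide_inverse, intro smooth_add smooth_cmod_power2_csmooth csmooth_power csmooth_mult csmooth_diff csmooth_const assms)

lemma smooth_local_rep_branched_data:
  assumes "ch \<in> P1_charts" shows "smooth (local_rep ch (branched_data c))"
proof -
  have FS: "smooth (\<lambda>x :: complex \<times> real. FS_pot (fst x))"
    unfolding FS_pot_def
    by (intro smooth_ln smooth_add smooth_const smooth_cmod_power2_csmooth csmooth_bounded_linear bounded_linear_fst)
      (auto intro: add_pos_nonneg)
  have "local_rep Some (branched_data c) = (\<lambda>x. ln (pot c 1 (fst x) (cis (snd x))) / 2 - FS_pot (fst x))"
    using FS_pot_branched_data_Some[of _ c] by (auto simp: local_rep_def fun_eq_iff algebra_simps)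
  moreover have "local_rep chart_inf (branched_data c) = (\<lambda>x. ln (pot c (fst x) 1 (cis (snd x))) / 2 - FS_pot (fst x))"
    using FS_pot_branched_data_inf[of _ c] by (auto simp: local_rep_def fun_eq_iff algebra_simps)
  moreover have "csmooth (\<lambda>x :: complex \<times> real. fst x)" "csmooth (\<lambda>x :: complex \<times> real. cis (snd x))"
    by (intro csmooth_bounded_linear csmooth_cis smooth_bounded_linear bounded_linear_fst bounded_linear_snd)+
  ultimately show ?thesis
    using assms by (auto simp: P1_charts_def intro!: smooth_diff FS smooth_ln_pot csmooth_const)
qed

text \<open>Up to a positive factor this is the pull-back of the Fubini-Study form of the projective
  plane under [f1 : f2 : f3]. With G = |f'|^2 and T = <f', f> it equals (S G - |T|^2) / (2 pi S^2),
  and Lagrange's identity makes the numerator the sum of the squared moduli of the Wronskians, one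
  of which is nonzero at z.\<close>

lemma ddc_ln_sum_squares_pos:
  fixes f1 f2 f3 :: "complex \<Rightarrow> complex"
  assumes f: "f1 holomorphic_on UNIV" "f2 holomorphic_on UNIV" "f3 holomorphic_on UNIV"
  defines "S \<equiv> \<lambda>z. (cmod (f1 z))\<^sup>2 + (cmod (f2 z))\<^sup>2 + (cmod (f3 z))\<^sup>2"
  assumes pos: "\<And>z. S z > 0"
    and minor: "f1 z * deriv f2 z \<noteq> f2 z * deriv f1 z \<or> f1 z * deriv f3 z \<noteq> f3 z * deriv f1 z
      \<or> f2 z * deriv f3 z \<noteq> f3 z * deriv f2 z"
  shows "ddc (\<lambda>z. ln (S z) / 2) z > 0"
proof -
  have d1: "(h has_derivative (\<lambda>k. deriv h z * k)) (at z)" if "h holomorphic_on UNIV" for h z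
    using holomorphic_derivI[OF that open_UNIV] by (simp add: has_field_derivative_def)
  have f': "deriv f1 holomorphic_on UNIV" "deriv f2 holomorphic_on UNIV" "deriv f3 holomorphic_on UNIV"
    using f by (auto intro: holomorphic_deriv)
  note D = d1[OF f(1)] d1[OF f(2)] d1[OF f(3)] d1[OF f'(1)] d1[OF f'(2)] d1[OF f'(3)]
  define T where "T z = deriv f1 z * cnj (f1 z) + deriv f2 z * cnj (f2 z) + deriv f3 z * cnj (f3 z)" for z
  define T' where "T' z b = deriv (deriv f1) z * b * cnj (f1 z) + deriv f1 z * cnj (deriv f1 z * b)
     + (deriv (deriv f2) z * b * cnj (f2 z) + deriv f2 z * cnj (deriv f2 z * b))
     + (deriv (deriv f3) z * b * cnj (f3 z) + deriv f3 z * cnj (deriv f3 z * b))" for z b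
  have dS: "(S has_derivative (\<lambda>b. 2 * Re (b * T z))) (at z)" for z
    unfolding S_def cmod_power2 T_def
    by (auto intro!: derivative_eq_intros D simp: algebra_simps)
  have dT: "(T has_derivative T' z) (at z)" for z
    unfolding T_def[abs_def] T'_def[abs_def]
    by (auto intro!: derivative_eq_intros D bounded_linear.has_derivative[OF bounded_linear_cnj] simp: algebra_simps)
  have d: "dir_deriv b (\<lambda>z. ln (S z) / 2) = (\<lambda>z. Re (b * T z) / S z)" for b
    by (intro ext dir_deriv_eq)
      (use pos in \<open>auto intro!: derivative_eq_intros dS simp: field_simps less_imp_neq[symmetric]\<close>)
  have dd: "dir_deriv b (\<lambda>z. Re (b * T z) / S z) z = Re (b * T' z b) / S z - 2 * (Re (b * T z))\<^sup>2 / (S z)\<^sup>2" for b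
  proof -
    have "((\<lambda>z. Re (b * T z) / S z) has_derivative
        (\<lambda>h. (Re (b * T' z h) * S z - Re (b * T z) * (2 * Re (h * T z))) / (S z * S z))) (at z)"
      using pos[of z]
      by (intro has_derivative_divide' bounded_linear.has_derivative[OF bounded_linear_Re] has_derivative_mult_right dS dT) simp
    moreover have "(A * S z - B * (2 * B)) / (S z * S z) = A / S z - 2 * B\<^sup>2 / (S z)\<^sup>2" for A B
      using pos[of z] by (simp add: diff_divide_distrib power2_eq_square)
    ultimately show ?thesis
      by (simp only: dir_deriv_eq)
  qed
  define G where "G = (cmod (deriv f1 z))\<^sup>2 + (cmod (deriv f2 z))\<^sup>2 + (cmod (deriv f3 z))\<^sup>2"
  have "Re (1 * T' z 1) + Re (\<i> * T' z \<i>) = 2 * G"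
    unfolding T'_def G_def cmod_power2 by (simp add: power2_eq_square algebra_simps)
  moreover have "(Re (1 * T z))\<^sup>2 + (Re (\<i> * T z))\<^sup>2 = (cmod (T z))\<^sup>2"
    by (simp add: cmod_power2)
  ultimately have "ddc (\<lambda>z. ln (S z) / 2) z = (2 * G / S z - 2 * (cmod (T z))\<^sup>2 / (S z)\<^sup>2) / (4 * pi)"
    unfolding ddc_def d using dd[of 1] dd[of \<i>]
    by (simp add: Basis_complex_def add_divide_distrib[symmetric] diff_divide_distrib[symmetric])
      (smt (verit) add_divide_distrib diff_divide_distrib)
  moreover have "S z * G - (cmod (T z))\<^sup>2 = (cmod (f1 z * deriv f2 z - f2 z * deriv f1 z))\<^sup>2
     + (cmod (f1 z * deriv f3 z - f3 z * deriv f1 z))\<^sup>2 + (cmod (f2 z * deriv f3 z - f3 z * deriv f2 z))\<^sup>2"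
  proof -
    have "complex_of_real (S z * G - (cmod (T z))\<^sup>2) = complex_of_real ((cmod (f1 z * deriv f2 z - f2 z * deriv f1 z))\<^sup>2
     + (cmod (f1 z * deriv f3 z - f3 z * deriv f1 z))\<^sup>2 + (cmod (f2 z * deriv f3 z - f3 z * deriv f2 z))\<^sup>2)"
      unfolding S_def G_def T_def of_real_add of_real_diff of_real_mult complex_norm_square
      by (simp add: algebra_simps)
    then show ?thesis by (simp only: of_real_eq_iff)
  qed
  moreover have "\<dots> > 0"
  proof -
    have "a\<^sup>2 + b\<^sup>2 + d\<^sup>2 > 0" if "a \<noteq> 0 \<or> b \<noteq> 0 \<or> d \<noteq> 0" for a b d :: real
      using that by (elim disjE) (simp_all add: add_pos_nonneg add_nonneg_pos)
    then show ?thesis using minor by auto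
  qed
  ultimately have "S z * G > (cmod (T z))\<^sup>2" by linarith
  then have "2 * G / S z - 2 * (cmod (T z))\<^sup>2 / (S z)\<^sup>2 > 0"
    using pos[of z] by (simp add: field_simps power2_eq_square)
  then show ?thesis
    using \<open>ddc _ z = _\<close> by simp
qed

text \<open>In the finite chart the Wronskian of 1 and z/c is the constant 1/c. In the chart at
  infinity z^2 and z/c have Wronskian -z^2/c, and at z = 0 the second and third components give
  -1/c.\<close>

lemma smooth_boundary_data_branched_data:
  assumes "c > 0" shows "smooth_boundary_data (branched_data c)"
  unfolding smooth_boundary_data_def
proof (intro conjI ballI allI)
  show "smooth (local_rep ch (branched_data c))" if "ch \<in> P1_charts" for ch
    by (rule smooth_local_rep_branched_data[OF that])
  fix t ch z assume "ch \<in> P1_charts"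
  then consider "ch = Some" | "ch = chart_inf" by (auto simp: P1_charts_def)
  then show "0 < ddc (\<lambda>z. FS_pot z + branched_data c (ch z, t)) z"
  proof cases
    case 1
    have d: "deriv (\<lambda>z::complex. 1\<^sup>2) z = 0" "deriv (\<lambda>z. 1 * z / c) z = 1 / c"
      using assms by (auto intro!: DERIV_imp_deriv derivative_eq_intros simp: power2_eq_square)
    show ?thesis
      unfolding 1 FS_pot_branched_data_Some pot_def
    proof (rule ddc_ln_sum_squares_pos)
      show "0 < (cmod (1\<^sup>2))\<^sup>2 + (cmod (1 * z / complex_of_real c))\<^sup>2 + (cmod (z\<^sup>2 - (complex_of_real c)\<^sup>2 * t\<^sup>2 * 1\<^sup>2))\<^sup>2" for z
        using pot_pos[of 1 z c t] by (simp add: pot_def)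
    qed (use assms d in \<open>auto intro!: holomorphic_intros\<close>)
  next
    case 2
    have d: "deriv (\<lambda>z::complex. z\<^sup>2) z = 2 * z" "deriv (\<lambda>z. z * 1 / c) z = 1 / c"
      "deriv (\<lambda>z. 1\<^sup>2 - (complex_of_real c)\<^sup>2 * t\<^sup>2 * z\<^sup>2) z = - (c\<^sup>2 * t\<^sup>2 * (2 * z))"
      using assms by (auto intro!: DERIV_imp_deriv derivative_eq_intros simp: power2_eq_square)
    show ?thesis
      unfolding 2 FS_pot_branched_data_inf pot_def
    proof (rule ddc_ln_sum_squares_pos)
      show "0 < (cmod (z\<^sup>2))\<^sup>2 + (cmod (z * 1 / complex_of_real c))\<^sup>2 + (cmod (1\<^sup>2 - (complex_of_real c)\<^sup>2 * t\<^sup>2 * z\<^sup>2))\<^sup>2" for z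
        using pot_pos[of z 1 c t] by (simp add: pot_def)
      show "z\<^sup>2 * deriv (\<lambda>z. z * 1 / complex_of_real c) z \<noteq> z * 1 / complex_of_real c * deriv (\<lambda>z. z\<^sup>2) z \<or>
        z\<^sup>2 * deriv (\<lambda>z. 1\<^sup>2 - (complex_of_real c)\<^sup>2 * t\<^sup>2 * z\<^sup>2) z \<noteq> (1\<^sup>2 - (complex_of_real c)\<^sup>2 * t\<^sup>2 * z\<^sup>2) * deriv (\<lambda>z. z\<^sup>2) z \<or>
        z * 1 / complex_of_real c * deriv (\<lambda>z. 1\<^sup>2 - (complex_of_real c)\<^sup>2 * t\<^sup>2 * z\<^sup>2) z \<noteq> (1\<^sup>2 - (complex_of_real c)\<^sup>2 * t\<^sup>2 * z\<^sup>2) * deriv (\<lambda>z. z * 1 / complex_of_real c) z"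
        unfolding d using assms by (cases "z = 0") (auto simp: power2_eq_square algebra_simps)
    qed (use assms in \<open>auto intro!: holomorphic_intros\<close>)
  qed
qed

section \<open>The C^2 norm dominates the uniform norm\<close>

lemma smooth_bounded_on_compact:
  "smooth (f :: 'a::euclidean_space \<Rightarrow> real) \<Longrightarrow> compact K \<Longrightarrow> \<exists>B. \<forall>x\<in>K. \<bar>f x\<bar> \<le> B"
  using compact_imp_bounded[OF compact_continuous_image[OF smooth_imp_continuous]]
  unfolding bounded_iff by (metis imageI real_norm_def)

text \<open>This is the only use made of closeness in \<open>C2_norm\<close>. A real
  \<open>Sup\<close> is known to bound its members only when the set is bounded above, so most of
  the proof bounds all derivatives over the compact patches.\<close>

lemma abs_le_C2_norm:
  assumes f: "\<And>ch. ch \<in> P1_charts \<Longrightarrow> smooth (local_rep ch f)" and t: "t \<in> sphere 0 1"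
  shows "\<bar>f (p, t)\<bar> \<le> C2_norm f"
proof -
  obtain ch z where ch: "ch \<in> P1_charts" "p = ch z" "z \<in> cball 0 1"
  proof (cases p)
    case None
    then show thesis using that[of chart_inf 0] by (simp add: P1_charts_def chart_inf_def)
  next
    case (Some y)
    show thesis
    proof (cases "cmod y \<le> 1")
      case True
      then show thesis using that[of Some y] Some by (simp add: P1_charts_def)
    next
      case False
      then have "y \<noteq> 0" by auto
      then show thesis
        using that[of chart_inf "1 / y"] Some False
        by (simp add: P1_charts_def chart_inf_def norm_divide)
    qed
  qed
  obtain s where s: "s \<in> {0..2 * pi}" "t = cis s"
    using t Arg2pi_ge_0[of t] Arg2pi_lt_2pi[of t] Arg2pi_eq[of t]
    by (intro that[of "Arg2pi t"]) (auto simp: cis_conv_exp)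
  let ?K = "cball (0::complex) 1 \<times> {0..2 * pi}"
  let ?X = "\<Union>c\<in>P1_charts. \<Union>x\<in>?K.
       {\<bar>local_rep c f x\<bar>}
       \<union> {\<bar>dir_deriv a (local_rep c f) x\<bar> | a. a \<in> Basis}
       \<union> {\<bar>dir_deriv a (dir_deriv b (local_rep c f)) x\<bar> | a b. a \<in> Basis \<and> b \<in> Basis}"
  have K: "compact ?K" by (intro compact_Times) auto
  \<comment> \<open>One statement for the orders 0, 1 and 2: indices on which F does not depend are
    dummies, filled with \<open>a0\<close> below.\<close>
  have ex: "\<exists>B. \<forall>c\<in>P1_charts. \<forall>a\<in>Basis. \<forall>b\<in>Basis. \<forall>x\<in>?K. \<bar>F c a b x\<bar> \<le> B"
    if F: "\<And>c a b. c \<in> P1_charts \<Longrightarrow> a \<in> Basis \<Longrightarrow> b \<in> Basis \<Longrightarrow> smooth (F c a b)"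
    for F :: "(complex \<Rightarrow> complex option) \<Rightarrow> complex \<times> real \<Rightarrow> complex \<times> real \<Rightarrow> complex \<times> real \<Rightarrow> real"
  proof -
    have "\<forall>q\<in>P1_charts \<times> Basis \<times> Basis. \<exists>B. \<forall>x\<in>?K. \<bar>F (fst q) (fst (snd q)) (snd (snd q)) x\<bar> \<le> B"
      using smooth_bounded_on_compact[OF F K] by auto
    then obtain B where B: "\<forall>q\<in>P1_charts \<times> Basis \<times> Basis. \<forall>x\<in>?K. \<bar>F (fst q) (fst (snd q)) (snd (snd q)) x\<bar> \<le> B q"
      by metis
    have fin: "finite (P1_charts \<times> (Basis :: (complex \<times> real) set) \<times> (Basis :: (complex \<times> real) set))"
      by (simp add: P1_charts_def)
    show ?thesis
    proof (intro exI ballI)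
      fix c a b x assume *: "c \<in> P1_charts" "(a :: complex \<times> real) \<in> Basis" "(b :: complex \<times> real) \<in> Basis" "x \<in> ?K"
      have "\<bar>F c a b x\<bar> \<le> B (c, a, b)" using B * by force
      also have "\<dots> \<le> Max (B ` (P1_charts \<times> Basis \<times> Basis))"
        using fin * by (intro Max_ge) auto
      finally show "\<bar>F c a b x\<bar> \<le> Max (B ` (P1_charts \<times> Basis \<times> Basis))" .
    qed
  qed
  obtain B0 where B0: "\<forall>c\<in>P1_charts. \<forall>a\<in>(Basis :: (complex \<times> real) set). \<forall>b\<in>(Basis :: (complex \<times> real) set). \<forall>x\<in>?K. \<bar>local_rep c f x\<bar> \<le> B0"
    using ex[of "\<lambda>c a b. local_rep c f"] f by blast
  obtain B1 where B1: "\<forall>c\<in>P1_charts. \<forall>a\<in>Basis. \<forall>b\<in>(Basis :: (complex \<times> real) set). \<forall>x\<in>?K. \<bar>dir_deriv a (local_rep c f) x\<bar> \<le> B1"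
    using ex[of "\<lambda>c a b. dir_deriv a (local_rep c f)"] f smooth_dir_deriv by blast
  obtain B2 where B2: "\<forall>c\<in>P1_charts. \<forall>a\<in>Basis. \<forall>b\<in>Basis. \<forall>x\<in>?K. \<bar>dir_deriv a (dir_deriv b (local_rep c f)) x\<bar> \<le> B2"
    using ex[of "\<lambda>c a b. dir_deriv a (dir_deriv b (local_rep c f))"] f smooth_dir_deriv by blast
  obtain a0 :: "complex \<times> real" where a0: "a0 \<in> Basis" using nonempty_Basis by blast
  have "bdd_above ?X"
  proof (rule bdd_aboveI)
    fix v assume "v \<in> ?X"
    then obtain ch' x where cx: "ch' \<in> P1_charts" "x \<in> ?K" and
      v: "v \<in> {\<bar>local_rep ch' f x\<bar>} \<union> {\<bar>dir_deriv a (local_rep ch' f) x\<bar> | a. a \<in> Basis}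
       \<union> {\<bar>dir_deriv a (dir_deriv b (local_rep ch' f)) x\<bar> | a b. a \<in> Basis \<and> b \<in> Basis}"
      by (elim UN_E)
    from v consider "v = \<bar>local_rep ch' f x\<bar>"
      | a where "a \<in> Basis" "v = \<bar>dir_deriv a (local_rep ch' f) x\<bar>"
      | a b where "a \<in> Basis" "b \<in> Basis" "v = \<bar>dir_deriv a (dir_deriv b (local_rep ch' f)) x\<bar>"
      by blast
    then show "v \<le> max B0 (max B1 B2)"
    proof cases
      case 1
      then show ?thesis using B0[rule_format, OF cx(1) a0 a0 cx(2)] by linarith
    next
      case (2 a)
      then show ?thesis using B1[rule_format, OF cx(1) 2(1) a0 cx(2)] by linarith
    next
      case (3 a b)
      then show ?thesis using B2[rule_format, OF cx(1) 3(1,2) cx(2)] by linarith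
    qed
  qed
  moreover have "\<bar>f (p, t)\<bar> \<in> ?X"
    using ch s by (intro UN_I[of ch] UN_I[of "(z, s)"]) (auto simp: local_rep_def)
  ultimately show ?thesis
    unfolding C2_norm_def by (rule cSup_upper[rotated])
qed

section \<open>Semicontinuity on the projective line\<close>

lemma topspace_P1 [simp]: "topspace P1 = UNIV"
  by (auto simp: P1_def UNIV_option_conv)

lemma compact_space_P1: "compact_space P1"
  by (simp add: P1_def)

lemma openin_P1_Some: "open U \<Longrightarrow> openin P1 (Some ` U)"
  by (simp add: P1_def)

lemma openin_P1_vimage_Some: "openin P1 U \<Longrightarrow> open (Some -` U)"
  using openin_continuous_map_preimage[OF continuous_map_Some[of euclidean]]
  by (simp add: P1_def vimage_def)

lemma openin_P1_chart_inf_ball: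
  assumes "r > 0" shows "openin P1 (chart_inf ` ball 0 r)"
proof -
  have "chart_inf ` ball 0 r = insert None (Some ` (topspace euclidean - cball (0::complex) (1 / r)))"
  proof (intro equalityI subsetI)
    fix p assume "p \<in> chart_inf ` ball 0 r"
    then obtain w where w: "p = chart_inf w" "cmod w < r" by auto
    then show "p \<in> insert None (Some ` (topspace euclidean - cball (0::complex) (1 / r)))"
      using assms by (auto simp: chart_inf_def norm_divide field_simps not_le)
  next
    fix p assume p: "p \<in> insert None (Some ` (topspace euclidean - cball (0::complex) (1 / r)))"
    show "p \<in> chart_inf ` ball 0 r"
    proof (cases p)
      case None
      then show ?thesis using assms by (intro image_eqI[of _ _ 0]) (auto simp: chart_inf_def)
    next
      case (Some y)
      then have y: "1 / r < cmod y" using p by auto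
      then have "y \<noteq> 0" using assms by (metis divide_pos_pos norm_zero not_less_iff_gr_or_eq zero_less_one)
      with y assms have "1 / y \<in> ball 0 r" by (simp add: norm_divide field_simps)
      then show ?thesis using Some \<open>y \<noteq> 0\<close> by (intro image_eqI[of _ _ "1/y"]) (auto simp: chart_inf_def)
    qed
  qed
  then show ?thesis
    unfolding P1_def openin_Alexandroff_compactification
    by (intro disjI2 exI[of _ "cball 0 (1 / r)"]) auto
qed

text \<open>Openness may be tested in the two charts. \<open>chart_inf\<close> is used only at its
  centre, where images of small balls supply enough neighbourhoods; finite points are handled by
  \<open>Some\<close>.\<close>

lemma openin_prod_P1I:
  fixes T :: "complex set"
  assumes S: "\<And>p t. (p, t) \<in> S \<Longrightarrow> t \<in> T"
    and charts: "\<And>ch. ch \<in> P1_charts \<Longrightarrow> \<exists>W. open W \<and> {(z, t). t \<in> T \<and> (ch z, t) \<in> S} = W \<inter> (UNIV \<times> T)"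
  shows "openin (prod_topology P1 (top_of_set T)) S"
  unfolding openin_prod_topology_alt
proof (intro allI impI)
  fix p t assume pt: "(p, t) \<in> S"
  obtain ch z0 where ch: "ch \<in> P1_charts" "p = ch z0" "\<And>A z. open A \<Longrightarrow> z0 \<in> A \<Longrightarrow> \<exists>A'\<subseteq>A. z0 \<in> A' \<and> openin P1 (ch ` A')"
  proof (cases p)
    case None
    show thesis
    proof (rule that[of chart_inf 0])
      fix A :: "complex set" assume "open A" "0 \<in> A"
      then obtain r where "r > 0" "ball 0 r \<subseteq> A" by (auto simp: open_contains_ball)
      then show "\<exists>A'\<subseteq>A. 0 \<in> A' \<and> openin P1 (chart_inf ` A')"
        using openin_P1_chart_inf_ball by (intro exI[of _ "ball 0 r"]) auto
    qed (auto simp: None chart_inf_def P1_charts_def)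
  next
    case (Some y)
    show thesis
      by (rule that[of Some y]) (use Some openin_P1_Some in \<open>auto simp: P1_charts_def\<close>)
  qed
  obtain W where W: "open W" "{(z, t). t \<in> T \<and> (ch z, t) \<in> S} = W \<inter> (UNIV \<times> T)"
    using charts[OF ch(1)] by blast
  have "(z0, t) \<in> W" using W(2) pt S[OF pt] ch(2) by blast
  then obtain A B where AB: "open A" "open B" "z0 \<in> A" "t \<in> B" "A \<times> B \<subseteq> W"
    using W(1) by (auto elim!: open_prod_elim)
  obtain A' where A': "A' \<subseteq> A" "z0 \<in> A'" "openin P1 (ch ` A')"
    using ch(3)[OF AB(1,3)] by blast
  show "\<exists>U V. openin P1 U \<and> openin (top_of_set T) V \<and> p \<in> U \<and> t \<in> V \<and> U \<times> V \<subseteq> S"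
  proof (intro exI conjI)
    show "openin P1 (ch ` A')" by fact
    show "openin (top_of_set T) (T \<inter> B)" using AB(2) by (simp add: openin_open_Int)
    show "p \<in> ch ` A'" "t \<in> T \<inter> B" using ch A' S[OF pt] AB by auto
    show "ch ` A' \<times> (T \<inter> B) \<subseteq> S"
      using W(2) AB(5) A'(1) by blast
  qed
qed

text \<open>Without a maximum, each m has a level \<open>r m\<close> strictly between
  \<open>f m\<close> and a larger value \<open>f (g m)\<close>. The open sets f < \<open>r m\<close>
  cover; for the largest level in a finite subcover, the point \<open>g m\<close> lies in none of
  the chosen sets.\<close>

lemma usc_on_attains_sup:
  assumes X: "compact_space X" "topspace X \<noteq> {}" and f: "usc_on X f"
  shows "\<exists>m\<in>topspace X. \<forall>x\<in>topspace X. f x \<le> f m"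
proof (rule ccontr)
  assume "\<not> ?thesis"
  then have "\<forall>m\<in>topspace X. \<exists>x\<in>topspace X. \<exists>r. f m < ereal r \<and> ereal r < f x"
    by (meson ereal_dense2 not_le_imp_less)
  then obtain g r where g: "\<And>m. m \<in> topspace X \<Longrightarrow> g m \<in> topspace X \<and> f m < ereal (r m) \<and> ereal (r m) < f (g m)"
    by metis
  let ?U = "(\<lambda>m. {x \<in> topspace X. f x < ereal (r m)}) ` topspace X"
  have "\<forall>U\<in>?U. openin X U" using f by (auto simp: usc_on_def)
  moreover have "topspace X \<subseteq> \<Union> ?U" using g by blast
  ultimately obtain F where F: "finite F" "F \<subseteq> ?U" "topspace X \<subseteq> \<Union> F"
    using X(1) unfolding compact_space_alt by meson
  then obtain M where M: "finite M" "M \<subseteq> topspace X" "F = (\<lambda>m. {x \<in> topspace X. f x < ereal (r m)}) ` M"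
    by (meson finite_subset_image)
  have "M \<noteq> {}" using F(3) M(3) X(2) by auto
  then have "Max (r ` M) \<in> r ` M" using M(1) by simp
  then obtain m where "m \<in> M" "r m = Max (r ` M)" by auto
  then have m: "m \<in> M" "\<And>k. k \<in> M \<Longrightarrow> r k \<le> r m" using M(1) by auto
  have gm: "g m \<in> topspace X" "ereal (r m) < f (g m)" using g m M by auto
  then obtain k where k: "k \<in> M" "f (g m) < ereal (r k)" using F(3) M(3) by auto
  then show False using m(2)[OF k(1)] gm(2) by (cases "f (g m)") auto
qed

lemma usc_on_bounded_above:
  assumes X: "compact_space X" and f: "usc_on X f"
  obtains C :: real where "\<And>x. x \<in> topspace X \<Longrightarrow> f x \<le> ereal C"
proof (cases "topspace X = {}")
  case False
  obtain m where m: "m \<in> topspace X" "\<forall>x\<in>topspace X. f x \<le> f m"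
    using usc_on_attains_sup[OF X False f] by blast
  have "f m < \<infinity>" using f m by (auto simp: usc_on_def)
  then obtain C where "f m < ereal C"
    using less_PInf_Ex_of_nat by auto
  then show thesis using m(2) that[of C] by (meson less_imp_le order_trans)
qed (use that in auto)

lemma usc_on_add_continuous:
  assumes f: "usc_on X f" and q: "continuous_map X euclideanreal q"
  shows "usc_on X (\<lambda>x. f x + ereal (q x))"
  unfolding usc_on_def
proof (intro conjI ballI allI)
  show "f x + ereal (q x) < \<infinity>" if "x \<in> topspace X" for x
    using f that by (auto simp: usc_on_def)
  fix r :: real
  have "{x \<in> topspace X. f x + ereal (q x) < ereal r} =
      (\<Union>s. {x \<in> topspace X. f x < ereal s} \<inter> {x \<in> topspace X. q x < r - s})"
  proof (intro equalityI subsetI)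
    fix x assume x: "x \<in> {x \<in> topspace X. f x + ereal (q x) < ereal r}"
    then have "f x < ereal (r - q x)" by (cases "f x") auto
    then obtain s where "f x < ereal s" "ereal s < ereal (r - q x)" using ereal_dense2 by blast
    then show "x \<in> (\<Union>s. {x \<in> topspace X. f x < ereal s} \<inter> {x \<in> topspace X. q x < r - s})"
      using x by (intro UN_I[of s]) auto
  next
    fix x assume "x \<in> (\<Union>s. {x \<in> topspace X. f x < ereal s} \<inter> {x \<in> topspace X. q x < r - s})"
    then obtain s where "x \<in> topspace X" "f x < ereal s" "q x < r - s" by auto
    then show "x \<in> {x \<in> topspace X. f x + ereal (q x) < ereal r}"
      by (cases "f x") auto
  qed
  moreover have "openin X {x \<in> topspace X. q x < r - s}" for s
    using openin_continuous_map_preimage[OF q, of "{..<r - s}"] by simp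
  moreover have "openin X {x \<in> topspace X. f x < ereal s}" for s
    using f by (simp add: usc_on_def)
  ultimately show "openin X {x \<in> topspace X. f x + ereal (q x) < ereal r}"
    by (auto intro!: openin_clauses(3) openin_Int)
qed

lemma usc_on_Some_chart:
  assumes f: "usc_on (prod_topology P1 (top_of_set T)) f" and K: "K \<subseteq> UNIV \<times> T"
  shows "usc_on (top_of_set K) (\<lambda>x. f (Some (fst x), snd x))"
  unfolding usc_on_def
proof (intro conjI ballI allI)
  show "f (Some (fst x), snd x) < \<infinity>" if "x \<in> topspace (top_of_set K)" for x
    using f that K unfolding usc_on_def by auto
  fix r :: real
  let ?S = "{x \<in> UNIV \<times> T. f x < ereal r}"
  have S: "openin (prod_topology P1 (top_of_set T)) ?S"
    using f by (simp add: usc_on_def)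
  have nbhd: "\<exists>W. open W \<and> x \<in> W \<and> W \<inter> K \<subseteq> {x \<in> K. f (Some (fst x), snd x) < ereal r}"
    if x: "x \<in> K" "f (Some (fst x), snd x) < ereal r" for x
  proof -
    have "(Some (fst x), snd x) \<in> ?S" using x K by auto
    then obtain U V where UV: "openin P1 U" "openin (top_of_set T) V" "Some (fst x) \<in> U" "snd x \<in> V" "U \<times> V \<subseteq> ?S"
      using S unfolding openin_prod_topology_alt by meson
    obtain V' where V': "open V'" "V = T \<inter> V'" using UV(2) by (auto simp: openin_open)
    show ?thesis
    proof (intro exI[of _ "(Some -` U) \<times> V'"] conjI)
      show "open ((Some -` U) \<times> V')" by (intro open_Times openin_P1_vimage_Some UV V')
      show "x \<in> (Some -` U) \<times> V'" using UV V' by (cases x) auto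
      show "(Some -` U) \<times> V' \<inter> K \<subseteq> {x \<in> K. f (Some (fst x), snd x) < ereal r}"
        using UV(5) V' K by fastforce
    qed
  qed
  show "openin (top_of_set K) {x \<in> topspace (top_of_set K). f (Some (fst x), snd x) < ereal r}"
  proof (subst openin_subopen, intro ballI)
    fix x assume "x \<in> {x \<in> topspace (top_of_set K). f (Some (fst x), snd x) < ereal r}"
    then have x: "x \<in> K" "f (Some (fst x), snd x) < ereal r" by auto
    then obtain W where W: "open W" "x \<in> W" "W \<inter> K \<subseteq> {x \<in> K. f (Some (fst x), snd x) < ereal r}"
      using nbhd[OF x] by blast
    then show "\<exists>T. openin (top_of_set K) T \<and> x \<in> T \<and> T \<subseteq> {x \<in> topspace (top_of_set K). f (Some (fst x), snd x) < ereal r}"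
      using x by (intro exI[of _ "K \<inter> W"]) (auto simp: openin_open_Int)
  qed
qed

section \<open>An explicit subsolution\<close>

lemma continuous_on_ln_pot:
  assumes "continuous_on A u" "continuous_on A v" "continuous_on A t" "\<And>x. x \<in> A \<Longrightarrow> u x \<noteq> 0 \<or> v x \<noteq> 0"
  shows "continuous_on A (\<lambda>x. ln (pot c (u x) (v x) (t x)))"
proof (rule continuous_on_ln)
  show "continuous_on A (\<lambda>x. pot c (u x) (v x) (t x))"
    unfolding pot_def divide_inverse by (intro continuous_intros assms)
  show "\<forall>x\<in>A. pot c (u x) (v x) (t x) \<noteq> 0"
    using pot_pos assms(4) by (metis less_irrefl)
qed

lemma psh_on_real:
  assumes h: "continuous_on UNIV h"
    and mean: "\<And>a1 a2 b1 b2. h (a1, a2) \<le> integral {0..2 * pi} (\<lambda>\<theta>. h (a1 + cis \<theta> * b1, a2 + cis \<theta> * b2)) / (2 * pi)"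
  shows "psh_on U (\<lambda>x. ereal (h x))"
  unfolding psh_on_def
proof (intro conjI allI impI)
  have "openin (top_of_set U) (U \<inter> {x. h x < r})" for r
    by (intro openin_open_Int open_Collect_less h continuous_intros)
  then show "usc_on (top_of_set U) (\<lambda>x. ereal (h x))"
    by (simp add: usc_on_def Int_def)
  fix a1 a2 b1 b2
  have "continuous_on UNIV (\<lambda>\<theta>. h (a1 + cis \<theta> * b1, a2 + cis \<theta> * b2))"
    by (rule continuous_on_compose2[OF h]) (auto intro!: continuous_intros)
  then show "ereal (h (a1, a2)) \<le> ereal_integral (uniform_measure lborel {0..2 * pi}) (\<lambda>\<theta>. ereal (h (a1 + cis \<theta> * b1, a2 + cis \<theta> * b2)))"
    using mean[of a1 a2 b1 b2] by (simp add: ereal_integral_continuous)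
qed

text \<open>Along a complex line the three components of \<open>pot\<close> are polynomials in the
  parameter of the line, in either chart, so the mean inequality for the logarithm of a sum of
  squares applies.\<close>

lemma branched_data_subsolution:
  assumes le: "\<And>p t. t \<in> sphere 0 1 \<Longrightarrow> branched_data c (p, t) - d \<le> \<phi> (p, t)"
  shows "(\<lambda>x. ereal (branched_data c x - d)) \<in> HMAE_subsolutions \<phi>"
proof -
  define hS where "hS = (\<lambda>(z, t). ln (pot c 1 z t) / 2 - d)"
  define hI where "hI = (\<lambda>(z, t). ln (pot c z 1 t) / 2 - d)"
  have cont: "continuous_on UNIV hS" "continuous_on UNIV hI"
    unfolding hS_def hI_def case_prod_unfold by (intro continuous_intros continuous_on_ln_pot; simp)+
  have mean: "h (a1, a2) \<le> integral {0..2 * pi} (\<lambda>\<theta>. h (a1 + cis \<theta> * b1, a2 + cis \<theta> * b2)) / (2 * pi)"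
    if "h = hS \<or> h = hI" for h :: "complex \<times> complex \<Rightarrow> real" and a1 a2 b1 b2
  proof -
    \<comment> \<open>Homogeneous coordinates of the moving point: (1, z) in the finite chart and
      (z, 1) in the chart at infinity.\<close>
    define u where "u = (if h = hS then (\<lambda>z. 1) else (\<lambda>z. a1 + z * b1))"
    define v where "v = (if h = hS then (\<lambda>z. a1 + z * b1) else (\<lambda>z. 1))"
    have hol: "u holomorphic_on UNIV" "v holomorphic_on UNIV"
      by (auto simp: u_def v_def intro!: holomorphic_intros)
    have nz: "u z \<noteq> 0 \<or> v z \<noteq> 0" for z by (simp add: u_def v_def)
    let ?S = "\<lambda>z. pot c (u z) (v z) (a2 + z * b2)"
    have h: "h (a1 + z * b1, a2 + z * b2) = ln (?S z) / 2 - d" for z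
      using that by (cases "h = hS") (auto simp: hS_def hI_def u_def v_def)
    have "ln (?S 0) / 2 \<le> integral {0..2 * pi} (\<lambda>\<theta>. ln (?S (cis \<theta>)) / 2) / (2 * pi)"
      unfolding pot_def
    proof (rule ln_sum_squares_le_mean)
      show "(\<lambda>z. u z * v z / complex_of_real c) holomorphic_on UNIV"
        unfolding divide_inverse by (intro holomorphic_intros hol)
      show "0 < (cmod ((u z)\<^sup>2))\<^sup>2 + (cmod (u z * v z / complex_of_real c))\<^sup>2 + (cmod ((v z)\<^sup>2 - (complex_of_real c)\<^sup>2 * (a2 + z * b2)\<^sup>2 * (u z)\<^sup>2))\<^sup>2" for z
        using pot_pos[OF nz[of z]] by (simp add: pot_def)
    qed (intro holomorphic_intros hol)+
    moreover have "integral {0..2 * pi} (\<lambda>\<theta>. ln (?S (cis \<theta>)) / 2 - d) = integral {0..2 * pi} (\<lambda>\<theta>. ln (?S (cis \<theta>)) / 2) - 2 * pi * d"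
    proof (subst Henstock_Kurzweil_Integration.integral_diff)
      have cc: "continuous_on A (\<lambda>\<theta>. f (cis \<theta>))" if "f holomorphic_on UNIV" for A f
        by (rule continuous_on_compose2[OF holomorphic_on_imp_continuous_on[OF that]]) (auto intro: continuous_intros)
      have "continuous_on {0..2 * pi} (\<lambda>\<theta>. ln (?S (cis \<theta>)))"
        by (intro continuous_on_ln_pot cc hol nz holomorphic_intros)
      then show "(\<lambda>\<theta>. ln (?S (cis \<theta>)) / 2) integrable_on {0..2 * pi}"
        by (intro integrable_continuous_real continuous_on_divide) auto
    qed auto
    ultimately show ?thesis
      using h[of 0] by (simp add: h diff_divide_distrib)
  qed
  have chart: "ereal (FS_pot z) + ereal (branched_data c (ch z, t) - d) = ereal ((if ch = Some then hS else hI) (z, t))"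
    if "ch \<in> P1_charts" for ch z t
    using that FS_pot_branched_data_Some[of z c t] FS_pot_branched_data_inf[of z c t]
    by (auto simp: P1_charts_def hS_def hI_def)
  have "FS_psh (\<lambda>x. ereal (branched_data c x - d))"
    unfolding FS_psh_def
  proof
    fix ch assume "ch \<in> P1_charts"
    from chart[OF this] have "(\<lambda>(z, t). ereal (FS_pot z) + ereal (branched_data c (ch z, t) - d)) = (\<lambda>x. ereal ((if ch = Some then hS else hI) x))"
      by (auto simp: fun_eq_iff)
    then show "psh_on (UNIV \<times> ball 0 1) (\<lambda>(z, t). ereal (FS_pot z) + ereal (branched_data c (ch z, t) - d))"
      using mean cont by (auto intro!: psh_on_real)
  qed
  moreover have "usc_on (prod_topology P1 (top_of_set (cball 0 1))) (\<lambda>x. ereal (branched_data c x - d))"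
    unfolding usc_on_def
  proof (intro conjI ballI allI)
    fix r :: real
    show "openin (prod_topology P1 (top_of_set (cball 0 1)))
        {x \<in> topspace (prod_topology P1 (top_of_set (cball 0 1))). ereal (branched_data c x - d) < ereal r}"
    proof (rule openin_prod_P1I)
      fix ch assume ch: "ch \<in> P1_charts"
      define h where "h = (if ch = Some then hS else hI)"
      have h: "branched_data c (ch z, t) - d = h (z, t) - FS_pot z" for z t
        using chart[OF ch, of z t] by (simp add: h_def)
      have "continuous_on UNIV (\<lambda>x. h x - FS_pot (fst x))"
        unfolding FS_pot_def h_def using cont 
        by (auto intro!: continuous_intros simp: add_nonneg_eq_0_iff)
      then have "open {x. h x - FS_pot (fst x) < r}"
        by (rule open_Collect_less[OF _ continuous_on_const])
      moreover have "{(z, t). t \<in> cball 0 1 \<and> (ch z, t) \<in> {x \<in> topspace (prod_topology P1 (top_of_set (cball 0 1))). ereal (branched_data c x - d) < ereal r}}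
          = {x. h x - FS_pot (fst x) < r} \<inter> (UNIV \<times> cball 0 1)"
        using h by auto
      ultimately show "\<exists>W. open W \<and> {(z, t). t \<in> cball 0 1 \<and> (ch z, t) \<in> {x \<in> topspace (prod_topology P1 (top_of_set (cball 0 1))). ereal (branched_data c x - d) < ereal r}} = W \<inter> (UNIV \<times> cball 0 1)"
        by blast
    qed auto
  qed auto
  ultimately show ?thesis
    using le by (simp add: HMAE_subsolutions_def)
qed

section \<open>An upper bound for all subsolutions\<close>

text \<open>The cross term is a pure oscillation with mean 0 over a full period. Frequency 1 will
  serve for the coordinates along a line and frequency 2 for Q along a leaf direction.\<close>

lemma mean_cmod_power2:
  assumes "n > 0"
  shows "((\<lambda>\<theta>. (cmod (A + B * cis (real n * \<theta>)))\<^sup>2) has_integral 2 * pi * ((cmod A)\<^sup>2 + (cmod B)\<^sup>2)) {0..2 * pi}"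
proof -
  define F where "F \<theta> = ((cmod A)\<^sup>2 + (cmod B)\<^sup>2) * \<theta> + 2 * Re (cnj A * B * (- \<i>) * cis (real n * \<theta>)) / n" for \<theta>
  have "((\<lambda>\<theta>. (cmod (A + B * cis (real n * \<theta>)))\<^sup>2) has_integral F (2 * pi) - F 0) {0..2 * pi}"
  proof (rule fundamental_theorem_of_calculus)
    fix x :: real
    have "(cmod (A + B * cis (real n * x)))\<^sup>2 = (cmod A)\<^sup>2 + (cmod B)\<^sup>2 + 2 * Re (cnj A * B * cis (real n * x))"
    proof -
      have "(Re A + (Re B * C - Im B * S))\<^sup>2 + (Im A + (Re B * S + Im B * C))\<^sup>2
         = (Re A)\<^sup>2 + (Im A)\<^sup>2 + ((Re B)\<^sup>2 + (Im B)\<^sup>2) * (C\<^sup>2 + S\<^sup>2) + 2 * ((Re A * Re B + Im A * Im B) * C - (Re A * Im B - Im A * Re B) * S)" for C S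
        by (simp add: power2_eq_square algebra_simps)
      from this[of "cos (real n * x)" "sin (real n * x)"] show ?thesis
        unfolding cmod_power2 by simp
    qed
    moreover have "(F has_real_derivative (cmod A)\<^sup>2 + (cmod B)\<^sup>2 + 2 * Re (cnj A * B * cis (real n * x))) (at x)"
      unfolding F_def using assms
      by (auto intro!: derivative_eq_intros simp: field_simps)
    ultimately show "(F has_vector_derivative (cmod (A + B * cis (real n * x)))\<^sup>2) (at x within {0..2 * pi})"
      by (simp add: has_real_derivative_iff_has_vector_derivative has_vector_derivative_at_within)
  qed auto
  moreover have "F (2 * pi) - F 0 = 2 * pi * ((cmod A)\<^sup>2 + (cmod B)\<^sup>2)"
  proof -
    have "cis (real n * (2 * pi)) = 1"
      using cis_multiple_2pi[of "real n"] by (simp add: mult.commute mult.left_commute)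
    then show ?thesis by (simp add: F_def)
  qed
  ultimately show ?thesis by simp
qed

text \<open>In the direction of a leaf of \<open>y\<^sup>2 - c\<^sup>2 t\<^sup>2 = const\<close> the function \<open>\<bar>y\<^sup>2 - c\<^sup>2 t\<^sup>2\<bar>\<^sup>2\<close> has vanishing
  Laplacian, so that after a small perturbation its difference with a subsolution cannot have an
  interior maximum.\<close>

lemma subsolution_upper_bound:
  assumes c: "c \<ge> 1" and v: "v \<in> HMAE_subsolutions \<phi>"
    and le: "\<And>p t. t \<in> sphere 0 1 \<Longrightarrow> \<phi> (p, t) \<le> branched_data c (p, t) + 1"
    and t1: "cmod t1 \<le> 1"
  shows "ereal (FS_pot y1) + v (Some y1, t1) \<le> ereal (4 + (cmod (y1\<^sup>2 - (complex_of_real c)\<^sup>2 * t1\<^sup>2))\<^sup>2)"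
proof -
  define Q where "Q y t = y\<^sup>2 - (complex_of_real c)\<^sup>2 * t\<^sup>2" for y t
  \<comment> \<open>The weight of the strictly plurisubharmonic perturbation |t|^2 + |y|^2. On |t| =
    1, where |y|^2 <= |Q| + c^2, this choice makes its contribution at most 1 + |Q|, a bound without
    \<open>c\<close>.\<close>
  define e where "e = 1 / (1 + c\<^sup>2)"
  have c2: "c\<^sup>2 \<ge> 1" using c by (simp add: one_le_power)
  then have "1 + c\<^sup>2 > 0" by linarith
  then have e: "0 < e" "e \<le> 1" "e * (1 + c\<^sup>2) = 1"
    by (simp_all add: e_def)
  define q where "q y t = FS_pot y - (cmod (Q y t))\<^sup>2 + e * ((cmod t)\<^sup>2 + (cmod y)\<^sup>2)" for y t
  define k where "k x = v (Some (fst x), snd x) + ereal (q (fst x) (snd x))" for x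
  have usc: "usc_on (prod_topology P1 (top_of_set (cball 0 1))) v"
    and psh: "psh_on (UNIV \<times> ball 0 1) (\<lambda>(z, t). ereal (FS_pot z) + v (Some z, t))"
    and bd: "\<And>p t. t \<in> sphere 0 1 \<Longrightarrow> v (p, t) \<le> ereal (\<phi> (p, t))"
    using v by (auto simp: HMAE_subsolutions_def FS_psh_def P1_charts_def)
  have "compact_space (prod_topology P1 (top_of_set (cball (0::complex) 1)))"
    by (simp add: compact_space_prod_topology compact_space_P1 compact_space_subtopology)
  then obtain C where C: "\<And>x. x \<in> topspace (prod_topology P1 (top_of_set (cball 0 1))) \<Longrightarrow> v x \<le> ereal C"
    using usc_on_bounded_above[OF _ usc] by blast
  have C: "v (p, t) \<le> ereal C" if "cmod t \<le> 1" for p t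
    using C[of "(p, t)"] that by simp
  have FS_le: "FS_pot y \<le> (cmod y)\<^sup>2" for y
    unfolding FS_pot_def by (rule ln_add_one_self_le_self) simp
  have main: "k (y1, t1) \<le> 4"
  proof (rule ccontr)
    assume "\<not> k (y1, t1) \<le> 4"
    then have k1: "k (y1, t1) > 4" by simp
    \<comment> \<open>For |y| >= R the number s = |y|^2 - c^2 is at least 3 + 2 c^2 + |C|, so that
      |Q|^2 >= s^2 outweighs \<open>FS_pot\<close>, the perturbation and the a priori bound
      \<open>C\<close> of \<open>v\<close>. The summand |y1|^2 places (y1, t1) inside the compact
      set.\<close>
    define R where "R = sqrt (c\<^sup>2 + (3 + 2 * c\<^sup>2 + \<bar>C\<bar> + (cmod y1)\<^sup>2))"
    have R2: "R\<^sup>2 = c\<^sup>2 + (3 + 2 * c\<^sup>2 + \<bar>C\<bar> + (cmod y1)\<^sup>2)" and R0: "R \<ge> 0"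
      by (simp_all add: R_def)
    have y1: "cmod y1 < R"
    proof (rule power2_less_imp_less[OF _ R0])
      show "(cmod y1)\<^sup>2 < R\<^sup>2" unfolding R2 using c2 by linarith
    qed
    have far: "k (y, t) \<le> 4" if y: "R \<le> cmod y" and t: "cmod t \<le> 1" for y t
    proof -
      define s where "s = (cmod y)\<^sup>2 - c\<^sup>2"
      have s: "s \<ge> 3 + 2 * c\<^sup>2 + \<bar>C\<bar>"
        using power_mono[OF y R0, of 2] zero_le_power2[of "cmod y1"] unfolding R2 s_def by linarith
      then have s0: "s \<ge> 0" using c2 by linarith
      have "(cmod y)\<^sup>2 - c\<^sup>2 \<le> cmod (Q y t)"
      proof -
        have "cmod ((complex_of_real c)\<^sup>2 * t\<^sup>2) = c\<^sup>2 * (cmod t)\<^sup>2" by (simp add: norm_mult norm_power)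
        also have "\<dots> \<le> c\<^sup>2 * 1"
          using t by (intro mult_left_mono) (auto simp: power_le_one)
        finally show ?thesis
          using norm_triangle_ineq2[of "y\<^sup>2" "(complex_of_real c)\<^sup>2 * t\<^sup>2"] by (simp add: Q_def norm_power)
      qed
      then have "s\<^sup>2 \<le> (cmod (Q y t))\<^sup>2"
        by (intro power_mono s0) (simp add: s_def)
      moreover have "(3 + 2 * c\<^sup>2 + \<bar>C\<bar>) * s \<le> s\<^sup>2"
        unfolding power2_eq_square by (rule mult_right_mono[OF s[unfolded power2_eq_square] s0])
      moreover have "s * 1 \<le> s * (1 + 2 * c\<^sup>2 + \<bar>C\<bar>)"
        by (rule mult_left_mono[OF _ s0]) (use c2 in linarith)
      moreover have "e * ((cmod t)\<^sup>2 + (cmod y)\<^sup>2) \<le> 1 * (1 + (cmod y)\<^sup>2)"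
        using e t by (intro mult_mono add_mono) (auto simp: power_le_one)
      ultimately have "q y t \<le> 1 + 2 * c\<^sup>2 - s"
        using FS_le[of y] unfolding q_def s_def by (simp add: algebra_simps) 
      then have "q y t + C \<le> 4" using s by linarith
      then show ?thesis
        using C[OF t, of "Some y"] unfolding k_def
        by (cases "v (Some y, t)") auto
    qed
    let ?K = "cball (0::complex) R \<times> cball (0::complex) 1"
    have "usc_on (top_of_set ?K) k"
      unfolding k_def
    proof (rule usc_on_add_continuous)
      show "usc_on (top_of_set ?K) (\<lambda>x. v (Some (fst x), snd x))"
        by (rule usc_on_Some_chart[OF usc]) auto
      show "continuous_map (top_of_set ?K) euclideanreal (\<lambda>x. q (fst x) (snd x))"
        unfolding q_def Q_def FS_pot_def
        by (auto intro!: continuous_intros simp: add_nonneg_eq_0_iff)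
    qed
    moreover have "compact_space (top_of_set ?K)"
      by (intro compact_space_subtopology) (auto simp: compact_Times)
    moreover have K1: "(y1, t1) \<in> ?K" using y1 t1 by auto
    ultimately have "\<exists>m\<in>topspace (top_of_set ?K). \<forall>x\<in>topspace (top_of_set ?K). k x \<le> k m"
      using R0 by (intro usc_on_attains_sup) auto
    then obtain x where x: "x \<in> ?K" "\<And>x'. x' \<in> ?K \<Longrightarrow> k x' \<le> k x"
      unfolding topspace_euclidean_subtopology by blast
    obtain y t where yt: "x = (y, t)" by (cases x)
    have "k x > 4" using k1 x(2)[OF K1] by (rule less_le_trans)
    have t: "cmod t \<le> 1" using x(1) yt by auto
    have y: "cmod y < R"
      using far[OF _ t, of y] \<open>k x > 4\<close> yt by (meson not_le)
    have "v (Some y, t) \<le> ereal C" by (rule C[OF t])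
    then obtain w where w: "v (Some y, t) = ereal w"
      using \<open>k x > 4\<close> by (cases "v (Some y, t)") (auto simp: k_def yt)
    have w4: "w + q y t > 4" using \<open>k x > 4\<close> by (simp add: k_def yt w)
    have kmax: "v (Some y', t') \<le> ereal (w + q y t - q y' t')" if "cmod y' \<le> R" "cmod t' \<le> 1" for y' t'
      using x(2)[of "(y', t')"] that by (cases "v (Some y', t')") (auto simp: k_def yt w)
    show False
    proof (cases "cmod t = 1")
      case True
      define s where "s = cmod (Q y t)"
      have s: "s \<ge> 0" by (simp add: s_def)
      have yy: "(cmod y)\<^sup>2 \<le> s + c\<^sup>2"
        using norm_triangle_ineq[of "Q y t" "(complex_of_real c)\<^sup>2 * t\<^sup>2"] True
        by (simp add: Q_def s_def norm_mult norm_power)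
      have "w \<le> branched_data c (Some y, t) + 1"
        using bd[of t "Some y"] le[of t "Some y"] True w by simp
      then have "w + FS_pot y \<le> ln (pot c 1 y t) / 2 + 1"
        by (simp add: branched_data_def)
      moreover have "ln (pot c 1 y t) \<le> pot c 1 y t - 1"
        by (rule ln_le_minus_one) (simp add: pot_pos)
      moreover have "pot c 1 y t \<le> 2 + s + s\<^sup>2"
      proof -
        have "(cmod y)\<^sup>2 / c\<^sup>2 \<le> (s + c\<^sup>2) / c\<^sup>2"
          using yy by (rule divide_right_mono) simp
        also have "\<dots> = s / c\<^sup>2 + 1" using c by (simp add: add_divide_distrib)
        also have "s / c\<^sup>2 \<le> s / 1" using s c by (intro divide_left_mono) (auto simp: one_le_power)
        finally show ?thesis using c
          by (simp add: pot_def Q_def s_def norm_divide power_divide)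
      qed
      moreover have "e * ((cmod t)\<^sup>2 + (cmod y)\<^sup>2) \<le> 1 + s"
      proof -
        have "e * ((cmod t)\<^sup>2 + (cmod y)\<^sup>2) \<le> e * (1 + c\<^sup>2 + s)"
          using e yy True by (intro mult_left_mono) auto
        also have "\<dots> = e * (1 + c\<^sup>2) + e * s" by (simp add: distrib_left)
        also have "\<dots> \<le> 1 + 1 * s" using e s by (intro add_mono mult_right_mono) auto
        finally show ?thesis by simp
      qed
      \<comment> \<open>The estimates add up to \<open>w + q y t\<close> <= 5/2 + 3 s / 2 - s^2 / 2,
        and by this square the right side is at most 29/8. Hence the constant 4.\<close>
      moreover have "0 \<le> (s - 3/2)\<^sup>2" by simp
      ultimately show False
        using w4 unfolding q_def s_def[symmetric] by (simp add: power2_eq_square algebra_simps)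
    next
      case False
      then have t: "cmod t < 1" using t by simp
      \<comment> \<open>A direction in the kernel of dQ = 2 y dy - 2 c^2 t dt. At the origin dQ
        vanishes and the formula would give the zero vector, so another direction is taken there. As
        Q is quadratic, on this line it is exactly Q(y, t) + q2 z^2.\<close>
      define b1 b2 where "b1 = (if y = 0 \<and> t = 0 then 1 else (complex_of_real c)\<^sup>2 * t)" and "b2 = y"
      have b: "(cmod b1)\<^sup>2 + (cmod b2)\<^sup>2 > 0"
        using c by (auto simp: b1_def b2_def sum_power2_gt_zero_iff)
      define q2 where "q2 = b1\<^sup>2 - (complex_of_real c)\<^sup>2 * b2\<^sup>2"
      have leaf: "Q (y + z * b1) (t + z * b2) = Q y t + q2 * z\<^sup>2" for z
        by (auto simp: Q_def q2_def b1_def b2_def power2_eq_square algebra_simps)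
      \<comment> \<open>The last condition makes the gain r^4 |q2|^2 in the mean of |Q|^2 smaller
        than the loss e r^2 |b|^2 caused by the perturbation.\<close>
      obtain r where r: "r > 0" "r * cmod b1 < R - cmod y" "r * cmod b2 < 1 - cmod t"
        "r\<^sup>2 * (cmod q2)\<^sup>2 < e * ((cmod b1)\<^sup>2 + (cmod b2)\<^sup>2)"
      proof -
        have "\<forall>\<^sub>F r in at_right 0. 0 < r \<and> r * cmod b1 < R - cmod y \<and> r * cmod b2 < 1 - cmod t \<and> r\<^sup>2 * (cmod q2)\<^sup>2 < e * ((cmod b1)\<^sup>2 + (cmod b2)\<^sup>2)"
        proof (intro eventually_conj)
          have "((\<lambda>r. r * cmod b1) \<longlongrightarrow> 0 * cmod b1) (at_right 0)" "((\<lambda>r. r * cmod b2) \<longlongrightarrow> 0 * cmod b2) (at_right 0)"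
            "((\<lambda>r. r\<^sup>2 * (cmod q2)\<^sup>2) \<longlongrightarrow> 0\<^sup>2 * (cmod q2)\<^sup>2) (at_right 0)"
            by (intro tendsto_intros)+
          then show "\<forall>\<^sub>F r in at_right 0. r * cmod b1 < R - cmod y" "\<forall>\<^sub>F r in at_right 0. r * cmod b2 < 1 - cmod t"
            "\<forall>\<^sub>F r in at_right 0. r\<^sup>2 * (cmod q2)\<^sup>2 < e * ((cmod b1)\<^sup>2 + (cmod b2)\<^sup>2)"
            using y t b e by (auto intro!: order_tendstoD(2)[where y = 0] elim: order_tendstoD(2))
        qed (simp add: eventually_at_right_less)
        then show thesis using that by (metis (no_types, lifting) eventually_happens trivial_limit_at_right_real)
      qed
      have in1: "cmod (y + z * (r * b1)) \<le> R" "cmod (t + z * (r * b2)) < 1" if "cmod z \<le> 1" for z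
      proof -
        have "cmod (z * (r * b)) \<le> r * cmod b" for b :: complex
          using that r(1) by (simp add: norm_mult mult_left_le_one_le mult_right_mono)
        from this[of b1] this[of b2] show "cmod (y + z * (r * b1)) \<le> R" "cmod (t + z * (r * b2)) < 1"
          using norm_triangle_ineq[of y "z * (r * b1)"] norm_triangle_ineq[of t "z * (r * b2)"] r by linarith+
      qed
      \<comment> \<open>Maximality of \<open>k\<close> at (y, t) bounds \<open>FS_pot\<close> +
        \<open>v\<close> on the circle by this function, whose mean is explicit; the sub-mean value
        property then contradicts the choice of r.\<close>
      define B where "B \<theta> = w + q y t + (cmod (Q y t + (r\<^sup>2 * q2) * cis (2 * \<theta>)))\<^sup>2
          - e * ((cmod (t + (r * b2) * cis \<theta>))\<^sup>2 + (cmod (y + (r * b1) * cis \<theta>))\<^sup>2)" for \<theta>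
      have contB: "continuous_on UNIV B"
        unfolding B_def by (intro continuous_intros)
      have "ereal (FS_pot y) + v (Some y, t) \<le> ereal_integral (uniform_measure lborel {0..2 * pi})
          (\<lambda>\<theta>. ereal (FS_pot (y + cis \<theta> * (r * b1))) + v (Some (y + cis \<theta> * (r * b1)), t + cis \<theta> * (r * b2)))"
        using psh in1 unfolding psh_on_def by fastforce
      also have "\<dots> \<le> ereal_integral (uniform_measure lborel {0..2 * pi}) (\<lambda>\<theta>. ereal (B \<theta>))"
      proof (rule ereal_integral_mono)
        fix \<theta>
        have eq: "B \<theta> = w + q y t - q (y + cis \<theta> * (r * b1)) (t + cis \<theta> * (r * b2)) + FS_pot (y + cis \<theta> * (r * b1))"
          using leaf[of "r * cis \<theta>"]
          by (simp add: B_def q_def power_mult_distrib Complex.DeMoivre mult_ac)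
        show "ereal (FS_pot (y + cis \<theta> * (r * b1))) + v (Some (y + cis \<theta> * (r * b1)), t + cis \<theta> * (r * b2)) \<le> ereal (B \<theta>)"
          using kmax[of "y + cis \<theta> * (r * b1)" "t + cis \<theta> * (r * b2)"] in1[of "cis \<theta>"] unfolding eq
          by (cases "v (Some (y + cis \<theta> * (r * b1)), t + cis \<theta> * (r * b2))") auto
      qed
      also have "\<dots> = ereal (integral {0..2 * pi} B / (2 * pi))"
        by (rule ereal_integral_continuous[OF contB])
      also have "integral {0..2 * pi} B = 2 * pi * (w + q y t + ((cmod (Q y t))\<^sup>2 + (cmod (r\<^sup>2 * q2))\<^sup>2)
          - e * (((cmod t)\<^sup>2 + (cmod (r * b2))\<^sup>2) + ((cmod y)\<^sup>2 + (cmod (r * b1))\<^sup>2)))"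
      proof (rule integral_unique)
        have "(B has_integral ((w + q y t) * (2 * pi) + 2 * pi * ((cmod (Q y t))\<^sup>2 + (cmod (r\<^sup>2 * q2))\<^sup>2))
          - e * (2 * pi * ((cmod t)\<^sup>2 + (cmod (r * b2))\<^sup>2) + 2 * pi * ((cmod y)\<^sup>2 + (cmod (r * b1))\<^sup>2))) {0..2 * pi}"
          unfolding B_def
          by (intro has_integral_add has_integral_diff has_integral_mult_right
              mean_cmod_power2[of 2, simplified] mean_cmod_power2[of 1, simplified])
            (use has_integral_const_real[of "w + q y t" 0 "2 * pi"] in \<open>simp add: mult.commute\<close>)
        then show "(B has_integral 2 * pi * (w + q y t + ((cmod (Q y t))\<^sup>2 + (cmod (r\<^sup>2 * q2))\<^sup>2)
          - e * (((cmod t)\<^sup>2 + (cmod (r * b2))\<^sup>2) + ((cmod y)\<^sup>2 + (cmod (r * b1))\<^sup>2)))) {0..2 * pi}"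
          by (simp add: algebra_simps)
      qed
      finally have "FS_pot y + w \<le> w + q y t + ((cmod (Q y t))\<^sup>2 + (cmod (r\<^sup>2 * q2))\<^sup>2)
          - e * (((cmod t)\<^sup>2 + (cmod (r * b2))\<^sup>2) + ((cmod y)\<^sup>2 + (cmod (r * b1))\<^sup>2))"
        by (simp add: w)
      then have "e * ((cmod (r * b2))\<^sup>2 + (cmod (r * b1))\<^sup>2) \<le> (cmod (r\<^sup>2 * q2))\<^sup>2"
        by (simp add: q_def algebra_simps)
      then have "r\<^sup>2 * (e * ((cmod b1)\<^sup>2 + (cmod b2)\<^sup>2)) \<le> r\<^sup>2 * (r\<^sup>2 * (cmod q2)\<^sup>2)"
        by (simp add: norm_mult norm_power power_mult_distrib algebra_simps)
      moreover have "r\<^sup>2 * (r\<^sup>2 * (cmod q2)\<^sup>2) < r\<^sup>2 * (e * ((cmod b1)\<^sup>2 + (cmod b2)\<^sup>2))"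
        by (rule mult_strict_left_mono[OF r(4)]) (use r(1) in simp)
      ultimately show False by linarith
    qed
  qed
  have "0 \<le> e * ((cmod t1)\<^sup>2 + (cmod y1)\<^sup>2)" using e by (intro mult_nonneg_nonneg) auto
  then show ?thesis
    using main unfolding k_def q_def Q_def
    by (cases "v (Some y1, t1)") auto
qed

section \<open>Holomorphic discs\<close>

text \<open>On |z| = \<open>\<rho>\<close> the moduli of f - c z and f + c z have product at most
  s^2, so one of them is at most s. They never both are, since the difference of the two factors has
  modulus 2 c \<open>\<rho>\<close> > 2 s, and by connectedness it is the same factor f - k z
  everywhere. The other one is then at least 2 c \<open>\<rho>\<close> - s >= c
  \<open>\<rho>\<close>, which improves the bound s to s^2 / (c \<open>\<rho>\<close>) <= 1/16. The
  maximum principle carries this inside.\<close>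

lemma near_branched_curve_small:
  fixes f :: "complex \<Rightarrow> complex" and c \<rho> :: real
  assumes f: "f holomorphic_on ball 0 \<rho>" "continuous_on (cball 0 \<rho>) f" and \<rho>: "\<rho> > 0"
    and M: "\<And>z. z \<in> cball 0 \<rho> \<Longrightarrow> cmod ((f z)\<^sup>2 - (complex_of_real c)\<^sup>2 * z\<^sup>2) \<le> s\<^sup>2"
    and s: "s \<ge> 0" "c > 0" "c * \<rho> > s" "c * \<rho> \<ge> 16 * s\<^sup>2" and z: "z \<in> ball 0 \<rho>"
  shows "cmod (f z) \<le> 1 / 16 + c * cmod z"
proof -
  let ?S = "sphere (0::complex) \<rho>"
  have fac: "(cmod (f z - c * z)) * (cmod (f z + c * z)) \<le> s\<^sup>2" if "z \<in> ?S" for z :: complex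
    using M[of z] that by (simp add: norm_mult[symmetric] power2_eq_square algebra_simps)
  define E where "E k = {z \<in> ?S. cmod (f z - k * z) \<le> s}" for k :: complex
  have contS: "continuous_on ?S f" by (rule continuous_on_subset[OF f(2)]) auto
  have clE: "closedin (top_of_set ?S) (E k)" for k
  proof -
    have "closedin (top_of_set ?S) (?S \<inter> (\<lambda>z. cmod (f z - k * z)) -` {..s})"
      by (intro continuous_closedin_preimage continuous_intros contS)
    then show ?thesis by (simp add: E_def vimage_def Int_def)
  qed
  have cover: "E c \<union> E (- c) = ?S"
  proof (intro equalityI subsetI)
    fix z assume z: "z \<in> ?S"
    have "\<not> (s < cmod (f z - c * z) \<and> s < cmod (f z + c * z))"
    proof
      assume "s < cmod (f z - c * z) \<and> s < cmod (f z + c * z)"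
      then have "s * s < cmod (f z - c * z) * cmod (f z + c * z)"
        using s by (intro mult_strict_mono) auto
      then show False using fac[OF z] by (simp add: power2_eq_square)
    qed
    then show "z \<in> E c \<union> E (- c)" using z by (auto simp: E_def)
  qed (auto simp: E_def)
  have disj: "E c \<inter> E (- c) = {}"
  proof (rule ccontr)
    assume "E c \<inter> E (- c) \<noteq> {}"
    then obtain z :: complex where z: "cmod z = \<rho>" "cmod (f z - c * z) \<le> s" "cmod (f z + c * z) \<le> s"
      by (auto simp: E_def)
    have "2 * c * \<rho> = cmod ((f z + c * z) - (f z - c * z))"
      using z(1) s \<rho> by (simp add: norm_mult)
    also have "\<dots> \<le> s + s" using norm_triangle_ineq4[of "f z + c * z" "f z - c * z"] z by linarith
    finally show False using s by linarith
  qed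
  have conn: "connected ?S" by (rule connected_sphere) simp
  have "E c = {} \<or> E (- c) = {}"
  proof (rule ccontr)
    assume "\<not> ?thesis"
    then have ne: "E c \<noteq> {}" "E (- c) \<noteq> {}" by simp_all
    have "\<exists>E1 E2. closedin (top_of_set ?S) E1 \<and> closedin (top_of_set ?S) E2 \<and> E1 \<union> E2 = ?S \<and> E1 \<inter> E2 = {} \<and> E1 \<noteq> {} \<and> E2 \<noteq> {}"
      by (rule exI[of _ "E c"], rule exI[of _ "E (- c)"]) (intro conjI clE cover disj ne)
    with conn[unfolded connected_closedin_eq] show False by (rule notE)
  qed
  then obtain k where k: "k = complex_of_real c \<or> k = - complex_of_real c" "E k = ?S"
    using cover that[of "complex_of_real c"] that[of "- complex_of_real c"] by auto
  have small: "cmod (f z - k * z) \<le> 1 / 16" if z: "z \<in> ?S" for z :: complex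
  proof -
    have "z \<in> E k" using z k(2) by simp
    then have "cmod (f z - k * z) \<le> s" by (simp add: E_def)
    moreover have "2 * (c * \<rho>) = cmod ((f z + k * z) - (f z - k * z))"
    proof -
      have "cmod k = c" using k(1) s by auto
      moreover have "(f z + k * z) - (f z - k * z) = 2 * (k * z)" by simp
      ultimately show ?thesis using z by (simp only: norm_mult) simp
    qed
    ultimately have big: "c * \<rho> \<le> cmod (f z + k * z)"
      using norm_triangle_ineq4[of "f z + k * z" "f z - k * z"] s by linarith
    have "cmod (f z - k * z) * (c * \<rho>) \<le> cmod (f z - k * z) * cmod (f z + k * z)"
      by (rule mult_left_mono[OF big norm_ge_zero])
    also have "\<dots> \<le> s\<^sup>2"
      using fac[OF z] k(1) by (elim disjE) (simp_all add: mult.commute)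
    also have "\<dots> \<le> 1 / 16 * (c * \<rho>)" using s by linarith
    finally show ?thesis
      by (rule mult_right_le_imp_le) (use s \<rho> in simp)
  qed
  have "cmod (f z - k * z) \<le> 1 / 16"
  proof (rule maximum_modulus_frontier[of "\<lambda>z. f z - k * z" "cball 0 \<rho>"])
    show "(\<lambda>z. f z - k * z) holomorphic_on interior (cball 0 \<rho>)"
      by (auto intro!: holomorphic_intros f)
    show "continuous_on (closure (cball 0 \<rho>)) (\<lambda>z. f z - k * z)"
      by (auto intro!: continuous_intros f)
  qed (use small z in auto)
  moreover have "cmod (k * z) = c * cmod z" using k(1) s by (auto simp: norm_mult)
  ultimately show ?thesis
    using norm_triangle_ineq[of "f z - k * z" "k * z"] by simp
qed

text \<open>Weierstrass factorization writes a meromorphic function as a quotient without common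
  zeros. The radius r < 1 keeps zeros and poles from accumulating at the frontier. The value y0,
  neither 0 nor infinity, excludes the constant maps 0 and infinity.\<close>

lemma P1_disc_lift:
  assumes g: "holomorphic_into_P1 g (ball 0 1)" and \<tau>0: "\<tau>0 \<in> ball 0 1" "g \<tau>0 = Some y0" "y0 \<noteq> 0" and r: "0 < r" "r < 1"
  obtains g0 g1 where "g0 holomorphic_on ball 0 r" "g1 holomorphic_on ball 0 r"
    "\<And>\<tau>. \<tau> \<in> ball 0 r \<Longrightarrow> g0 \<tau> \<noteq> 0 \<or> g1 \<tau> \<noteq> 0"
    "\<And>\<tau>. \<tau> \<in> ball 0 r \<Longrightarrow> g \<tau> = (if g0 \<tau> = 0 then None else Some (g1 \<tau> / g0 \<tau>))"
proof -
  \<comment> \<open>The value 0 at a pole is the convention of \<open>nicely_meromorphic_on\<close>;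
    with it, a map constantly equal to infinity would turn into the zero function.\<close>
  define G where "G \<tau> = (case g \<tau> of None \<Rightarrow> 0 | Some y \<Rightarrow> y)" for \<tau>
  let ?D = "ball (0::complex) 1"
  have loc: "(\<exists>V h. open V \<and> \<sigma> \<in> V \<and> h holomorphic_on V \<and> (\<forall>z\<in>V. G z = h z) \<and> g \<sigma> \<noteq> None) \<or>
     (\<exists>V h. open V \<and> \<sigma> \<in> V \<and> h holomorphic_on V \<and> (\<forall>z\<in>V. G z = inverse (h z)) \<and> h \<sigma> = 0 \<and> g \<sigma> = None)"
    if \<sigma>: "\<sigma> \<in> ?D" for \<sigma>
  proof -
    obtain V ch h where V: "open V" "\<sigma> \<in> V" "ch \<in> P1_charts" "h holomorphic_on V" "\<forall>z\<in>V. g z = ch (h z)"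
      using g \<sigma> unfolding holomorphic_into_P1_def by meson
    consider "ch = Some" | "ch = chart_inf" "h \<sigma> = 0" | "ch = chart_inf" "h \<sigma> \<noteq> 0"
      using V(3) by (auto simp: P1_charts_def)
    then show ?thesis
    proof cases
      case 1
      then show ?thesis using V by (intro disjI1 exI[of _ V] exI[of _ h]) (auto simp: G_def)
    next
      case 2
      then show ?thesis using V
        by (intro disjI2 exI[of _ V] exI[of _ h]) (auto simp: G_def chart_inf_def inverse_eq_divide)
    next
      case 3
      have "open (V \<inter> h -` (- {0}))"
        using continuous_open_preimage[OF holomorphic_on_imp_continuous_on[OF V(4)] V(1)] by auto
      then show ?thesis using V 3
        by (intro disjI1 exI[of _ "V \<inter> h -` (- {0})"] exI[of _ "\<lambda>z. inverse (h z)"])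
          (auto simp: G_def chart_inf_def inverse_eq_divide intro!: holomorphic_intros intro: holomorphic_on_subset)
    qed
  qed
  have an: "G analytic_on {\<sigma>}" if \<sigma>: "\<sigma> \<in> ?D" "g \<sigma> \<noteq> None" for \<sigma>
  proof -
    obtain V h where V: "open V" "\<sigma> \<in> V" "h holomorphic_on V" "\<forall>z\<in>V. G z = h z"
      using loc[OF \<sigma>(1)] \<sigma>(2) by blast
    then have "G holomorphic_on V" using holomorphic_transform[OF V(3)] by simp
    then show "G analytic_on {\<sigma>}" using V by (meson analytic_at)
  qed
  have pole: "(\<exists>V h. open V \<and> \<sigma> \<in> V \<and> h holomorphic_on V \<and> (\<forall>z\<in>V. G z = inverse (h z)) \<and> h \<sigma> = 0)" "G \<sigma> = 0"
    if "\<sigma> \<in> ?D" "g \<sigma> = None" for \<sigma>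
    using loc[OF that(1)] that(2) by (auto simp: G_def)
  have polar: "is_pole G \<sigma>" if \<sigma>: "\<sigma> \<in> ?D" "g \<sigma> = None" "\<forall>\<^sub>F z in at \<sigma>. G z \<noteq> 0" for \<sigma>
  proof -
    obtain V h where V: "open V" "\<sigma> \<in> V" "h holomorphic_on V" "\<forall>z\<in>V. G z = inverse (h z)" "h \<sigma> = 0"
      using pole(1)[OF \<sigma>(1,2)] by blast
    have evV: "\<forall>\<^sub>F z in at \<sigma>. z \<in> V" using V eventually_at_in_open' by blast
    have "isCont h \<sigma>" using V by (meson continuous_on_eq_continuous_at holomorphic_on_imp_continuous_on)
    then have "h \<midarrow>\<sigma>\<rightarrow> 0" using V(5) by (simp add: isCont_def)
    moreover have "\<forall>\<^sub>F z in at \<sigma>. h z \<noteq> 0"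
      using \<sigma>(3) evV by eventually_elim (use V in auto)
    ultimately have "filterlim h (at 0) (at \<sigma>)" by (simp add: filterlim_at)
    then have "filterlim (\<lambda>z. inverse (h z)) at_infinity (at \<sigma>)"
      by (rule filterlim_compose[OF filterlim_inverse_at_infinity])
    moreover have "\<forall>\<^sub>F z in at \<sigma>. inverse (h z) = G z"
      using evV by eventually_elim (use V in auto)
    ultimately show "is_pole G \<sigma>"
      unfolding is_pole_def using filterlim_cong[OF refl refl, of "\<lambda>z. inverse (h z)" G "at \<sigma>" at_infinity] by simp
  qed
  have nice: "G nicely_meromorphic_on ?D"
    unfolding nicely_meromorphic_on_def
  proof (intro conjI ballI)
    show "G meromorphic_on ?D"
    proof (subst meromorphic_on_meromorphic_at, intro ballI)
      fix \<sigma> assume \<sigma>: "\<sigma> \<in> ?D"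
      show "G meromorphic_on {\<sigma>}"
      proof (cases "g \<sigma> = None")
        case False
        then show ?thesis using an[OF \<sigma>] by (simp add: analytic_on_imp_meromorphic_on)
      next
        case True
        obtain V h where V: "open V" "\<sigma> \<in> V" "h holomorphic_on V" "\<forall>z\<in>V. G z = inverse (h z)" "h \<sigma> = 0"
          using pole(1)[OF \<sigma> True] by blast
        have "h analytic_on {\<sigma>}" using V by (meson analytic_at)
        then have "(\<lambda>z. inverse (h z)) meromorphic_on {\<sigma>}"
          by (intro meromorphic_intros analytic_on_imp_meromorphic_on)
        moreover have "\<forall>\<^sub>F z in at \<sigma>. G z = inverse (h z)"
          using eventually_at_in_open'[OF V(1,2)] by eventually_elim (use V in auto)
        ultimately show ?thesis using meromorphic_on_cong[of "{\<sigma>}" G "\<lambda>z. inverse (h z)"] by auto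
      qed
    qed
    fix \<sigma> assume \<sigma>: "\<sigma> \<in> ?D"
    show "is_pole G \<sigma> \<and> G \<sigma> = 0 \<or> G \<midarrow>\<sigma>\<rightarrow> G \<sigma>"
    proof (cases "g \<sigma> = None")
      case False
      then show ?thesis using an[OF \<sigma>] analytic_at_imp_isCont isContD by blast
    next
      case True
      obtain V h where V: "open V" "\<sigma> \<in> V" "h holomorphic_on V" "\<forall>z\<in>V. G z = inverse (h z)" "h \<sigma> = 0"
        using pole(1)[OF \<sigma> True] by blast
      have evV: "\<forall>\<^sub>F z in at \<sigma>. z \<in> V" using V eventually_at_in_open' by blast
      have "h analytic_on {\<sigma>}" using V by (meson analytic_at)
      then have "(\<forall>\<^sub>F z in at \<sigma>. h z = 0) \<or> (\<forall>\<^sub>F z in at \<sigma>. h z \<noteq> 0)"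
        using non_zero_neighbour[OF isolated_singularity_at_analytic not_essential_analytic]
        by (auto simp: frequently_def)
      then show ?thesis
      proof
        assume "\<forall>\<^sub>F z in at \<sigma>. h z = 0"
        then have "\<forall>\<^sub>F z in at \<sigma>. 0 = G z" using evV by eventually_elim (use V in auto)
        then have "G \<midarrow>\<sigma>\<rightarrow> 0" by (rule Lim_transform_eventually[OF tendsto_const])
        then show ?thesis using pole(2)[OF \<sigma> True] by simp
      next
        assume "\<forall>\<^sub>F z in at \<sigma>. h z \<noteq> 0"
        then have "\<forall>\<^sub>F z in at \<sigma>. G z \<noteq> 0" using evV by eventually_elim (use V in auto)
        then show ?thesis using polar[OF \<sigma> True] pole(2)[OF \<sigma> True] by blast
      qed
    qed
  qed
  \<comment> \<open>Zeros of \<open>G\<close>, which by the convention include its poles, are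
    isolated: otherwise the identity theorem would give \<open>G\<close> = 0 at
    \<open>\<tau>0\<close>.\<close>
  have nz: "\<forall>\<^sub>F z in at \<sigma>. G z \<noteq> 0" if "\<sigma> \<in> ?D" for \<sigma>
  proof (rule ccontr)
    assume "\<not> ?thesis"
    then have "\<exists>\<^sub>F z in at \<sigma>. G z = 0" by (simp add: frequently_def)
    then have "G \<tau>0 = 0"
      using frequently_eq_meromorphic_imp_constant[OF _ nice open_ball _ that \<tau>0(1)] by (simp add: convex_connected)
    then show False using \<tau>0 by (simp add: G_def)
  qed
  have is_pole_iff: "is_pole G \<sigma> \<longleftrightarrow> g \<sigma> = None" if "\<sigma> \<in> ?D" for \<sigma>
    using polar[OF that _ nz[OF that]] an[OF that] analytic_at_imp_no_pole by blast
  have sub: "ball 0 r \<subseteq> ?D" using r by auto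
  have fr: "\<not> z islimpt {w \<in> ball 0 r. G w = 0 \<or> is_pole G w}" if "z \<in> frontier (ball 0 r)" for z
  proof
    assume *: "z islimpt {w \<in> ball 0 r. G w = 0 \<or> is_pole G w}"
    have "z \<in> ?D" using that r by auto
    have "z islimpt {w. G w = 0}"
    proof (rule islimpt_subset[OF *], safe)
      fix w assume "w \<in> ball 0 r" "is_pole G w"
      then show "G w = 0" using is_pole_iff[of w] pole(2)[of w] sub by blast
    qed
    then have "\<exists>\<^sub>F w in at z. w \<in> {w. G w = 0}" by (simp only: islimpt_conv_frequently_at)
    then show False using nz[OF \<open>z \<in> ?D\<close>] by (simp add: frequently_def)
  qed
  obtain h f1 f2 where w: "h holomorphic_on ball 0 r" "f1 holomorphic_on UNIV" "f2 holomorphic_on UNIV"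
    "\<forall>z\<in>ball 0 r. f1 z = 0 \<longleftrightarrow> \<not> is_pole G z \<and> G z = 0" "\<forall>z\<in>ball 0 r. f2 z = 0 \<longleftrightarrow> is_pole G z"
    "\<forall>z\<in>ball 0 r. h z \<noteq> 0" "\<forall>z\<in>ball 0 r. G z = h z * f1 z / f2 z"
  proof (rule weierstrass_factorization_meromorphic[OF nicely_meromorphic_on_subset[OF nice sub] open_ball convex_connected[OF convex_ball] fr], assumption, goal_cases)
    case (1 h f1 f2)
    then show ?case by (intro that[of h f1 f2])
  qed
  show thesis
  proof (rule that[of f2 "\<lambda>z. h z * f1 z"])
    show "f2 holomorphic_on ball 0 r" "(\<lambda>z. h z * f1 z) holomorphic_on ball 0 r"
      by (auto intro!: holomorphic_intros w(1) intro: holomorphic_on_subset[OF w(2)] holomorphic_on_subset[OF w(3)])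
    fix \<tau> assume \<tau>: "\<tau> \<in> ball (0::complex) r"
    show "f2 \<tau> \<noteq> 0 \<or> h \<tau> * f1 \<tau> \<noteq> 0" using w(4-6) \<tau> by auto
    show "g \<tau> = (if f2 \<tau> = 0 then None else Some (h \<tau> * f1 \<tau> / f2 \<tau>))"
    proof (cases "g \<tau>")
      case None
      then show ?thesis using is_pole_iff[of \<tau>] w(5) \<tau> sub by auto
    next
      case (Some y)
      then have "G \<tau> = y" by (simp add: G_def)
      then show ?thesis using is_pole_iff[of \<tau>] w(5,7) \<tau> sub Some by auto
    qed
  qed
qed

section \<open>From bounds on the solution to bounds along a disc\<close>

lemma holomorphic_log_ball:
  assumes "f holomorphic_on ball p R" "\<And>z. z \<in> ball p R \<Longrightarrow> f z \<noteq> 0"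
  obtains l where "l holomorphic_on ball p R" "\<And>z. z \<in> ball p R \<Longrightarrow> ln ((cmod (f z))\<^sup>2) = Re (l z)"
proof -
  obtain l where l: "l holomorphic_on ball p R" "\<And>z. z \<in> ball p R \<Longrightarrow> f z = exp (l z)"
    using contractible_imp_holomorphic_log[of f "ball p R"] assms convex_imp_contractible[OF convex_ball] by metis
  show thesis
  proof (rule that[of "\<lambda>z. 2 * l z"])
    show "(\<lambda>z. 2 * l z) holomorphic_on ball p R" by (intro holomorphic_intros l)
    fix z assume "z \<in> ball p R"
    then show "ln ((cmod (f z))\<^sup>2) = Re (2 * l z)"
      using l(2) by (simp add: norm_exp_eq_Re ln_realpow)
  qed
qed

lemma HMAE_solution_lower:
  assumes sub: "(\<lambda>x. ereal (branched_data c x - 1)) \<in> HMAE_subsolutions \<phi>"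
    and fin: "\<And>y. p = Some y \<Longrightarrow> HMAE_solution \<phi> (p, t) < \<infinity>"
  shows "branched_data c (p, t) - 1 \<le> real_of_ereal (HMAE_solution \<phi> (p, t))"
proof -
  have le: "ereal (branched_data c (p, t) - 1) \<le> HMAE_solution \<phi> (p, t)"
    unfolding HMAE_solution_def by (rule SUP_upper2[OF sub]) simp
  show ?thesis
  proof (cases "HMAE_solution \<phi> (p, t)")
    \<comment> \<open>\<open>real_of_ereal\<close> sends infinity to 0. The upper bound covers
      finite points only, but at the point at infinity the claim then reads -1 <= 0.\<close>
    case PInf
    then have "p = None" using fin by (cases p) auto
    then show ?thesis using PInf by (simp add: branched_data_def)
  qed (use le in auto)
qed

lemma HMAE_solution_upper:
  assumes "\<And>v. v \<in> HMAE_subsolutions \<phi> \<Longrightarrow> ereal a + v x \<le> ereal b"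
  shows "HMAE_solution \<phi> x \<le> ereal (b - a)"
  unfolding HMAE_solution_def
proof (rule SUP_least)
  fix v assume "v \<in> HMAE_subsolutions \<phi>"
  from assms[OF this] show "v x \<le> ereal (b - a)" by (cases "v x") auto
qed

text \<open>In homogeneous coordinates \<open>(g0, g1)\<close> of the disc, \<open>ln (\<bar>g0\<bar>\<^sup>2 + \<bar>g1\<bar>\<^sup>2) + \<Phi>\<close> is weakly
  harmonic also at the poles of the disc, and \<open>K = g0 * exp (- H / 2)\<close> below is the first
  coordinate of the lift along which the mollified potential vanishes. It is bounded above
  because \<open>\<Phi>\<close> is bounded below, and bounded below at one point; a Cauchy estimate then bounds it
  below nearby, which excludes poles and bounds the potential.\<close>

lemma harmonic_disc_near_branched_curve:
  fixes \<Phi> :: "complex option \<times> complex \<Rightarrow> ereal"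
  assumes disc: "harmonic_disc \<Phi> g" and c: "c > 0"
    and low: "\<And>\<tau>. \<tau> \<in> ball 0 1 \<Longrightarrow> branched_data c (g \<tau>, \<tau>) - 1 \<le> real_of_ereal (\<Phi> (g \<tau>, \<tau>))"
    and up: "\<And>y \<tau>. \<tau> \<in> ball 0 1 \<Longrightarrow> g \<tau> = Some y \<Longrightarrow> cmod (y\<^sup>2 - (complex_of_real c)\<^sup>2 * \<tau>\<^sup>2) < 1 \<Longrightarrow>
        FS_pot y + real_of_ereal (\<Phi> (g \<tau>, \<tau>)) \<le> 5"
    and \<tau>0: "cmod \<tau>0 < 1 / 1000" "g \<tau>0 = Some y0" "y0 \<noteq> 0" "cmod (y0\<^sup>2 - (complex_of_real c)\<^sup>2 * \<tau>0\<^sup>2) < 1"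
  obtains f where "f holomorphic_on ball 0 (1 / 1000)" "continuous_on (cball 0 (1 / 1000)) f" "f \<tau>0 = y0"
    "\<And>z. z \<in> cball 0 (1 / 1000) \<Longrightarrow> cmod ((f z)\<^sup>2 - (complex_of_real c)\<^sup>2 * z\<^sup>2) \<le> 243\<^sup>2"
proof -
  define u where "u \<tau> = real_of_ereal (\<Phi> (g \<tau>, \<tau>))" for \<tau>
  \<comment> \<open>Nested radii: the lift lives on 3/4, averages of radius at most 1/16 are centred
    in the disc of radius 5/8, \<open>L\<close> is uniformly continuous on 11/16 = 5/8 + 1/16, and
    Cauchy circles of radius 1/2 are centred in the disc of radius 1/8.\<close>
  let ?B = "ball (0::complex) (3/4)"
  have g: "holomorphic_into_P1 g (ball 0 1)"
    and harm: "\<And>V h ch. ch \<in> P1_charts \<Longrightarrow> open V \<Longrightarrow> V \<subseteq> ball 0 1 \<Longrightarrow> h holomorphic_on V \<Longrightarrow> (\<And>\<tau>. \<tau> \<in> V \<Longrightarrow> g \<tau> = ch (h \<tau>)) \<Longrightarrow>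
        ddc_vanishes_on V (\<lambda>\<tau>. FS_pot (h \<tau>) + u \<tau>)"
    using disc unfolding harmonic_disc_def u_def by blast+
  obtain g0 g1 where g01: "g0 holomorphic_on ?B" "g1 holomorphic_on ?B"
    "\<And>\<tau>. \<tau> \<in> ?B \<Longrightarrow> g0 \<tau> \<noteq> 0 \<or> g1 \<tau> \<noteq> 0"
    "\<And>\<tau>. \<tau> \<in> ?B \<Longrightarrow> g \<tau> = (if g0 \<tau> = 0 then None else Some (g1 \<tau> / g0 \<tau>))"
    by (rule P1_disc_lift[OF g _ \<tau>0(2,3), of "3/4"]) (use \<tau>0 in auto)
  have cg: "continuous_on ?B g0" "continuous_on ?B g1"
    using g01 holomorphic_on_imp_continuous_on by auto
  \<comment> \<open>The potential on the lift. Off the zeros of \<open>g0\<close> or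
    \<open>g1\<close> it differs from the expression in the corresponding chart by the harmonic
    function ln |g0|^2 or ln |g1|^2. \<open>L\<close> is its analogue for
    \<open>branched_data\<close>.\<close>
  define U where "U \<tau> = ln ((cmod (g0 \<tau>))\<^sup>2 + (cmod (g1 \<tau>))\<^sup>2) + u \<tau>" for \<tau>
  define L where "L \<tau> = ln (pot c (g0 \<tau>) (g1 \<tau>) \<tau>) / 2" for \<tau>
  define V0 where "V0 = ?B \<inter> g0 -` (- {0})"
  define V1 where "V1 = ?B \<inter> g1 -` (- {0})"
  have oV: "open V0" "open V1"
    unfolding V0_def V1_def by (intro continuous_open_preimage cg; auto)+
  have U0: "U \<tau> = FS_pot (g1 \<tau> / g0 \<tau>) + u \<tau> + ln ((cmod (g0 \<tau>))\<^sup>2)" if "\<tau> \<in> V0" for \<tau>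
  proof -
    have "g0 \<tau> \<noteq> 0" using that by (simp add: V0_def)
    then have "(cmod (g0 \<tau>))\<^sup>2 + (cmod (g1 \<tau>))\<^sup>2 = (cmod (g0 \<tau>))\<^sup>2 * (1 + (cmod (g1 \<tau> / g0 \<tau>))\<^sup>2)"
      by (simp add: norm_divide field_simps)
    moreover have "1 + (cmod (g1 \<tau> / g0 \<tau>))\<^sup>2 > 0" by (simp add: add_pos_nonneg)
    ultimately show ?thesis
      using \<open>g0 \<tau> \<noteq> 0\<close> by (simp add: U_def FS_pot_def ln_mult)
  qed
  have U1: "U \<tau> = FS_pot (g0 \<tau> / g1 \<tau>) + u \<tau> + ln ((cmod (g1 \<tau>))\<^sup>2)" if "\<tau> \<in> V1" for \<tau>
  proof -
    have "g1 \<tau> \<noteq> 0" using that by (simp add: V1_def)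
    then have "(cmod (g0 \<tau>))\<^sup>2 + (cmod (g1 \<tau>))\<^sup>2 = (cmod (g1 \<tau>))\<^sup>2 * (1 + (cmod (g0 \<tau> / g1 \<tau>))\<^sup>2)"
      by (simp add: norm_divide field_simps)
    moreover have "1 + (cmod (g0 \<tau> / g1 \<tau>))\<^sup>2 > 0" by (simp add: add_pos_nonneg)
    ultimately show ?thesis
      using \<open>g1 \<tau> \<noteq> 0\<close> by (simp add: U_def FS_pot_def ln_mult)
  qed
  have L_scale: "ln (pot c (s * x) (s * y) \<tau>) / 2 = ln ((cmod s)\<^sup>2) + ln (pot c x y \<tau>) / 2"
    if "s \<noteq> 0" "x \<noteq> 0 \<or> y \<noteq> 0" for s x y \<tau>
    unfolding pot_scale using that pot_pos[OF that(2), of c \<tau>] by (simp add: ln_mult ln_realpow)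
  have UL: "L \<tau> - 1 \<le> U \<tau>" if \<tau>: "\<tau> \<in> ?B" for \<tau>
  proof (cases "g0 \<tau> = 0")
    case False
    have "L \<tau> = ln ((cmod (g0 \<tau>))\<^sup>2) + ln (pot c 1 (g1 \<tau> / g0 \<tau>) \<tau>) / 2"
      using L_scale[of "g0 \<tau>" 1 "g1 \<tau> / g0 \<tau>" \<tau>] False by (simp add: L_def)
    moreover have "g \<tau> = Some (g1 \<tau> / g0 \<tau>)" using g01(4)[OF \<tau>] False by simp
    moreover have "\<tau> \<in> V0" "\<tau> \<in> ball 0 1" using \<tau> False by (auto simp: V0_def)
    ultimately show ?thesis
      using low[of \<tau>] FS_pot_branched_data_Some[of "g1 \<tau> / g0 \<tau>" c \<tau>] U0[of \<tau>] by (simp add: u_def)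
  next
    case True
    then have nz: "g1 \<tau> \<noteq> 0" using g01(3)[OF \<tau>] by blast
    then have "L \<tau> = ln ((cmod (g1 \<tau>))\<^sup>2) + ln (pot c 0 1 \<tau>) / 2"
      using L_scale[of "g1 \<tau>" 0 1 \<tau>] True by (simp add: L_def)
    moreover have "g \<tau> = chart_inf 0" using g01(4)[OF \<tau>] True by (simp add: chart_inf_def)
    moreover have "\<tau> \<in> V1" "\<tau> \<in> ball 0 1" using \<tau> nz by (auto simp: V1_def)
    ultimately show ?thesis
      using low[of \<tau>] FS_pot_branched_data_inf[of 0 c \<tau>] U1[of \<tau>] True by (simp add: u_def)
  qed
  have contL: "continuous_on ?B L"
    unfolding L_def by (intro continuous_on_divide continuous_on_ln_pot cg continuous_on_const continuous_on_id g01(3)) auto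
  \<comment> \<open>A Lebesgue number: each small ball lies in one chart, where \<open>g0\<close> or
    \<open>g1\<close> has a holomorphic logarithm.\<close>
  obtain \<delta> where \<delta>: "\<delta> > 0" "\<And>p. p \<in> cball 0 (5/8) \<Longrightarrow> ball p \<delta> \<subseteq> V0 \<or> ball p \<delta> \<subseteq> V1"
  proof -
    have "cball 0 (5/8) \<subseteq> \<Union> {V0, V1}"
      using g01(3) by (auto simp: V0_def V1_def)
    then show thesis
      using Heine_Borel_lemma[of "cball 0 (5/8)" "{V0, V1}"] oV that by (auto simp: ball_simps)
  qed
  have "uniformly_continuous_on (cball 0 (11/16)) L"
    by (rule compact_uniformly_continuous[OF continuous_on_subset[OF contL]]) auto
  then obtain d1 where d1: "d1 > 0" "\<And>x y. x \<in> cball 0 (11/16) \<Longrightarrow> y \<in> cball 0 (11/16) \<Longrightarrow> dist y x < d1 \<Longrightarrow> dist (L y) (L x) < 1"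
    unfolding uniformly_continuous_on_def using zero_less_one by metis
  have \<tau>0B: "\<tau>0 \<in> ?B" using \<tau>0 by simp
  have g00: "g0 \<tau>0 \<noteq> 0" "g1 \<tau>0 / g0 \<tau>0 = y0"
    using g01(4)[OF \<tau>0B] \<tau>0(2) by (auto split: if_splits)
  \<comment> \<open>The upper bound on the solution is available only where |Q| < 1, and the average
    at \<open>\<tau>0\<close> needs it on a whole disc. There ln |g0|^2 also stays below its central
    value plus 1.\<close>
  define T where "T = {x \<in> V0. cmod ((g1 x / g0 x)\<^sup>2 - (complex_of_real c)\<^sup>2 * x\<^sup>2) < 1 \<and> ln ((cmod (g0 x))\<^sup>2) < ln ((cmod (g0 \<tau>0))\<^sup>2) + 1}"
  have "open T"
  proof -
    have cV: "continuous_on V0 g0" "continuous_on V0 g1"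
      using cg by (auto simp: V0_def intro: continuous_on_subset)
    have "open (V0 \<inter> (\<lambda>x. cmod ((g1 x / g0 x)\<^sup>2 - (complex_of_real c)\<^sup>2 * x\<^sup>2)) -` {..<1})"
      by (intro continuous_open_preimage continuous_intros cV oV) (auto simp: V0_def)
    moreover have "open (V0 \<inter> (\<lambda>x. ln ((cmod (g0 x))\<^sup>2)) -` {..<ln ((cmod (g0 \<tau>0))\<^sup>2) + 1})"
      by (intro continuous_open_preimage continuous_intros cV oV) (auto simp: V0_def)
    moreover have "T = (V0 \<inter> (\<lambda>x. cmod ((g1 x / g0 x)\<^sup>2 - (complex_of_real c)\<^sup>2 * x\<^sup>2)) -` {..<1}) \<inter>
        (V0 \<inter> (\<lambda>x. ln ((cmod (g0 x))\<^sup>2)) -` {..<ln ((cmod (g0 \<tau>0))\<^sup>2) + 1})"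
      by (auto simp: T_def)
    ultimately show ?thesis by (simp add: open_Int)
  qed
  moreover have "\<tau>0 \<in> T" using \<tau>0 \<tau>0B g00 by (simp add: T_def V0_def)
  ultimately obtain d2 where d2: "d2 > 0" "cball \<tau>0 d2 \<subseteq> T"
    using open_contains_cball by blast
  \<comment> \<open>One radius for all centres, so that \<open>mollify r U\<close> is a single
    function. The bounds give, in order: a disc of radius 2 r in one chart, oscillation of
    \<open>L\<close> below 1, containment in \<open>T\<close>, containment in the disc of radius
    11/16.\<close>
  define r where "r = min (\<delta> / 3) (min (d1 / 2) (min d2 (1 / 16)))"
  have r: "r > 0" "2 * r < \<delta>" "r < d1" "r \<le> d2" "r \<le> 1 / 16"
    using \<delta> d1 d2 by (auto simp: r_def min_def)
  have loc: "set_integrable lborel (cball p (2 * r)) U \<and> (mollify r U has_derivative (\<lambda>k. Re (mollify_grad r U p * k))) (at p)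
      \<and> mollify_grad r U field_differentiable (at p)" if p: "p \<in> cball 0 (5/8)" for p
  proof -
    have cb: "cball p (2 * r) \<subseteq> ball p \<delta>" using r by auto
    from \<delta>(2)[OF p] show ?thesis
    proof
      assume V: "ball p \<delta> \<subseteq> V0"
      obtain l where l: "l holomorphic_on ball p \<delta>" "\<And>z. z \<in> ball p \<delta> \<Longrightarrow> ln ((cmod (g0 z))\<^sup>2) = Re (l z)"
        using holomorphic_log_ball[of g0 p \<delta>] holomorphic_on_subset[OF g01(1)] V by (auto simp: V0_def subset_iff)
      have Ul: "U x = FS_pot (g1 x / g0 x) + u x + Re (l x)" if "x \<in> ball p \<delta>" for x
        using U0[of x] l(2)[OF that] V that by auto
      have v: "ddc_vanishes_on V0 (\<lambda>\<tau>. FS_pot (g1 \<tau> / g0 \<tau>) + u \<tau>)"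
        by (rule harm[of Some])
          (use oV g01 in \<open>auto simp: P1_charts_def V0_def intro!: holomorphic_intros intro: holomorphic_on_subset\<close>)
      show ?thesis
        using mollify_local[OF r(1) cb V v l(1) Ul] by blast
    next
      assume V: "ball p \<delta> \<subseteq> V1"
      obtain l where l: "l holomorphic_on ball p \<delta>" "\<And>z. z \<in> ball p \<delta> \<Longrightarrow> ln ((cmod (g1 z))\<^sup>2) = Re (l z)"
        using holomorphic_log_ball[of g1 p \<delta>] holomorphic_on_subset[OF g01(2)] V by (auto simp: V1_def subset_iff)
      have Ul: "U x = FS_pot (g0 x / g1 x) + u x + Re (l x)" if "x \<in> ball p \<delta>" for x
        using U1[of x] l(2)[OF that] V that by auto
      have v: "ddc_vanishes_on V1 (\<lambda>\<tau>. FS_pot (g0 \<tau> / g1 \<tau>) + u \<tau>)"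
        by (rule harm[of chart_inf])
          (use oV g01 in \<open>auto simp: P1_charts_def V1_def chart_inf_def intro!: holomorphic_intros intro: holomorphic_on_subset\<close>)
      show ?thesis
        using mollify_local[OF r(1) cb V v l(1) Ul] by blast
    qed
  qed
  have int: "set_integrable lborel (cball p r) U" if "p \<in> cball 0 (5/8)" for p
    by (rule set_integrable_subset[of _ "cball p (2 * r)"]) (use loc[OF that] r in auto)
  let ?A = "mollify r U"
  \<comment> \<open>One unit is lost to the shift of the subsolution and one to the oscillation of
    \<open>L\<close>.\<close>
  have A_ge: "L p - 2 \<le> ?A p" if p: "p \<in> cball 0 (5/8)" for p
  proof (rule mollify_ge[OF r(1) int[OF p]])
    fix x assume x: "x \<in> cball p r"
    have xn: "cmod x \<le> 11/16"
      using norm_triangle_ineq4[of p "p - x"] x p r by (simp add: dist_norm)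
    have "dist (L x) (L p) < 1"
      by (rule d1(2)) (use x xn p r in \<open>auto simp: dist_commute\<close>)
    then show "L p - 2 \<le> U x" using UL[of x] xn by (simp add: dist_real_def)
  qed
  \<comment> \<open>5 from the upper bound on the solution and 1 from the variation of ln
    |g0|^2.\<close>
  have A_le: "?A \<tau>0 \<le> ln ((cmod (g0 \<tau>0))\<^sup>2) + 6"
  proof (rule mollify_le[OF r(1) int])
    show "\<tau>0 \<in> cball 0 (5/8)" using \<tau>0 by simp
    fix x assume "x \<in> cball \<tau>0 r"
    then have x: "x \<in> T" using d2 r by auto
    then have "g x = Some (g1 x / g0 x)" "x \<in> ball 0 1"
      using g01(4)[of x] by (auto simp: T_def V0_def)
    then have "FS_pot (g1 x / g0 x) + u x \<le> 5"
      using up[of x] x by (simp add: T_def u_def)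
    then show "U x \<le> ln ((cmod (g0 \<tau>0))\<^sup>2) + 6"
      using U0[of x] x by (simp add: T_def)
  qed
  obtain Hh where Hh: "Hh holomorphic_on ball 0 (5/8)" "\<And>p. p \<in> ball 0 (5/8) \<Longrightarrow> ?A p = Re (Hh p)"
    using harmonic_imp_Re_holomorphic[of 0 "5/8" ?A "mollify_grad r U"] loc by auto
  define K where "K z = g0 z * exp (- Hh z / 2)" for z
  have holK: "K holomorphic_on ball 0 (5/8)"
    unfolding K_def by (intro holomorphic_intros Hh holomorphic_on_subset[OF g01(1)]) auto
  have K2: "(cmod (K z))\<^sup>2 = (cmod (g0 z))\<^sup>2 * exp (- ?A z)" if "z \<in> ball 0 (5/8)" for z
    using Hh(2)[OF that] by (simp add: K_def norm_mult power_mult_distrib norm_exp_eq_Re exp_double[symmetric] flip: exp_of_nat_mult)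
  have e3: "exp 1 \<le> (3::real)" by (rule exp_le)
  have pow_e: "exp (real n) \<le> 3 ^ n" for n :: nat
    using power_mono[OF e3, of n] by (simp add: exp_of_nat_mult[symmetric])
  \<comment> \<open>\<open>pot\<close> contains the term |g0|^4, so ln |g0|^2 <= L <= A + 2, with A
    the average; hence |K|^2 <= e^2 <= 9.\<close>
  have K_le: "cmod (K z) \<le> 3" if z: "z \<in> ball 0 (5/8)" for z
  proof (cases "g0 z = 0")
    case False
    have zB: "z \<in> ?B" "z \<in> cball 0 (5/8)" using z by auto
    have "((cmod (g0 z))\<^sup>2)\<^sup>2 \<le> pot c (g0 z) (g1 z) z" by (simp add: pot_def norm_power)
    then have "ln (((cmod (g0 z))\<^sup>2)\<^sup>2) \<le> ln (pot c (g0 z) (g1 z) z)"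
      using False by (intro ln_mono) (auto simp: pot_pos)
    then have "ln ((cmod (g0 z))\<^sup>2) \<le> L z" using False by (simp add: L_def ln_realpow)
    then have "ln ((cmod (g0 z))\<^sup>2) \<le> ?A z + 2" using A_ge[OF zB(2)] by linarith
    then have "exp (ln ((cmod (g0 z))\<^sup>2)) \<le> exp (?A z + 2)" by simp
    then have "(cmod (g0 z))\<^sup>2 \<le> exp (?A z) * exp 2" using False by (simp add: exp_add)
    then have "(cmod (K z))\<^sup>2 \<le> exp 2"
      unfolding K2[OF z] by (simp add: exp_minus field_simps)
    also have "\<dots> \<le> 3\<^sup>2" using pow_e[of 2] by simp
    finally show ?thesis by (rule power2_le_imp_le) simp
  qed (simp add: K_def)
  \<comment> \<open>|K|^2 >= e^(-6) >= 3^(-6) = (1/27)^2.\<close>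
  have K0: "1 / 27 \<le> cmod (K \<tau>0)"
  proof (rule power2_le_imp_le)
    have z: "\<tau>0 \<in> ball 0 (5/8)" using \<tau>0 by simp
    have "exp (?A \<tau>0) \<le> exp (ln ((cmod (g0 \<tau>0))\<^sup>2) + 6)" using A_le by simp
    also have "\<dots> = (cmod (g0 \<tau>0))\<^sup>2 * exp 6" using g00 by (simp add: exp_add)
    also have "\<dots> \<le> (cmod (g0 \<tau>0))\<^sup>2 * 3 ^ 6" using pow_e[of 6] by (intro mult_left_mono) auto
    finally show "(1 / 27)\<^sup>2 \<le> (cmod (K \<tau>0))\<^sup>2"
      unfolding K2[OF z] by (simp add: exp_minus field_simps)
  qed simp
  \<comment> \<open>Cauchy's estimate gives |K'| <= 3 / (1/2) = 6, so \<open>K\<close> changes by at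
    most 12/1000 between \<open>\<tau>0\<close> and z, and 1/27 - 12/1000 > 1/81. This is what the
    radius 1/1000 is for.\<close>
  have K_ge: "1 / 81 \<le> cmod (K z)" if z: "cmod z \<le> 1 / 1000" for z
  proof -
    have der: "(K has_field_derivative deriv K x) (at x within ball 0 (1 / 8))" "cmod (deriv K x) \<le> 6" if x: "x \<in> ball 0 (1/8)" for x
    proof -
      have sub: "cball x (1/2) \<subseteq> ball 0 (5/8)"
      proof
        fix w assume "w \<in> cball x (1/2)"
        then show "w \<in> ball 0 (5/8)"
          using norm_triangle_ineq4[of x "x - w"] x by (simp add: dist_norm)
      qed
      show "(K has_field_derivative deriv K x) (at x within ball 0 (1 / 8))"
        by (rule has_field_derivative_at_within[OF holomorphic_derivI[OF holK open_ball]]) (use x in auto)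
      have "cmod ((deriv ^^ 1) K x) \<le> fact 1 * 3 / (1/2) ^ 1"
      proof (rule Cauchy_inequality)
        show "K holomorphic_on ball x (1/2)" "continuous_on (cball x (1/2)) K"
          using holomorphic_on_subset[OF holK] continuous_on_subset[OF holomorphic_on_imp_continuous_on[OF holK]] sub
          by (auto simp: subset_iff)
        show "cmod (K w) \<le> 3" if "cmod (x - w) = 1/2" for w
          by (rule K_le, rule subsetD[OF sub]) (use that in \<open>simp add: dist_norm\<close>)
      qed simp
      then show "cmod (deriv K x) \<le> 6" by simp
    qed
    have "cmod (K z - K \<tau>0) \<le> 6 * cmod (z - \<tau>0)"
      by (rule field_differentiable_bound[OF convex_ball der]) (use z \<tau>0 in auto)
    also have "\<dots> \<le> 6 * (2 / 1000)"
      using norm_triangle_ineq4[of z \<tau>0] z \<tau>0 by (intro mult_left_mono) auto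
    finally show ?thesis
      using K0 norm_triangle_ineq2[of "K \<tau>0" "K z"] by (simp add: norm_minus_commute)
  qed
  \<comment> \<open>With A the average, |Q| |g0|^2 <= e^L <= e^(A + 2) = e^2 |g0|^2 / |K|^2 <= 9 *
    81^2 |g0|^2, and 9 * 81^2 = 243^2.\<close>
  have small: "g0 z \<noteq> 0 \<and> cmod ((g1 z / g0 z)\<^sup>2 - (complex_of_real c)\<^sup>2 * z\<^sup>2) \<le> 243\<^sup>2" if z: "cmod z \<le> 1 / 1000" for z
  proof -
    have zB: "z \<in> ball 0 (5/8)" "z \<in> cball 0 (5/8)" using z by auto
    have nz: "g0 z \<noteq> 0" using K_ge[OF z] by (auto simp: K_def)
    have "(1 / 81)\<^sup>2 \<le> (cmod (K z))\<^sup>2" using K_ge[OF z] by (intro power_mono) auto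
    then have "exp (?A z) \<le> 6561 * (cmod (g0 z))\<^sup>2"
      unfolding K2[OF zB(1)] by (simp add: exp_minus field_simps)
    then have "exp (?A z) * exp 2 \<le> 6561 * (cmod (g0 z))\<^sup>2 * 3 ^ 2"
      using pow_e[of 2] by (intro mult_mono) auto
    moreover have "exp (L z) \<le> exp (?A z) * exp 2"
      using A_ge[OF zB(2)] by (simp add: exp_add[symmetric])
    ultimately have "exp (L z) \<le> 59049 * (cmod (g0 z))\<^sup>2" by simp
    moreover have "cmod ((g1 z)\<^sup>2 - (complex_of_real c)\<^sup>2 * z\<^sup>2 * (g0 z)\<^sup>2) \<le> exp (L z)"
    proof -
      have pp: "pot c (g0 z) (g1 z) z > 0" using nz by (simp add: pot_pos)
      have "exp (L z) = sqrt (pot c (g0 z) (g1 z) z)"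
        using pp by (simp add: L_def ln_sqrt[symmetric])
      moreover have "(cmod ((g1 z)\<^sup>2 - (complex_of_real c)\<^sup>2 * z\<^sup>2 * (g0 z)\<^sup>2))\<^sup>2 \<le> pot c (g0 z) (g1 z) z"
        by (simp add: pot_def)
      ultimately show ?thesis by (simp add: real_le_rsqrt)
    qed
    moreover have "(g1 z)\<^sup>2 - (complex_of_real c)\<^sup>2 * z\<^sup>2 * (g0 z)\<^sup>2 = ((g1 z / g0 z)\<^sup>2 - (complex_of_real c)\<^sup>2 * z\<^sup>2) * (g0 z)\<^sup>2"
      using nz by (simp add: field_simps power_divide)
    ultimately have "cmod ((g1 z / g0 z)\<^sup>2 - (complex_of_real c)\<^sup>2 * z\<^sup>2) * (cmod (g0 z))\<^sup>2 \<le> 59049 * (cmod (g0 z))\<^sup>2"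
      by (simp add: norm_mult norm_power)
    then show ?thesis using nz by simp
  qed
  show thesis
  proof (rule that[of "\<lambda>z. g1 z / g0 z"])
    have sub: "cball 0 (1 / 1000) \<subseteq> ?B" by auto
    show "continuous_on (cball 0 (1 / 1000)) (\<lambda>z. g1 z / g0 z)"
      using small by (intro continuous_on_divide continuous_on_subset[OF cg(1) sub] continuous_on_subset[OF cg(2) sub]) auto
    have sub: "ball 0 (1 / 1000) \<subseteq> ?B" by auto
    show "(\<lambda>z. g1 z / g0 z) holomorphic_on ball 0 (1 / 1000)"
      using small by (intro holomorphic_on_divide holomorphic_on_subset[OF g01(1) sub] holomorphic_on_subset[OF g01(2) sub]) auto
  qed (use small g00 in auto)
qed

section \<open>Choice of the constants and conclusion\<close>

theorem theorem3:
  shows "\<exists>\<phi>. smooth_boundary_data \<phi> \<and>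
    (\<exists>U' \<epsilon>. openin (prod_topology P1 (top_of_set (ball 0 1))) U' \<and> U' \<noteq> {} \<and> \<epsilon> > 0 \<and>
      (\<forall>\<phi>'. smooth_boundary_data \<phi>' \<and> C2_norm (\<lambda>x. \<phi>' x - \<phi> x) < \<epsilon> \<longrightarrow>
        \<not> (\<exists>g. harmonic_disc (HMAE_solution \<phi>') g \<and> (\<exists>\<tau>\<in>ball 0 1. (g \<tau>, \<tau>) \<in> U'))))"
proof -
  \<comment> \<open>With radius 1/1000 and s = 243, \<open>near_branched_curve_small\<close> asks
    for c/1000 >= 16 * 243^2 = 944784; here c/1000 = 10^6.\<close>
  define c :: real where "c = 10 ^ 9"
  \<comment> \<open>A point (y0, t0) of this set has |y0| > 1/4, whereas a disc through it would
    force |y0| <= 1/16 + c |t0| < 1/8. Also |Q| <= 9/16 + 1/256 < 1 there, so the upper estimate on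
    the solution is available.\<close>
  define U' where "U' = Some ` ball (1/2 :: complex) (1/4) \<times> ball (0::complex) (1 / (16 * c))"
  have U': "openin (prod_topology P1 (top_of_set (ball 0 1))) U'"
    unfolding U'_def openin_prod_Times_iff
    using openin_P1_Some[of "ball (1/2 :: complex) (1/4)"] openin_open_Int[of "ball (0::complex) (1 / (16 * c))" "ball 0 1"]
    by (auto simp: c_def Int_absorb1 subset_ball)
  have "U' \<noteq> {}" by (auto simp: U'_def c_def)
  have no_disc: "\<not> (\<exists>\<tau>\<in>ball 0 1. (g \<tau>, \<tau>) \<in> U')"
    if \<phi>': "smooth_boundary_data \<phi>'" "C2_norm (\<lambda>x. \<phi>' x - branched_data c x) < 1"
      and g: "harmonic_disc (HMAE_solution \<phi>') g" for \<phi>' g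
  proof
    assume "\<exists>\<tau>\<in>ball 0 1. (g \<tau>, \<tau>) \<in> U'"
    then obtain \<tau>0 y0 where \<tau>0: "g \<tau>0 = Some y0" "dist (1/2) y0 < 1/4" "cmod \<tau>0 < 1 / (16 * c)"
      by (auto simp: U'_def)
    have close: "\<bar>\<phi>' (p, t) - branched_data c (p, t)\<bar> \<le> 1" if "t \<in> sphere 0 1" for p t
    proof -
      have "\<bar>\<phi>' (p, t) - branched_data c (p, t)\<bar> \<le> C2_norm (\<lambda>x. \<phi>' x - branched_data c x)"
      proof (rule abs_le_C2_norm[OF _ that])
        fix ch assume ch: "ch \<in> P1_charts"
        have "local_rep ch (\<lambda>x. \<phi>' x - branched_data c x) = (\<lambda>x. local_rep ch \<phi>' x - local_rep ch (branched_data c) x)"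
          by (auto simp: local_rep_def fun_eq_iff)
        then show "smooth (local_rep ch (\<lambda>x. \<phi>' x - branched_data c x))"
          using \<phi>'(1) ch by (auto intro!: smooth_diff smooth_local_rep_branched_data simp: smooth_boundary_data_def)
      qed
      then show ?thesis using \<phi>'(2) by linarith
    qed
    have sub: "(\<lambda>x. ereal (branched_data c x - 1)) \<in> HMAE_subsolutions \<phi>'"
      by (rule branched_data_subsolution) (use close in \<open>smt (verit)\<close>)
    have upper: "HMAE_solution \<phi>' (Some y, t) \<le> ereal (4 + (cmod (y\<^sup>2 - (complex_of_real c)\<^sup>2 * t\<^sup>2))\<^sup>2 - FS_pot y)"
      if "cmod t \<le> 1" for y t
    proof (rule HMAE_solution_upper, rule subsolution_upper_bound[OF _ _ _ that])
      show "\<phi>' (p, t) \<le> branched_data c (p, t) + 1" if "t \<in> sphere 0 1" for p t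
        using close[OF that, of p] by linarith
    qed (auto simp: c_def)
    have low: "branched_data c (g \<tau>, \<tau>) - 1 \<le> real_of_ereal (HMAE_solution \<phi>' (g \<tau>, \<tau>))" if "\<tau> \<in> ball 0 1" for \<tau>
    proof (rule HMAE_solution_lower[OF sub])
      fix y
      show "HMAE_solution \<phi>' (g \<tau>, \<tau>) < \<infinity>" if "g \<tau> = Some y"
        using upper[of \<tau> y] that \<open>\<tau> \<in> ball 0 1\<close> by (cases "HMAE_solution \<phi>' (Some y, \<tau>)") auto
    qed
    have up: "FS_pot y + real_of_ereal (HMAE_solution \<phi>' (g \<tau>, \<tau>)) \<le> 5"
      if \<tau>: "\<tau> \<in> ball 0 1" "g \<tau> = Some y" and Q: "cmod (y\<^sup>2 - (complex_of_real c)\<^sup>2 * \<tau>\<^sup>2) < 1" for y \<tau>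
    proof -
      have "(cmod (y\<^sup>2 - (complex_of_real c)\<^sup>2 * \<tau>\<^sup>2))\<^sup>2 \<le> 1" using Q by (simp add: power_le_one)
      moreover have "HMAE_solution \<phi>' (g \<tau>, \<tau>) \<noteq> - \<infinity>"
      proof -
        have "ereal (branched_data c (g \<tau>, \<tau>) - 1) \<le> HMAE_solution \<phi>' (g \<tau>, \<tau>)"
          unfolding HMAE_solution_def by (rule SUP_upper2[OF sub]) simp
        then show ?thesis by auto
      qed
      ultimately show ?thesis
        using upper[of \<tau> y] \<tau> by (cases "HMAE_solution \<phi>' (g \<tau>, \<tau>)") auto
    qed
    have y0: "1/4 < cmod y0" "cmod y0 < 3/4"
      using \<tau>0(2) norm_triangle_ineq2[of "1/2" y0] norm_triangle_ineq2[of y0 "1/2"]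
      by (auto simp: dist_norm norm_minus_commute)
    have \<tau>s: "c * cmod \<tau>0 < 1/16" "cmod \<tau>0 < 1/1000"
      using \<tau>0(3) by (auto simp: c_def)
    have Q0: "cmod (y0\<^sup>2 - (complex_of_real c)\<^sup>2 * \<tau>0\<^sup>2) < 1"
    proof -
      have "cmod (y0\<^sup>2 - (complex_of_real c)\<^sup>2 * \<tau>0\<^sup>2) \<le> (cmod y0)\<^sup>2 + (c * cmod \<tau>0)\<^sup>2"
        using norm_triangle_ineq4[of "y0\<^sup>2" "(complex_of_real c)\<^sup>2 * \<tau>0\<^sup>2"]
        by (simp add: norm_mult norm_power power_mult_distrib)
      also have "\<dots> \<le> (3/4)\<^sup>2 + (1/16)\<^sup>2"
        using y0 \<tau>s by (intro add_mono power_mono) (auto simp: c_def)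
      also have "\<dots> < 1" by (simp add: power2_eq_square)
      finally show ?thesis .
    qed
    have "c > 0" by (simp add: c_def)
    obtain f where f: "f holomorphic_on ball 0 (1 / 1000)" "continuous_on (cball 0 (1 / 1000)) f" "f \<tau>0 = y0"
      "\<And>z. z \<in> cball 0 (1 / 1000) \<Longrightarrow> cmod ((f z)\<^sup>2 - (complex_of_real c)\<^sup>2 * z\<^sup>2) \<le> 243\<^sup>2"
    proof (rule harmonic_disc_near_branched_curve[OF g \<open>c > 0\<close>])
      show "y0 \<noteq> 0" using y0 by auto
      fix f
      assume "f holomorphic_on ball 0 (1 / 1000)" "continuous_on (cball 0 (1 / 1000)) f" "f \<tau>0 = y0"
        "\<And>z. z \<in> cball 0 (1 / 1000) \<Longrightarrow> cmod ((f z)\<^sup>2 - (complex_of_real c)\<^sup>2 * z\<^sup>2) \<le> 243\<^sup>2"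
      then show thesis by (rule that)
    qed (rule low up \<tau>s(2) \<tau>0(1) Q0; assumption)+
    have "cmod (f \<tau>0) \<le> 1/16 + c * cmod \<tau>0"
      by (rule near_branched_curve_small[OF f(1,2) _ f(4)]) (use \<tau>s in \<open>auto simp: c_def\<close>)
    then show False using y0 \<tau>s f(3) by simp
  qed
  show ?thesis
  proof (intro exI conjI allI impI)
    show "smooth_boundary_data (branched_data c)"
      by (rule smooth_boundary_data_branched_data) (simp add: c_def)
    show "openin (prod_topology P1 (top_of_set (ball 0 1))) U'" "U' \<noteq> {}" by fact+
    show "(1::real) > 0" by simp
    fix \<phi>'
    assume "smooth_boundary_data \<phi>' \<and> C2_norm (\<lambda>x. \<phi>' x - branched_data c x) < 1"
    then show "\<not> (\<exists>g. harmonic_disc (HMAE_solution \<phi>') g \<and> (\<exists>\<tau>\<in>ball 0 1. (g \<tau>, \<tau>) \<in> U'))"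
      using no_disc by blast
  qed
qed

end
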